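(* Let \[ M := \left\{ (z,w) \in \mathbb{C}^2 : |z|<1,\ \operatorname{Im} w = (\operatorname{Re} w)\,\frac{1-\sqrt{1-|z|^4}}{|z|^2} \right\}. \] Then every formal automorphism of the germ $(M,0)$ converges. Moreover, for $\alpha\in\mathbb{C}$ and $s\in\mathbb{R}$ let $\theta_{\alpha,s}$ be the holomorphic function defined near $0\in\mathbb{C}^2$ by \[ \theta_{\alpha,s}(z,w) := \big(1 - 2i\,\bar{\alpha}\, z w - (s + i|\alpha|^2) w^2\big)^{1/2}, \] where $\zeta\mapsto \zeta^{1/2}$ is the principal branch of the square root. Then \[ \widehat{\mathrm{Aut}}(M,0) = \mathrm{Aut}(M,0) = \left\{ H^{\varepsilon,r}_{\alpha,s}(z,w) := \left( \frac{\varepsilon (z+\alpha w)}{\theta_{\alpha,s}(z,w)},\ \frac{r\,w}{\theta_{\alpha,s}(z,w)}\right) : \varepsilon\in\mathbb{C},\ |\varepsilon|=1,\ r\in\mathbb{R}\setminus\{0\},\ \alpha\in\mathbb{C},\ s\in\mathbb{R} \right\}. \]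
   Context: The quotient $\frac{1-\sqrt{1-|z|^4}}{|z|^2}$ equals $\varphi(|z|^2)$ with $\varphi(t)=(1-\sqrt{1-t^2})/t$ (extended by $\varphi(0)=0$), a real-analytic function on $(-1,1)$; so $M$ is a real-analytic hypersurface through $0$ with real-analytic defining function $\rho(Z,\bar Z)=\operatorname{Im} w - (\operatorname{Re} w)\varphi(|z|^2)$, $Z=(z,w)$. The stability group $\mathrm{Aut}(M,0)$ is the group (under composition) of germs at $0$ of invertible biholomorphic maps $H:\mathbb{C}^2\to\mathbb{C}^2$ defined near $0$ with $H(0)=0$ and $H(M)\subset M$ near $0$. A formal automorphism of $(M,0)$ is a $\mathbb{C}^2$-valued formal power series $H$ in two indeterminates, with $H(0)=0$ and invertible (nonvanishing Jacobian at $0$), such that for a real-analytic local defining function $\rho$ of $M$ there is a formal power series $a$ in four indeterminates with $\rho(H(Z),\overline{H(Z)}) \equiv a(Z,\bar Z)\,\rho(Z,\bar Z)$ as formal power series; the set of these (a group under composition) is the formal stability group $\widehat{\mathrm{Aut}}(M,0)$. A formal automorphism is said to converge if its power series converges in a neighborhood of $0$. *)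

theory Defs
  imports "HOL-Analysis.Analysis" "HOL-Library.Numeral_Type"
begin

text \<open>A formal power series in indeterminates indexed by a finite type 'v is its
coefficient function on multi-indices ('v => nat).\<close>

type_synonym 'v mps = "('v \<Rightarrow> nat) \<Rightarrow> complex"

definition mdeg :: "('v::finite \<Rightarrow> nat) \<Rightarrow> nat" where
  "mdeg m = (\<Sum>v\<in>UNIV. m v)"

definition mpone :: "('v::finite) mps" where
  "mpone = (\<lambda>m. if m = (\<lambda>_. 0) then 1 else 0)"

definition mpvar :: "'v::finite \<Rightarrow> 'v mps" where
  "mpvar v = (\<lambda>m. if m = (\<lambda>u. if u = v then 1 else 0) then 1 else 0)"

definition mpadd :: "('v::finite) mps \<Rightarrow> 'v mps \<Rightarrow> 'v mps" where
  "mpadd f g = (\<lambda>m. f m + g m)"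

definition mpscale :: "complex \<Rightarrow> ('v::finite) mps \<Rightarrow> 'v mps" where
  "mpscale c f = (\<lambda>m. c * f m)"

definition mpmult :: "('v::finite) mps \<Rightarrow> 'v mps \<Rightarrow> 'v mps" where
  "mpmult f g = (\<lambda>m. \<Sum>a\<in>{a. \<forall>v. a v \<le> m v}. f a * g (\<lambda>v. m v - a v))"

definition mppow :: "('v::finite) mps \<Rightarrow> nat \<Rightarrow> 'v mps" where
  "mppow f n = (mpmult f ^^ n) mpone"

text \<open>Substitution of four series (without constant term) into a series in four
indeterminates: coefficient of m in f(g 0, g 1, g 2, g 3).  Only monomials of total
degree at most deg m can contribute, since each g i has zero constant term.\<close>

definition mpsubst4 :: "4 mps \<Rightarrow> (4 \<Rightarrow> ('u::finite) mps) \<Rightarrow> 'u mps" where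
  "mpsubst4 f g = (\<lambda>m. \<Sum>n\<in>{n::4\<Rightarrow>nat. mdeg n \<le> mdeg m}.
      f n * mpmult (mpmult (mppow (g 0) (n 0)) (mppow (g 1) (n 1)))
                   (mpmult (mppow (g 2) (n 2)) (mppow (g 3) (n 3))) m)"

definition mp_term :: "('v::finite) mps \<Rightarrow> ('v \<Rightarrow> complex) \<Rightarrow> ('v \<Rightarrow> nat) \<Rightarrow> complex" where
  "mp_term f x = (\<lambda>m. f m * (\<Prod>v\<in>UNIV. x v ^ m v))"

definition mp_converges :: "('v::finite) mps \<Rightarrow> bool" where
  "mp_converges f \<longleftrightarrow> (\<exists>r>0. \<forall>x. (\<forall>v. norm (x v) < r) \<longrightarrow> mp_term f x summable_on UNIV)"

definition mp_eval :: "('v::finite) mps \<Rightarrow> ('v \<Rightarrow> complex) \<Rightarrow> complex" where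
  "mp_eval f x = infsum (mp_term f x) UNIV"

definition M :: "(complex \<times> complex) set" where
  "M = {(z, w). norm z < 1 \<and>
         Im w = Re w * (1 - sqrt (1 - norm z ^ 4)) / norm z ^ 2}"

definition phi :: "real \<Rightarrow> real" where
  "phi t = (if t = 0 then 0 else (1 - sqrt (1 - t ^ 2)) / t)"

definition phic :: "nat \<Rightarrow> real" where
  "phic n = (deriv ^^ n) phi 0 / fact n"

text \<open>Indeterminates of the defining function: 0 = z, 1 = w, 2 = zbar, 3 = wbar.
rho = Im w - Re w * phi(z zbar) = (w - wbar)/(2i) - (w + wbar)/2 * phi(z zbar).\<close>

definition phis :: "4 mps" where
  "phis = (\<lambda>m. if m 1 = 0 \<and> m 3 = 0 \<and> m 0 = m 2 then complex_of_real (phic (m 0)) else 0)"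

definition rho_ser :: "4 mps" where
  "rho_ser = mpadd (mpscale (1 / (2 * \<i>)) (mpadd (mpvar 1) (mpscale (-1) (mpvar 3))))
                   (mpscale (-1/2) (mpmult (mpadd (mpvar 1) (mpvar 3)) phis))"

text \<open>Embedding a series in (z,w) as a holomorphic series in (z,w,zbar,wbar), and its
conjugate as an antiholomorphic series (in zbar, wbar, with conjugated coefficients).\<close>

definition hol_emb :: "2 mps \<Rightarrow> 4 mps" where
  "hol_emb f = (\<lambda>m. if m 2 = 0 \<and> m 3 = 0 then f (\<lambda>v. if v = 0 then m 0 else m 1) else 0)"

definition ahol_emb :: "2 mps \<Rightarrow> 4 mps" where
  "ahol_emb f = (\<lambda>m. if m 0 = 0 \<and> m 1 = 0 then cnj (f (\<lambda>v. if v = 0 then m 2 else m 3)) else 0)"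

definition unitidx :: "2 \<Rightarrow> (2 \<Rightarrow> nat)" where
  "unitidx v = (\<lambda>u. if u = v then 1 else 0)"

definition formal_aut :: "(2 \<Rightarrow> 2 mps) \<Rightarrow> bool" where
  "formal_aut H \<longleftrightarrow>
     (\<forall>i. H i (\<lambda>_. 0) = 0) \<and>
     H 0 (unitidx 0) * H 1 (unitidx 1) - H 0 (unitidx 1) * H 1 (unitidx 0) \<noteq> 0 \<and>
     (\<exists>a :: 4 mps. mpsubst4 rho_ser
        (\<lambda>v. if v = 0 then hol_emb (H 0) else if v = 1 then hol_emb (H 1)
             else if v = 2 then ahol_emb (H 0) else ahol_emb (H 1))
        = mpmult a rho_ser)"

definition cholo :: "(complex \<times> complex \<Rightarrow> complex \<times> complex) \<Rightarrow> (complex \<times> complex) set \<Rightarrow> bool" where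
  "cholo F U \<longleftrightarrow> open U \<and> (\<forall>p\<in>U. \<exists>L. (F has_derivative L) (at p) \<and>
       (\<forall>c v. L (c * fst v, c * snd v) = (c * fst (L v), c * snd (L v))))"

definition Aut_M0 :: "(complex \<times> complex \<Rightarrow> complex \<times> complex) set" where
  "Aut_M0 = {F. F (0, 0) = (0, 0) \<and>
     (\<exists>U. open U \<and> (0, 0) \<in> U \<and> cholo F U \<and> inj_on F U \<and> open (F ` U) \<and>
          cholo (inv_into U F) (F ` U) \<and> (\<forall>p \<in> M \<inter> U. F p \<in> M))}"

definition germ_eq :: "(complex \<times> complex \<Rightarrow> complex \<times> complex) \<Rightarrow> (complex \<times> complex \<Rightarrow> complex \<times> complex) \<Rightarrow> bool" where
  "germ_eq F G \<longleftrightarrow> (\<exists>U. open U \<and> (0, 0) \<in> U \<and> (\<forall>p\<in>U. F p = G p))"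

definition pt2 :: "complex \<Rightarrow> complex \<Rightarrow> (2 \<Rightarrow> complex)" where
  "pt2 z w = (\<lambda>v. if v = 0 then z else w)"

definition represents :: "(2 \<Rightarrow> 2 mps) \<Rightarrow> (complex \<times> complex \<Rightarrow> complex \<times> complex) \<Rightarrow> bool" where
  "represents H F \<longleftrightarrow> (\<forall>i. mp_converges (H i)) \<and>
     (\<exists>\<delta>>0. \<forall>z w. norm z < \<delta> \<and> norm w < \<delta> \<longrightarrow>
        F (z, w) = (mp_eval (H 0) (pt2 z w), mp_eval (H 1) (pt2 z w)))"

definition theta :: "complex \<Rightarrow> real \<Rightarrow> complex \<Rightarrow> complex \<Rightarrow> complex" where
  "theta \<alpha> s z w = csqrt (1 - 2 * \<i> * cnj \<alpha> * z * w - (of_real s + \<i> * of_real ((norm \<alpha>)\<^sup>2)) * w\<^sup>2)"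

definition Hmap :: "complex \<Rightarrow> real \<Rightarrow> complex \<Rightarrow> real \<Rightarrow> complex \<times> complex \<Rightarrow> complex \<times> complex" where
  "Hmap \<epsilon> r \<alpha> s = (\<lambda>(z, w). (\<epsilon> * (z + \<alpha> * w) / theta \<alpha> s z w, of_real r * w / theta \<alpha> s z w))"

end

theory Submission
  imports Defs "HOL-Complex_Analysis.Complex_Analysis"
begin

text \<open>Write \<open>z\<^sup>*\<close>, \<open>w\<^sup>*\<close> for the conjugate variables. Away from \<open>w = 0\<close> the coordinates
\<open>\<zeta> = z / w\<close>, \<open>\<omega> = - 1 / w\<^sup>2\<close> map the hypersurface to the Heisenberg sphere \<open>Im \<omega> = |\<zeta>|\<^sup>2\<close>, whose
affine automorphisms give the maps \<open>H\<close>. Formally, the hypersurface is \<open>w = w\<^sup>* E (z z\<^sup>*)\<close> with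
\<open>E\<^sup>2 - 1 = 2 \<i> t E\<close>, so an automorphism \<open>(F, G)\<close> satisfies
\<open>G\<^sup>2 - (G\<^sup>*)\<^sup>2 = 2 \<i> F F\<^sup>* G G\<^sup>*\<close> on it. Since \<open>G\<close> vanishes for \<open>w = 0\<close>,
\<open>P = (w / G)\<^sup>2\<close> and \<open>f = w F / G\<close> are power series, and \<open>E\<^sup>2 P\<^sup>* - P = 2 \<i> E f f\<^sup>*\<close>. The
terms of order at most three in \<open>z\<^sup>*\<close> force \<open>P\<close> to be a quadratic polynomial and \<open>f\<close> to be
linear, which is the asserted form of \<open>(F, G)\<close>.

An automorphism germ has a Taylor series by Osgood's lemma. The formal identity for that series follows
from asymptotic expansions along real curves in the hypersurface, followed by division by
\<open>w - w\<^sup>* E (z z\<^sup>*)\<close>. Identities between series in several variables are checked along formal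
curves, where they become identities in an integral domain of univariate series.\<close>

text \<open>For \<open>t = sin x\<close> one has \<open>phi t = tan (x / 2)\<close> and
  \<open>E t = exp (\<i> x)\<close>, which explains the quadratic equation of \<open>E\<close> and
  makes its powers computable. Level 0 is quadratic and gives \<open>f\<^sub>0 = l z\<close>,
  \<open>P\<^sub>0 = |l|\<^sup>2\<close>. Every later level is linear in the new pair
  \<open>(P\<^sub>k, f\<^sub>k)\<close>, with a source term from lower levels. Its kernel is nonzero
  only for \<open>k = 1\<close> and \<open>k = 2\<close>, where \<open>\<alpha>\<close> and
  \<open>s\<close> originate; the source can be nonzero only for \<open>k = 2\<close>, where it
  produces \<open>\<i> |\<alpha>|\<^sup>2\<close>. The quadratic equation has a second root, with
  \<open>1 / phi\<close> in place of \<open>phi\<close>; returning to the hypersurface therefore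
  requires the inequality \<open>|Im w| \<le> |Re w|\<close> as well. An automorphism germ sees only
  real points, where \<open>z\<^sup>*\<close> is tied to \<open>z\<close>; test vectors with
  \<open>x 2 = cnj (x 0)\<close> still determine a power series.\<close>

unbundle no vec_syntax

section \<open>Formal curves\<close>

lemma finite_mdeg_le [simp]: "finite {m::'v::finite \<Rightarrow> nat. mdeg m \<le> N}"
proof (rule finite_subset)
  show "{m::'v \<Rightarrow> nat. mdeg m \<le> N} \<subseteq> (\<Pi>\<^sub>E v\<in>UNIV. {..N})"
  proof
    fix m :: "'v \<Rightarrow> nat" assume "m \<in> {m. mdeg m \<le> N}"
    then have "mdeg m \<le> N" by simp
    moreover have "m v \<le> mdeg m" for v
      using member_le_sum[of v UNIV m] by (simp add: mdeg_def)
    ultimately have "m v \<le> N" for v using le_trans by blast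
    then show "m \<in> (\<Pi>\<^sub>E v\<in>UNIV. {..N})" by auto
  qed
  show "finite (\<Pi>\<^sub>E v\<in>(UNIV::'v set). {..N})"
    by (rule finite_PiE) auto
qed

lemma finite_mdeg_eq [simp]: "finite {m::'v::finite \<Rightarrow> nat. mdeg m = N}"
  by (rule finite_subset[OF _ finite_mdeg_le[of N]]) auto

lemma finite_le_multi [simp]: "finite {a::'v::finite \<Rightarrow> nat. \<forall>v. a v \<le> m v}"
proof (rule finite_subset)
  show "{a::'v \<Rightarrow> nat. \<forall>v. a v \<le> m v} \<subseteq> {a. mdeg a \<le> mdeg m}"
    unfolding mdeg_def by (auto intro: sum_mono)
qed simp

definition curve_monom :: "('v::finite \<Rightarrow> complex fps) \<Rightarrow> ('v \<Rightarrow> nat) \<Rightarrow> complex fps" where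
  "curve_monom c m = (\<Prod>v\<in>UNIV. c v ^ m v)"

text \<open>Only meaningful if all \<open>c v $ 0\<close> vanish: then monomials of degree above \<open>n\<close> do not contribute
to the coefficient of order \<open>n\<close>.\<close>

definition along :: "('v::finite \<Rightarrow> complex fps) \<Rightarrow> 'v mps \<Rightarrow> complex fps" where
  "along c f = Abs_fps (\<lambda>n. \<Sum>m | mdeg m \<le> n. f m * curve_monom c m $ n)"

lemma curve_monom_add: "curve_monom c (\<lambda>v. a v + b v) = curve_monom c a * curve_monom c b"
  by (simp add: curve_monom_def power_add prod.distrib)

lemma mdeg_add: "mdeg (\<lambda>v. a v + b v) = mdeg a + mdeg b"
  by (simp add: mdeg_def sum.distrib)

lemma curve_monom_eq_X_power:
  assumes "\<And>v. c v $ 0 = 0"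
  shows "curve_monom c m = fps_X ^ mdeg m * (\<Prod>v\<in>UNIV. fps_shift 1 (c v) ^ m v)"
proof -
  have "c v = fps_X * fps_shift 1 (c v)" for v
    by (rule fps_ext) (use assms in \<open>auto simp: fps_X_mult_nth\<close>)
  then have "curve_monom c m = (\<Prod>v\<in>UNIV. (fps_X * fps_shift 1 (c v)) ^ m v)"
    unfolding curve_monom_def by (intro prod.cong refl arg_cong2[where f="(^)"])
  also have "\<dots> = (\<Prod>v\<in>UNIV. fps_X ^ m v) * (\<Prod>v\<in>UNIV. fps_shift 1 (c v) ^ m v)"
    by (simp add: power_mult_distrib prod.distrib)
  finally show ?thesis by (simp add: mdeg_def power_sum)
qed

lemma curve_monom_nth_low: "(\<And>v. c v $ 0 = 0) \<Longrightarrow> n < mdeg m \<Longrightarrow> curve_monom c m $ n = 0"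
  by (subst curve_monom_eq_X_power) (auto simp: fps_X_power_mult_nth)

lemma fps_prod_nth_0: "finite A \<Longrightarrow> (\<Prod>a\<in>A. f a) $ 0 = (\<Prod>a\<in>A. f a $ 0)"
  for f :: "'a \<Rightarrow> 'b::comm_ring_1 fps"
  by (induction A rule: finite_induct) auto

lemma curve_monom_nth_mdeg: "(\<And>v. c v $ 0 = 0) \<Longrightarrow> curve_monom c m $ mdeg m = (\<Prod>v\<in>UNIV. (c v $ 1) ^ m v)"
  by (subst curve_monom_eq_X_power) (auto simp: fps_X_power_mult_nth fps_prod_nth_0 fps_nth_power_0)

lemma along_nth: "along c f $ n = (\<Sum>m | mdeg m \<le> n. f m * curve_monom c m $ n)"
  by (simp add: along_def)

lemma along_nth_ge:
  assumes "\<And>v. c v $ 0 = 0" "n \<le> N"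
  shows "along c f $ n = (\<Sum>m | mdeg m \<le> N. f m * curve_monom c m $ n)"
  unfolding along_nth
  by (rule sum.mono_neutral_left) (use assms in \<open>auto intro!: curve_monom_nth_low\<close>)

lemma along_add: "along c (mpadd f g) = along c f + along c g"
  by (rule fps_ext) (simp add: along_nth mpadd_def ring_distribs sum.distrib)

lemma along_scale: "along c (mpscale k f) = fps_const k * along c f"
  by (rule fps_ext) (simp add: along_nth mpscale_def sum_distrib_left mult.assoc)

text \<open>\<open>mps\<close> is a bare function type without ring operations. Multiplicativity
  makes \<open>along c\<close> a homomorphism into the integral domain of univariate series, where
  equations can be rearranged and factors cancelled.\<close>

lemma along_mult:
  fixes c :: "'v::finite \<Rightarrow> complex fps"
  assumes c: "\<And>v. c v $ 0 = 0"
  shows "along c (mpmult f g) = along c f * along c g"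
proof (rule fps_ext)
  fix N
  define D where "D = {m::'v\<Rightarrow>nat. mdeg m \<le> N}"
  have [simp]: "finite D" by (simp add: D_def)
  have le: "mdeg a \<le> mdeg m" if "\<forall>v. a v \<le> m v" for a m :: "'v \<Rightarrow> nat"
    using that by (auto simp: mdeg_def intro: sum_mono)
  define P where "P = (SIGMA l:D. {a. \<forall>v. a v \<le> l v})"
  define h where "h = (\<lambda>(a::'v\<Rightarrow>nat, b::'v\<Rightarrow>nat). f a * g b * curve_monom c (\<lambda>v. a v + b v) $ N)"
  have "(along c f * along c g) $ N = (\<Sum>i=0..N. (\<Sum>a\<in>D. f a * curve_monom c a $ i) * (\<Sum>b\<in>D. g b * curve_monom c b $ (N - i)))"
    unfolding fps_mult_nth by (intro sum.cong refl arg_cong2[where f="(*)"])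
       (auto simp: D_def intro!: along_nth_ge c)
  also have "\<dots> = (\<Sum>i=0..N. \<Sum>a\<in>D. \<Sum>b\<in>D. f a * g b * (curve_monom c a $ i * curve_monom c b $ (N-i)))"
    by (simp add: sum_product mult_ac)
  also have "\<dots> = (\<Sum>a\<in>D. \<Sum>i=0..N. \<Sum>b\<in>D. f a * g b * (curve_monom c a $ i * curve_monom c b $ (N-i)))"
    by (rule sum.swap)
  also have "\<dots> = (\<Sum>a\<in>D. \<Sum>b\<in>D. \<Sum>i=0..N. f a * g b * (curve_monom c a $ i * curve_monom c b $ (N-i)))"
    by (intro sum.cong refl sum.swap)
  also have "\<dots> = (\<Sum>a\<in>D. \<Sum>b\<in>D. h (a, b))"
    by (simp add: h_def curve_monom_add fps_mult_nth sum_distrib_left)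
  also have "\<dots> = (\<Sum>p\<in>D\<times>D. h p)"
    by (simp add: sum.cartesian_product)
  \<comment> \<open>The two truncations produce total degrees up to \<open>2 * N\<close>; those
    above \<open>N\<close> contribute nothing because every component of \<open>c\<close> has order
    at least one.\<close>
  also have "\<dots> = (\<Sum>p\<in>{(a,b). mdeg a + mdeg b \<le> N}. h p)"
  proof (rule sum.mono_neutral_right)
    show "\<forall>p\<in>D \<times> D - {(a, b). mdeg a + mdeg b \<le> N}. h p = 0"
      using c by (auto simp: h_def mdeg_add intro!: curve_monom_nth_low)
  qed (auto simp: D_def)
  also have "\<dots> = (\<Sum>(l,a)\<in>P. f a * g (\<lambda>v. l v - a v) * curve_monom c l $ N)"
  proof (rule sum.reindex_bij_witness[where i="\<lambda>(l,a). (a, \<lambda>v. l v - a v)" and j="\<lambda>(a,b). (\<lambda>v. a v + b v, a)"])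
    fix p assume "p \<in> P"
    then obtain l a where p: "p = (l, a)" "l \<in> D" "\<forall>v. a v \<le> l v" by (auto simp: P_def)
    then have eq: "(\<lambda>v. a v + (l v - a v)) = l" by auto
    then show "(case case p of (l, a) \<Rightarrow> (a, \<lambda>v. l v - a v) of (a, b) \<Rightarrow> (\<lambda>v. a v + b v, a)) = p"
      using p by auto
    have "mdeg a + mdeg (\<lambda>v. l v - a v) = mdeg l" using eq mdeg_add by metis
    then show "(case p of (l, a) \<Rightarrow> (a, \<lambda>v. l v - a v)) \<in> {(a, b). mdeg a + mdeg b \<le> N}"
      using p by (auto simp: D_def)
  qed (auto simp: P_def D_def h_def mdeg_add)
  also have "\<dots> = (\<Sum>l\<in>D. \<Sum>a | \<forall>v. a v \<le> l v. f a * g (\<lambda>v. l v - a v) * curve_monom c l $ N)"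
    unfolding P_def by (rule sum.Sigma[symmetric]) auto
  also have "\<dots> = along c (mpmult f g) $ N"
    by (simp add: along_nth mpmult_def D_def sum_distrib_right)
  finally show "along c (mpmult f g) $ N = (along c f * along c g) $ N" by simp
qed

lemma curve_monom_0 [simp]: "curve_monom c (\<lambda>_. 0) = 1"
  by (simp add: curve_monom_def)

lemma mdeg_0 [simp]: "mdeg (\<lambda>_. 0) = 0"
  by (simp add: mdeg_def)

lemma along_one: "along c mpone = 1"
proof (rule fps_ext)
  fix n
  have "along c mpone $ n = (\<Sum>m | mdeg m \<le> n. if m = (\<lambda>_. 0) then curve_monom c m $ n else 0)"
    unfolding along_nth by (intro sum.cong) (auto simp: mpone_def)
  then show "along c mpone $ n = 1 $ n" by (simp add: sum.delta)
qed

lemma curve_monom_unit [simp]: "curve_monom c (\<lambda>u. if u = v then 1 else 0) = c v"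
proof -
  have "curve_monom c (\<lambda>u. if u = v then 1 else 0) = (\<Prod>u\<in>UNIV. if u = v then c u else 1)"
    unfolding curve_monom_def by (intro prod.cong) auto
  then show ?thesis by simp
qed

lemma mdeg_unit [simp]: "mdeg (\<lambda>u. if u = v then 1 else 0) = 1"
  by (simp add: mdeg_def)

lemma along_var:
  assumes "c v $ 0 = 0"
  shows "along c (mpvar v) = c v"
proof (rule fps_ext)
  fix n
  have "along c (mpvar v) $ n = (\<Sum>m | mdeg m \<le> n. if m = (\<lambda>u. if u = v then 1 else 0) then curve_monom c m $ n else 0)"
    unfolding along_nth by (intro sum.cong) (auto simp: mpvar_def)
  also have "\<dots> = c v $ n" using assms by (cases n) (auto simp: sum.delta simp del: One_nat_def)
  finally show "along c (mpvar v) $ n = c v $ n" .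
qed

lemma along_pow: "(\<And>v. c v $ 0 = 0) \<Longrightarrow> along c (mppow f n) = along c f ^ n"
  by (induction n) (auto simp: mppow_def along_one along_mult)

lemma along_nth_0: "along c f $ 0 = f (\<lambda>_. 0)"
proof -
  have "{m::'a \<Rightarrow> nat. mdeg m \<le> 0} = {\<lambda>_. 0}"
    by (auto simp: mdeg_def)
  then show ?thesis by (simp add: along_nth)
qed

text \<open>With the other variables frozen, the sum is a polynomial in \<open>x u\<close> with
  infinitely many zeros. Its coefficients, each collecting the exponents with one value at
  \<open>u\<close>, vanish and are sums of the same kind over \<open>V\<close>. The separation
  hypothesis allows \<open>V\<close> to be smaller than the index type, provided that
  \<open>S\<close> is correspondingly thin.\<close>

lemma sum_monomials_eq_0D:
  fixes d :: "('v \<Rightarrow> nat) \<Rightarrow> complex" and A :: "'v \<Rightarrow> complex set"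
  assumes "finite V" "finite S" "\<And>m m'. m \<in> S \<Longrightarrow> m' \<in> S \<Longrightarrow> \<forall>v\<in>V. m v = m' v \<Longrightarrow> m = m'"
    and "\<And>v. infinite (A v)"
    and "\<And>x. (\<And>v. x v \<in> A v) \<Longrightarrow> (\<Sum>m\<in>S. d m * (\<Prod>v\<in>V. x v ^ m v)) = 0"
    and "m \<in> S"
  shows "d m = 0"
  using assms
proof (induction V arbitrary: S rule: finite_induct)
  case empty
  then have "S = {m}" by auto
  moreover have "\<exists>x. \<forall>v. x v \<in> A v"
  proof (rule choice, rule allI)
    fix v
    show "\<exists>y. y \<in> A v" using empty.prems(3)[of v] by (metis ex_in_conv finite.emptyI)
  qed
  ultimately show ?case using empty.prems(4) by auto
next
  case (insert u V)
  define S' where "S' = {m'\<in>S. m' u = m u}"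
  have "d m = 0"
  proof (rule insert.IH[of S'])
    show "finite S'" "m \<in> S'" using insert.prems by (auto simp: S'_def)
    show "m1 = m2" if "m1 \<in> S'" "m2 \<in> S'" "\<forall>v\<in>V. m1 v = m2 v" for m1 m2
      using that insert.prems(2)[of m1 m2] by (auto simp: S'_def)
    show "infinite (A v)" for v by fact
    fix x :: "'v \<Rightarrow> complex" assume x: "\<And>v. x v \<in> A v"
    define q where "q = (\<Sum>m\<in>S. monom (d m * (\<Prod>v\<in>V. x v ^ m v)) (m u))"
    have "poly q y = 0" if y: "y \<in> A u" for y
    proof -
      define x' where "x' = x(u := y)"
      have "\<And>v. x' v \<in> A v" using x y by (auto simp: x'_def)
      then have "0 = (\<Sum>m\<in>S. d m * (\<Prod>v\<in>insert u V. x' v ^ m v))"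
        using insert.prems(4) by metis
      also have "\<dots> = (\<Sum>m\<in>S. d m * (y ^ m u * (\<Prod>v\<in>V. x v ^ m v)))"
      proof (intro sum.cong refl arg_cong2[where f="(*)"])
        fix m
        have "(\<Prod>v\<in>V. x' v ^ m v) = (\<Prod>v\<in>V. x v ^ m v)"
          using insert.hyps by (intro prod.cong) (auto simp: x'_def)
        then show "(\<Prod>v\<in>insert u V. x' v ^ m v) = y ^ m u * (\<Prod>v\<in>V. x v ^ m v)"
          using insert.hyps by (simp add: x'_def)
      qed
      finally show ?thesis by (simp add: q_def poly_sum poly_monom mult_ac)
    qed
    then have "A u \<subseteq> {y. poly q y = 0}" by auto
    then have "q = 0"
      using insert.prems(3)[of u] poly_roots_finite finite_subset by blast
    then have "0 = coeff q (m u)" by simp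
    also have "\<dots> = (\<Sum>m'\<in>S. if m' u = m u then d m' * (\<Prod>v\<in>V. x v ^ m' v) else 0)"
      by (simp add: q_def coeff_sum)
    also have "\<dots> = (\<Sum>m'\<in>S'. d m' * (\<Prod>v\<in>V. x v ^ m' v))"
      using insert.prems(1) by (simp add: S'_def sum.inter_filter)
    finally show "(\<Sum>m'\<in>S'. d m' * (\<Prod>v\<in>V. x v ^ m' v)) = 0" by simp
  qed
  then show ?case .
qed

text \<open>A series is determined by its values along curves whose leading vectors run through a test set;
the higher order terms of the curves are arbitrary.\<close>

definition test_set :: "('v::finite \<Rightarrow> complex) set \<Rightarrow> bool" where
  "test_set X \<longleftrightarrow> (\<forall>N d. (\<forall>x\<in>X. (\<Sum>m | mdeg m = N. d m * (\<Prod>v\<in>UNIV. x v ^ m v)) = 0)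
     \<longrightarrow> (\<forall>m. mdeg m = N \<longrightarrow> d m = 0))"

lemma test_set_product:
  fixes A :: "'v::finite \<Rightarrow> complex set"
  assumes "\<And>v. infinite (A v)"
  shows "test_set {x. \<forall>v. x v \<in> A v}"
  unfolding test_set_def
proof (intro allI impI)
  fix N and d :: "('v \<Rightarrow> nat) \<Rightarrow> complex" and m :: "'v \<Rightarrow> nat"
  assume *: "\<forall>x\<in>{x. \<forall>v. x v \<in> A v}. (\<Sum>m | mdeg m = N. d m * (\<Prod>v\<in>UNIV. x v ^ m v)) = 0"
    and m: "mdeg m = N"
  show "d m = 0"
    by (rule sum_monomials_eq_0D[of UNIV "{m. mdeg m = N}" A]) (use * m assms in auto)
qed

lemma test_set_UNIV: "test_set (UNIV :: ('v::finite \<Rightarrow> complex) set)"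
  using test_set_product[of "\<lambda>_. UNIV"] by (simp add: infinite_UNIV_char_0)

lemma along_nth_leading:
  assumes "\<And>v. c v $ 0 = 0" "\<And>m. mdeg m < N \<Longrightarrow> f m = 0"
  shows "along c f $ N = (\<Sum>m | mdeg m = N. f m * (\<Prod>v\<in>UNIV. (c v $ 1) ^ m v))"
proof -
  have "along c f $ N = (\<Sum>m | mdeg m = N. f m * curve_monom c m $ N)"
    unfolding along_nth
  proof (rule sum.mono_neutral_right)
    show "\<forall>m\<in>{m. mdeg m \<le> N} - {m. mdeg m = N}. f m * curve_monom c m $ N = 0"
      using assms(2) by (auto simp: less_le)
  qed auto
  also have "\<dots> = (\<Sum>m | mdeg m = N. f m * (\<Prod>v\<in>UNIV. (c v $ 1) ^ m v))"
    by (intro sum.cong refl arg_cong2[where f="(*)"]) (use assms(1) curve_monom_nth_mdeg in auto)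
  finally show ?thesis .
qed

text \<open>Induction on the degree: once all coefficients of lower degree are zero, the coefficient
  of order \<open>mdeg m\<close> along a curve is the homogeneous part of that degree at the leading
  vector, whatever the higher terms of the curve. The bound \<open>D\<close> covers series that are
  known to vanish only to finite order.\<close>

lemma test_set_vanish:
  assumes X: "test_set X"
    and ex: "\<And>x. x \<in> X \<Longrightarrow> \<exists>c. (\<forall>v. c v $ 0 = 0 \<and> c v $ 1 = x v) \<and> (\<forall>k<D. along c f $ k = 0)"
    and "mdeg m < D"
  shows "f m = 0"
  using \<open>mdeg m < D\<close>
proof (induction "mdeg m" arbitrary: m rule: less_induct)
  case less
  have low: "f m' = 0" if "mdeg m' < mdeg m" for m'
    using less.hyps[OF that] that less.prems by simp
  have "(\<Sum>m' | mdeg m' = mdeg m. f m' * (\<Prod>v\<in>UNIV. x v ^ m' v)) = 0" if x: "x \<in> X" for x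
  proof -
    obtain c where c: "\<And>v. c v $ 0 = 0" "\<And>v. c v $ 1 = x v" "\<And>k. k < D \<Longrightarrow> along c f $ k = 0"
      using ex[OF x] by blast
    have "0 = along c f $ mdeg m" using c(3) less.prems by simp
    also have "\<dots> = (\<Sum>m' | mdeg m' = mdeg m. f m' * (\<Prod>v\<in>UNIV. x v ^ m' v))"
      unfolding c(2)[symmetric] by (rule along_nth_leading) (use c(1) low in auto)
    finally show ?thesis by simp
  qed
  then show "f m = 0" using X unfolding test_set_def by blast
qed

lemma test_set_eq:
  assumes X: "test_set X"
    and c: "\<And>x. x \<in> X \<Longrightarrow> \<exists>c. (\<forall>v. c v $ 0 = 0 \<and> c v $ 1 = x v) \<and> along c f = along c g"
  shows "f = g"
proof
  fix m
  have "mpadd f (mpscale (-1) g) m = 0"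
  proof (rule test_set_vanish[OF X])
    fix x assume "x \<in> X"
    then obtain c where "\<forall>v. c v $ 0 = 0 \<and> c v $ 1 = x v" "along c f = along c g"
      using c by blast
    then show "\<exists>c. (\<forall>v. c v $ 0 = 0 \<and> c v $ 1 = x v) \<and>
        (\<forall>k<Suc (mdeg m). along c (mpadd f (mpscale (-1) g)) $ k = 0)"
      by (intro exI[of _ c]) (auto simp: along_add along_scale)
  qed simp
  then show "f m = g m" by (simp add: mpadd_def mpscale_def)
qed

lemma UNIV_4': "(UNIV :: 4 set) = {0,1,2,3}"
proof -
  have "(4::4) = 0" by simp
  then have "(UNIV :: 4 set) = {1,2,3,0}" using UNIV_4 by metis
  then show ?thesis by (simp only: insert_commute)
qed

lemma UNIV_2': "(UNIV :: 2 set) = {0,1}"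
  using UNIV_2 by auto

lemma prod_4': "(\<Prod>v\<in>(UNIV::4 set). f v) = f 0 * f 1 * f 2 * f 3"
  for f :: "4 \<Rightarrow> 'a :: comm_monoid_mult"
  unfolding UNIV_4' by (simp add: mult.assoc)

lemma prod_2': "(\<Prod>v\<in>(UNIV::2 set). f v) = f 0 * f 1"
  for f :: "2 \<Rightarrow> 'a :: comm_monoid_mult"
  unfolding UNIV_2' by simp

lemma sum_4': "(\<Sum>v\<in>(UNIV::4 set). f v) = f 0 + f 1 + f 2 + f 3"
  for f :: "4 \<Rightarrow> 'a :: comm_monoid_add"
  unfolding UNIV_4' by (simp add: add.assoc)

lemma sum_2': "(\<Sum>v\<in>(UNIV::2 set). f v) = f 0 + f 1"
  for f :: "2 \<Rightarrow> 'a :: comm_monoid_add"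
  unfolding UNIV_2' by simp

text \<open>The cut-off \<open>mdeg n \<le> mdeg m\<close> in \<open>mpsubst4\<close> depends on
  \<open>m\<close>. It is removed by showing that a product of \<open>mdeg n\<close> series without
  constant term has no coefficients below degree \<open>mdeg n\<close>; then the two sums can be
  exchanged.\<close>

lemma along_subst4:
  fixes c :: "'u::finite \<Rightarrow> complex fps" and g :: "4 \<Rightarrow> 'u mps"
  assumes c: "\<And>v. c v $ 0 = 0" and g: "\<And>v. g v (\<lambda>_. 0) = 0"
  shows "along c (mpsubst4 f g) = along (\<lambda>v. along c (g v)) f"
proof (rule fps_ext)
  fix N
  define pw where "pw = (\<lambda>n::4\<Rightarrow>nat. mpmult (mpmult (mppow (g 0) (n 0)) (mppow (g 1) (n 1)))
                   (mpmult (mppow (g 2) (n 2)) (mppow (g 3) (n 3))))"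
  define d where "d = (\<lambda>v. along c (g v))"
  have d0: "d v $ 0 = 0" for v by (simp add: d_def along_nth_0 g)
  have cpw: "along c (pw n) = curve_monom d n" for n
    by (simp add: pw_def along_mult c along_pow curve_monom_def prod_4' d_def mult_ac)
  \<comment> \<open>Orders are counted along straight lines, which avoids combinatorics with
    iterated \<open>mpmult\<close>.\<close>
  have pw0: "pw n m = 0" if "mdeg m < mdeg n" for n m
  proof (rule test_set_vanish[OF test_set_UNIV _ that])
    fix x :: "'u \<Rightarrow> complex"
    define l where "l = (\<lambda>v. fps_const (x v) * fps_X)"
    have l: "l v $ 0 = 0" "l v $ 1 = x v" for v by (auto simp: l_def)
    have "along l (pw n) = curve_monom (\<lambda>v. along l (g v)) n"
      by (simp add: pw_def along_mult l along_pow curve_monom_def prod_4' mult_ac)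
    then have "\<forall>k<mdeg n. along l (pw n) $ k = 0"
      by (simp add: curve_monom_nth_low along_nth_0 g)
    then show "\<exists>c. (\<forall>v. c v $ 0 = 0 \<and> c v $ 1 = x v) \<and> (\<forall>k<mdeg n. along c (pw n) $ k = 0)"
      using l by blast
  qed
  have "along c (mpsubst4 f g) $ N = (\<Sum>m | mdeg m \<le> N. (\<Sum>n | mdeg n \<le> mdeg m. f n * pw n m) * curve_monom c m $ N)"
    by (simp add: along_nth mpsubst4_def pw_def)
  also have "\<dots> = (\<Sum>m | mdeg m \<le> N. (\<Sum>n | mdeg n \<le> N. f n * pw n m) * curve_monom c m $ N)"
    by (intro sum.cong refl arg_cong2[where f="(*)"] sum.mono_neutral_left) (auto simp: pw0)
  also have "\<dots> = (\<Sum>m | mdeg m \<le> N. \<Sum>n | mdeg n \<le> N. f n * (pw n m * curve_monom c m $ N))"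
    by (simp add: sum_distrib_right mult.assoc)
  also have "\<dots> = (\<Sum>n | mdeg n \<le> N. \<Sum>m | mdeg m \<le> N. f n * (pw n m * curve_monom c m $ N))"
    by (rule sum.swap)
  also have "\<dots> = (\<Sum>n | mdeg n \<le> N. f n * along c (pw n) $ N)"
    by (simp add: along_nth sum_distrib_left)
  also have "\<dots> = along d f $ N"
    by (simp add: cpw along_nth)
  finally show "along c (mpsubst4 f g) $ N = along (\<lambda>v. along c (g v)) f $ N"
    by (simp add: d_def)
qed

section \<open>The series of the defining function\<close>

text \<open>The quotient defining \<open>phi\<close>, rationalised: the singularity at 0 disappears,
  and the principal root is holomorphic because \<open>1 - t\<^sup>2\<close> stays in the right
  half-plane for \<open>norm t < 1\<close>.\<close>

definition phi_cx :: "complex \<Rightarrow> complex" where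
  "phi_cx t = t / (1 + csqrt (1 - t\<^sup>2))"

definition phi_fps :: "complex fps" where
  "phi_fps = Abs_fps (\<lambda>n. of_real (phic n))"

lemma Re_one_minus_square_pos:
  assumes "norm (t::complex) < 1"
  shows "0 < Re (1 - t\<^sup>2)"
proof -
  have "Re (t\<^sup>2) \<le> norm (t\<^sup>2)" by (rule complex_Re_le_cmod)
  also have "\<dots> < 1" using assms by (simp add: norm_power power_less_one_iff)
  finally show ?thesis by simp
qed

lemma one_plus_csqrt_nonzero: "1 + csqrt z \<noteq> 0"
proof
  assume "1 + csqrt z = 0"
  then have "Re (csqrt z) = -1" by (simp add: complex_eq_iff)
  moreover have "Re (csqrt z) \<ge> 0" using Re_csqrt by simp
  ultimately show False by simp
qed

lemma phi_cx_holomorphic: "phi_cx holomorphic_on ball 0 1"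
  unfolding phi_cx_def
  by (intro holomorphic_intros) (use Re_one_minus_square_pos one_plus_csqrt_nonzero in \<open>force simp: complex_nonpos_Reals_iff\<close>)+

lemma phi_eq_quotient:
  assumes "\<bar>t\<bar> < 1"
  shows "phi t = t / (1 + sqrt (1 - t\<^sup>2))"
proof (cases "t = 0")
  case False
  have "t\<^sup>2 \<le> 1" using assms by (simp add: abs_square_le_1)
  then have "(1 - sqrt (1 - t\<^sup>2)) * (1 + sqrt (1 - t\<^sup>2)) = t\<^sup>2"
    by (simp add: algebra_simps)
  moreover have "1 + sqrt (1 - t\<^sup>2) > 0" using \<open>t\<^sup>2 \<le> 1\<close> by (simp add: add_pos_nonneg)
  ultimately show ?thesis using False by (simp add: phi_def field_simps power2_eq_square)
qed (simp add: phi_def)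

lemma of_real_phi:
  assumes "\<bar>t\<bar> < 1"
  shows "of_real (phi t) = phi_cx (of_real t)"
proof -
  have "t\<^sup>2 \<le> 1" using assms by (simp add: abs_square_le_1)
  then have "csqrt (1 - (of_real t)\<^sup>2) = of_real (sqrt (1 - t\<^sup>2))"
    using of_real_sqrt[of "1 - t\<^sup>2"] by simp
  then show ?thesis using assms by (simp add: phi_eq_quotient phi_cx_def)
qed

text \<open>The coefficients \<open>phic\<close> come from iterated real derivatives, a holomorphic
  Taylor series from complex ones. On the real axis the real derivative is the complex derivative
  along the axis, whose imaginary part is 0 because it differentiates a constantly vanishing
  function.\<close>

lemma of_real_higher_deriv:
  fixes f :: "real \<Rightarrow> real" and g :: "complex \<Rightarrow> complex"
  assumes g: "g holomorphic_on ball 0 1"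
    and fg: "\<And>t. \<bar>t\<bar> < 1 \<Longrightarrow> of_real (f t) = g (of_real t)"
  shows "\<bar>t\<bar> < 1 \<Longrightarrow> of_real ((deriv ^^ n) f t) = (deriv ^^ n) g (of_real t)"
proof (induction n arbitrary: t)
  case 0
  then show ?case using fg by simp
next
  case (Suc n)
  let ?g = "(deriv ^^ n) g" and ?f = "(deriv ^^ n) f"
  have "(?g has_field_derivative deriv ?g (of_real t)) (at (of_real t))"
    using Suc.prems holomorphic_higher_deriv[OF g open_ball, of n]
    by (intro holomorphic_derivI[of _ "ball 0 1"]) auto
  then have "((\<lambda>x. ?g (of_real x)) has_vector_derivative deriv ?g (of_real t)) (at t)"
    by (rule has_vector_derivative_real_field)
  then have *: "((\<lambda>x. of_real (?f x)) has_vector_derivative deriv ?g (of_real t)) (at t)"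
  proof (rule has_vector_derivative_transform_within_open[of _ _ _ "{-1<..<1}"])
    show "\<And>x. x \<in> {- 1<..<1} \<Longrightarrow> ?g (of_real x) = of_real (?f x)"
      using Suc.IH by force
  qed (use Suc.prems in auto)
  have "(?f has_field_derivative Re (deriv ?g (of_real t))) (at t)"
    using bounded_linear.has_vector_derivative[OF bounded_linear_Re *] by (simp add: has_real_derivative_iff_has_vector_derivative)
  then have "deriv ?f t = Re (deriv ?g (of_real t))" by (rule DERIV_imp_deriv)
  moreover have "((\<lambda>_. 0::real) has_field_derivative Im (deriv ?g (of_real t))) (at t)"
    using bounded_linear.has_vector_derivative[OF bounded_linear_Im *] by (simp add: has_real_derivative_iff_has_vector_derivative)
  then have "Im (deriv ?g (of_real t)) = 0" by (rule DERIV_unique) simp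
  ultimately show ?case by (simp add: complex_eq_iff)
qed

lemma phi_fps_expansion: "phi_cx has_fps_expansion phi_fps"
proof -
  have "phi_cx has_fps_expansion fps_expansion phi_cx 0"
    using phi_cx_holomorphic by (rule has_fps_expansion_fps_expansion[rotated 2]) auto
  moreover have "fps_expansion phi_cx 0 = phi_fps"
    by (rule fps_ext)
      (use of_real_higher_deriv[OF phi_cx_holomorphic of_real_phi, of 0] in
        \<open>simp add: fps_expansion_def phi_fps_def phic_def\<close>)
  ultimately show ?thesis by simp
qed

text \<open>The half-angle formula \<open>sin x = 2 p / (1 + p\<^sup>2)\<close> for
  \<open>p = tan (x / 2)\<close>, transferred from functions to series by uniqueness of
  expansions.\<close>

lemma phi_fps_equation: "fps_X * (1 + phi_fps\<^sup>2) = 2 * phi_fps"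
proof -
  have "t * (1 + (phi_cx t)\<^sup>2) = 2 * phi_cx t" for t
  proof -
    define q where "q = csqrt (1 - t\<^sup>2)"
    have q2: "q\<^sup>2 = 1 - t\<^sup>2" by (simp add: q_def)
    have nz: "1 + q \<noteq> 0" using one_plus_csqrt_nonzero by (simp add: q_def)
    have "t * (1 + (t / (1 + q))\<^sup>2) = t * ((1 + q)\<^sup>2 + t\<^sup>2) / (1 + q)\<^sup>2"
      using nz by (simp add: power_divide field_simps)
    also have "(1 + q)\<^sup>2 + t\<^sup>2 = 2 * (1 + q)"
      using q2 by (simp add: power2_eq_square algebra_simps)
    also have "t * (2 * (1 + q)) / (1 + q)\<^sup>2 = 2 * (t / (1 + q))"
    proof -
      have "t * (2 * p) / p\<^sup>2 = 2 * (t / p)" if "p \<noteq> 0" for p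
        using that by (simp add: power2_eq_square)
      then show ?thesis using nz by blast
    qed
    finally show ?thesis by (simp add: phi_cx_def q_def)
  qed
  then have eq: "(\<lambda>t. t * (1 + phi_cx t * phi_cx t)) = (\<lambda>t. 2 * phi_cx t)"
    by (auto simp: power2_eq_square)
  have "(\<lambda>t. t * (1 + phi_cx t * phi_cx t)) has_fps_expansion fps_X * (1 + phi_fps * phi_fps)"
    by (intro fps_expansion_intros phi_fps_expansion)
  moreover have "(\<lambda>t. 2 * phi_cx t) has_fps_expansion 2 * phi_fps"
    by (intro fps_expansion_intros phi_fps_expansion)
  ultimately show ?thesis
    using fps_expansion_unique_complex eq by (metis power2_eq_square)
qed

lemma phi_fps_nth_0 [simp]: "phi_fps $ 0 = 0"
  by (simp add: phi_fps_def phic_def phi_def)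

text \<open>On the hypersurface \<open>w = Re w * (1 + \<i> * phi)\<close> and
  \<open>cnj w = Re w * (1 - \<i> * phi)\<close>; this is their quotient, as a series in
  \<open>t = z z\<^sup>*\<close>.\<close>

definition E_fps :: "complex fps" where
  "E_fps = (1 + fps_const \<i> * phi_fps) * inverse (1 - fps_const \<i> * phi_fps)"

lemma E_fps_nth_0 [simp]: "E_fps $ 0 = 1"
  by (simp add: E_fps_def)

lemma E_fps_mult: "E_fps * (1 - fps_const \<i> * phi_fps) = 1 + fps_const \<i> * phi_fps"
proof -
  have "inverse (1 - fps_const \<i> * phi_fps) * (1 - fps_const \<i> * phi_fps) = 1"
    by (rule inverse_mult_eq_1) simp
  then show ?thesis by (simp add: E_fps_def mult.assoc)
qed

lemma fps_const_i_square: "fps_const \<i> * fps_const \<i> = -1"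
  by (simp flip: fps_const_neg)

lemma E_fps_equation: "E_fps\<^sup>2 - 1 = 2 * fps_const \<i> * fps_X * E_fps"
proof -
  let ?u = "1 - fps_const \<i> * phi_fps" and ?v = "1 + fps_const \<i> * phi_fps"
  have nz: "?u \<noteq> 0"
  proof
    assume "?u = 0"
    then have "?u $ 0 = 0" by (metis fps_zero_nth)
    then show False by simp
  qed
  have "(1 - I * p) * (1 + I * p) = 1 - (I * I) * p\<^sup>2" for I p :: "complex fps"
    by (simp add: algebra_simps power2_eq_square)
  from this[of "fps_const \<i>"] have uv: "?u * ?v = 1 + phi_fps\<^sup>2"
    unfolding fps_const_i_square by simp
  have "(E_fps\<^sup>2 - 1) * ?u\<^sup>2 = (E_fps * ?u)\<^sup>2 - ?u\<^sup>2"
    by (simp only: left_diff_distrib power_mult_distrib mult_1)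
  also have "\<dots> = ?v\<^sup>2 - ?u\<^sup>2" by (simp only: E_fps_mult)
  also have "\<dots> = 2 * fps_const \<i> * (2 * phi_fps)" by (simp add: power2_eq_square algebra_simps)
  also have "\<dots> = 2 * fps_const \<i> * fps_X * (?u * ?v)" by (simp only: phi_fps_equation[symmetric] uv mult.assoc)
  also have "?u * ?v = ?u * (E_fps * ?u)" by (simp only: E_fps_mult)
  also have "2 * fps_const \<i> * fps_X * (?u * (E_fps * ?u)) = 2 * fps_const \<i> * fps_X * E_fps * ?u\<^sup>2"
    by (simp only: power2_eq_square mult_ac)
  finally show ?thesis using nz by simp
qed

definition diag :: "complex fps \<Rightarrow> 4 mps" where
  "diag e = (\<lambda>m. if m 1 = 0 \<and> m 3 = 0 \<and> m 0 = m 2 then e $ m 0 else 0)"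

lemma phis_eq_diag: "phis = diag phi_fps"
  by (auto simp: phis_def diag_def phi_fps_def)

lemma fps_nth_power_low: "b $ 0 = 0 \<Longrightarrow> n < k \<Longrightarrow> (b ^ k) $ n = 0" for b :: "complex fps"
  using startsby_zero_power_prefix by blast

lemma all_4: "(\<forall>v::4. P v) \<longleftrightarrow> P 0 \<and> P 1 \<and> P 2 \<and> P 3"
proof -
  have "(\<forall>v. P v) \<longleftrightarrow> (\<forall>v\<in>UNIV. P v)" by simp
  then show ?thesis unfolding UNIV_4' by simp
qed

lemma all_2: "(\<forall>v::2. P v) \<longleftrightarrow> P 0 \<and> P 1"
proof -
  have "(\<forall>v. P v) \<longleftrightarrow> (\<forall>v\<in>UNIV. P v)" by simp
  then show ?thesis unfolding UNIV_2' by simp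
qed

lemma along_diag:
  assumes c: "\<And>v. c v $ 0 = 0"
  shows "along c (diag e) = e oo (c 0 * c 2)"
proof (rule fps_ext)
  fix N
  define d where "d = (\<lambda>k::nat. \<lambda>v::4. if v = 0 \<or> v = 2 then k else 0)"
  have dm: "mdeg (d k) = 2 * k" for k by (simp add: mdeg_def sum_4' d_def)
  have dc: "curve_monom c (d k) = (c 0 * c 2) ^ k" for k
    by (simp add: curve_monom_def prod_4' d_def power_mult_distrib)
  have dd: "diag e (d k) = e $ k" for k by (simp add: diag_def d_def)
  have inj: "inj_on d A" for A by (rule inj_onI) (metis d_def)
  have "along c (diag e) $ N = (\<Sum>m\<in>d ` {k. 2 * k \<le> N}. diag e m * curve_monom c m $ N)"
    unfolding along_nth
  proof (rule sum.mono_neutral_right)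
    show "\<forall>m\<in>{m. mdeg m \<le> N} - d ` {k. 2 * k \<le> N}. diag e m * curve_monom c m $ N = 0"
    proof
      fix m assume m: "m \<in> {m. mdeg m \<le> N} - d ` {k. 2 * k \<le> N}"
      have "diag e m = 0"
      proof (rule ccontr)
        assume "diag e m \<noteq> 0"
        then have "m 1 = 0" "m 3 = 0" "m 2 = m 0" by (auto simp: diag_def split: if_splits)
        then have eq: "m = d (m 0)" by (auto simp: fun_eq_iff all_4 d_def)
        moreover have "2 * m 0 \<le> N" using m dm[of "m 0"] eq by auto
        ultimately show False using m by blast
      qed
      then show "diag e m * curve_monom c m $ N = 0" by simp
    qed
  qed (auto simp: dm)
  also have "\<dots> = (\<Sum>k | 2 * k \<le> N. e $ k * (c 0 * c 2) ^ k $ N)"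
    by (subst sum.reindex[OF inj]) (simp add: dd dc)
  also have "\<dots> = (\<Sum>k=0..N. e $ k * (c 0 * c 2) ^ k $ N)"
  proof (rule sum.mono_neutral_left)
    show "\<forall>k\<in>{0..N} - {k. 2 * k \<le> N}. e $ k * (c 0 * c 2) ^ k $ N = 0"
    proof
      fix k assume "k \<in> {0..N} - {k. 2 * k \<le> N}"
      then have "curve_monom c (d k) $ N = 0" by (intro curve_monom_nth_low c) (auto simp: dm)
      then show "e $ k * (c 0 * c 2) ^ k $ N = 0" by (simp add: dc)
    qed
  qed auto
  finally show "along c (diag e) $ N = (e oo (c 0 * c 2)) $ N"
    by (simp add: fps_compose_nth)
qed

section \<open>Two-variable series and their conjugates inside four variables\<close>

definition pair2 :: "'a \<Rightarrow> 'a \<Rightarrow> 2 \<Rightarrow> 'a" where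
  "pair2 a b = (\<lambda>v. if v = 0 then a else b)"

lemma pair2_simps [simp]: "pair2 a b 0 = a" "pair2 a b 1 = b"
  by (auto simp: pair2_def)

lemma pair2_eta: "pair2 (m 0) (m 1) = m"
  by (auto simp: fun_eq_iff all_2)

definition quad :: "'a \<Rightarrow> 'a \<Rightarrow> 'a \<Rightarrow> 'a \<Rightarrow> 4 \<Rightarrow> 'a" where
  "quad a b c d = (\<lambda>v. if v = 0 then a else if v = 1 then b else if v = 2 then c else d)"

lemma quad_simps [simp]: "quad a b c d 0 = a" "quad a b c d 1 = b" "quad a b c d 2 = c" "quad a b c d 3 = d"
  by (auto simp: quad_def)

lemma quad_eta: "quad (m 0) (m 1) (m 2) (m 3) = m"
  by (auto simp: fun_eq_iff all_4)

lemma along_hol_emb: "along c (hol_emb f) = along (pair2 (c 0) (c 1)) f"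
proof (rule fps_ext)
  fix N
  define d where "d = (\<lambda>m::2\<Rightarrow>nat. quad (m 0) (m 1) 0 0)"
  have dm: "mdeg (d m) = mdeg m" for m by (simp add: mdeg_def sum_4' sum_2' d_def)
  have dc: "curve_monom c (d m) = curve_monom (pair2 (c 0) (c 1)) m" for m
    by (simp add: curve_monom_def prod_4' prod_2' d_def)
  have dd: "hol_emb f (d m) = f m" for m
  proof -
    have "(\<lambda>v::2. if v = 0 then d m 0 else d m 1) = m" by (auto simp: fun_eq_iff all_2 d_def)
    then show ?thesis by (simp add: hol_emb_def) (simp add: d_def)
  qed
  have inj: "inj_on d A" for A
    by (rule inj_onI) (metis d_def pair2_eta quad_simps)
  have "along c (hol_emb f) $ N = (\<Sum>m\<in>d ` {m. mdeg m \<le> N}. hol_emb f m * curve_monom c m $ N)"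
    unfolding along_nth
  proof (rule sum.mono_neutral_right)
    show "\<forall>m\<in>{m. mdeg m \<le> N} - d ` {m. mdeg m \<le> N}. hol_emb f m * curve_monom c m $ N = 0"
    proof
      fix m assume m: "m \<in> {m. mdeg m \<le> N} - d ` {m. mdeg m \<le> N}"
      have "hol_emb f m = 0"
      proof (rule ccontr)
        assume "hol_emb f m \<noteq> 0"
        then have "m 2 = 0" "m 3 = 0" by (auto simp: hol_emb_def split: if_splits)
        then have eq: "m = d (pair2 (m 0) (m 1))" using quad_eta[of m] by (simp add: d_def)
        then have "mdeg (pair2 (m 0) (m 1)) \<le> N" using m dm by (metis DiffE mem_Collect_eq)
        then show False using m eq by blast
      qed
      then show "hol_emb f m * curve_monom c m $ N = 0" by simp
    qed
  qed (auto simp: dm)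
  also have "\<dots> = along (pair2 (c 0) (c 1)) f $ N"
    by (subst sum.reindex[OF inj]) (simp add: dd dc along_nth)
  finally show "along c (hol_emb f) $ N = along (pair2 (c 0) (c 1)) f $ N" .
qed

lemma along_ahol_emb: "along c (ahol_emb f) = along (pair2 (c 2) (c 3)) (\<lambda>m. cnj (f m))"
proof (rule fps_ext)
  fix N
  define d where "d = (\<lambda>m::2\<Rightarrow>nat. quad 0 0 (m 0) (m 1))"
  have dm: "mdeg (d m) = mdeg m" for m by (simp add: mdeg_def sum_4' sum_2' d_def)
  have dc: "curve_monom c (d m) = curve_monom (pair2 (c 2) (c 3)) m" for m
    by (simp add: curve_monom_def prod_4' prod_2' d_def)
  have dd: "ahol_emb f (d m) = cnj (f m)" for m
  proof -
    have "(\<lambda>v::2. if v = 0 then d m 2 else d m 3) = m" by (auto simp: fun_eq_iff all_2 d_def)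
    then show ?thesis by (simp add: ahol_emb_def) (simp add: d_def)
  qed
  have inj: "inj_on d A" for A
    by (rule inj_onI) (metis d_def pair2_eta quad_simps)
  have "along c (ahol_emb f) $ N = (\<Sum>m\<in>d ` {m. mdeg m \<le> N}. ahol_emb f m * curve_monom c m $ N)"
    unfolding along_nth
  proof (rule sum.mono_neutral_right)
    show "\<forall>m\<in>{m. mdeg m \<le> N} - d ` {m. mdeg m \<le> N}. ahol_emb f m * curve_monom c m $ N = 0"
    proof
      fix m assume m: "m \<in> {m. mdeg m \<le> N} - d ` {m. mdeg m \<le> N}"
      have "ahol_emb f m = 0"
      proof (rule ccontr)
        assume "ahol_emb f m \<noteq> 0"
        then have "m 0 = 0" "m 1 = 0" by (auto simp: ahol_emb_def split: if_splits)
        then have eq: "m = d (pair2 (m 2) (m 3))" using quad_eta[of m] by (simp add: d_def)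
        then have "mdeg (pair2 (m 2) (m 3)) \<le> N" using m dm by (metis DiffE mem_Collect_eq)
        then show False using m eq by blast
      qed
      then show "ahol_emb f m * curve_monom c m $ N = 0" by simp
    qed
  qed (auto simp: dm)
  also have "\<dots> = along (pair2 (c 2) (c 3)) (\<lambda>m. cnj (f m)) $ N"
    by (subst sum.reindex[OF inj]) (simp add: dd dc along_nth)
  finally show "along c (ahol_emb f) $ N = along (pair2 (c 2) (c 3)) (\<lambda>m. cnj (f m)) $ N" .
qed

lemma along_rho:
  assumes c: "\<And>v. c v $ 0 = 0"
  shows "along c rho_ser = fps_const (1 / (2 * \<i>)) * (c 1 - c 3)
           - fps_const (1/2) * ((c 1 + c 3) * (phi_fps oo (c 0 * c 2)))"
  by (simp add: rho_ser_def along_add along_scale along_mult c along_var phis_eq_diag along_diag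
      fps_const_neg[symmetric] del: fps_const_neg)

section \<open>Nested power series\<close>

text \<open>The outer variable is \<open>w\<close>, the inner one \<open>z\<close>.\<close>

type_synonym nest = "complex fps fps"

definition along2 :: "complex fps \<Rightarrow> complex fps \<Rightarrow> nest \<Rightarrow> complex fps" where
  "along2 z w F = Abs_fps (\<lambda>N. \<Sum>k\<le>N. ((F $ k oo z) * w ^ k) $ N)"

lemma along2_nth: "along2 z w F $ N = (\<Sum>k\<le>N. ((F $ k oo z) * w ^ k) $ N)"
  by (simp add: along2_def)

lemma fps_mult_power_nth_low:
  fixes a w :: "complex fps"
  assumes "w $ 0 = 0" "N < k"
  shows "(a * w ^ k) $ N = 0"
  unfolding fps_mult_nth by (intro sum.neutral) (use assms in \<open>auto intro!: fps_nth_power_low\<close>)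

lemma along2_nth_ge:
  assumes "w $ 0 = 0" "N \<le> K"
  shows "along2 z w F $ N = (\<Sum>k\<le>K. ((F $ k oo z) * w ^ k) $ N)"
  unfolding along2_nth
  by (rule sum.mono_neutral_left) (use assms in \<open>auto intro!: fps_mult_power_nth_low\<close>)

lemma along2_mult:
  assumes z: "z $ 0 = 0" and w: "w $ 0 = 0"
  shows "along2 z w (F * G) = along2 z w F * along2 z w G"
proof (rule fps_ext)
  fix N
  define a where "a = (\<lambda>k. (F $ k oo z) * w ^ k)"
  define b where "b = (\<lambda>k. (G $ k oo z) * w ^ k)"
  have ab: "a i * b j = (F $ i * G $ j oo z) * w ^ (i + j)" for i j
    by (simp add: a_def b_def fps_compose_mult_distrib z power_add mult_ac)
  have "(along2 z w F * along2 z w G) $ N = (\<Sum>i=0..N. (\<Sum>k\<le>N. a k $ i) * (\<Sum>l\<le>N. b l $ (N - i)))"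
    unfolding a_def b_def
    by (subst fps_mult_nth, intro sum.cong refl arg_cong2[where f="(*)"] along2_nth_ge w) auto
  also have "\<dots> = ((\<Sum>k\<le>N. a k) * (\<Sum>l\<le>N. b l)) $ N"
    by (simp add: fps_mult_nth fps_sum_nth)
  also have "\<dots> = (\<Sum>k\<le>N. \<Sum>l\<le>N. (a k * b l) $ N)"
    by (simp add: sum_product fps_sum_nth)
  also have "\<dots> = (\<Sum>(k,l)\<in>{..N}\<times>{..N}. (a k * b l) $ N)"
    by (simp add: sum.cartesian_product)
  also have "\<dots> = (\<Sum>(k,l)\<in>{(k,l). k + l \<le> N}. (a k * b l) $ N)"
    by (rule sum.mono_neutral_right) (auto simp: ab intro!: fps_mult_power_nth_low w)
  also have "\<dots> = (\<Sum>m\<le>N. \<Sum>k\<le>m. (a k * b (m - k)) $ N)"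
    by (rule sum.triangle_reindex_eq)
  also have "\<dots> = (\<Sum>m\<le>N. (((F * G) $ m oo z) * w ^ m) $ N)"
  proof (intro sum.cong refl)
    fix m
    have "(F * G) $ m oo z = (\<Sum>k\<le>m. F $ k * G $ (m - k) oo z)"
      by (simp add: fps_mult_nth fps_compose_sum_distrib atLeast0AtMost)
    then show "(\<Sum>k\<le>m. (a k * b (m - k)) $ N) = (((F * G) $ m oo z) * w ^ m) $ N"
      by (simp add: ab sum_distrib_right fps_sum_nth)
  qed
  finally show "along2 z w (F * G) $ N = (along2 z w F * along2 z w G) $ N" by (simp add: along2_nth)
qed

lemma along2_add: "along2 z w (F + G) = along2 z w F + along2 z w G"
  by (rule fps_ext) (simp add: along2_nth fps_compose_add_distrib distrib_right sum.distrib)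

lemma along2_diff: "along2 z w (F - G) = along2 z w F - along2 z w G"
  by (rule fps_ext) (simp add: along2_nth fps_compose_sub_distrib left_diff_distrib sum_subtractf)

lemma along2_const: "along2 z w (fps_const q) = q oo z"
proof (rule fps_ext)
  fix N
  have "along2 z w (fps_const q) $ N = (\<Sum>k\<le>N. if k = 0 then (q oo z) $ N else 0)"
    unfolding along2_nth by (intro sum.cong) auto
  then show "along2 z w (fps_const q) $ N = (q oo z) $ N" by simp
qed

lemma along2_1 [simp]: "along2 z w 1 = 1"
  using along2_const[of z w 1] by simp

lemma along2_0 [simp]: "along2 z w 0 = 0"
  using along2_const[of z w 0] by simp

lemma along2_X:
  assumes "w $ 0 = 0"
  shows "along2 z w fps_X = w"
proof (rule fps_ext)
  fix N
  have "along2 z w fps_X $ N = (\<Sum>k\<le>N. if k = 1 then w $ N else 0)"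
    unfolding along2_nth by (intro sum.cong) (auto simp: fps_X_def)
  then show "along2 z w fps_X $ N = w $ N" using assms by (cases N) auto
qed

definition nest2 :: "2 mps \<Rightarrow> nest" where
  "nest2 f = Abs_fps (\<lambda>k. Abs_fps (\<lambda>j. f (pair2 j k)))"

definition unnest2 :: "nest \<Rightarrow> 2 mps" where
  "unnest2 F = (\<lambda>m. F $ m 1 $ m 0)"

lemma nest2_unnest2 [simp]: "nest2 (unnest2 F) = F"
  by (intro fps_ext) (simp add: nest2_def unnest2_def)

lemma nest2_nth: "nest2 f $ k $ j = f (pair2 j k)"
  by (simp add: nest2_def)

text \<open>Moves curves from coefficient functions to nested series, where division by
  \<open>w\<close> and inverses of units are available.\<close>

lemma along_pair2:
  assumes z: "z $ 0 = 0" and w: "w $ 0 = 0"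
  shows "along (pair2 z w) f = along2 z w (nest2 f)"
proof (rule fps_ext)
  fix N
  let ?c = "pair2 z w"
  have c0: "?c v $ 0 = 0" for v using z w by (simp add: pair2_def)
  have cm: "curve_monom ?c (pair2 j k) = z ^ j * w ^ k" for j k by (simp add: curve_monom_def prod_2')
  have md: "mdeg (pair2 j k) = j + k" for j k by (simp add: mdeg_def sum_2')
  have *: "((nest2 f $ k oo z) * w ^ k) $ N = (\<Sum>j\<le>N. f (pair2 j k) * (z ^ j * w ^ k) $ N)" for k
  proof -
    have "((nest2 f $ k oo z) * w ^ k) $ N = (\<Sum>i=0..N. (\<Sum>j\<le>N. f (pair2 j k) * z ^ j $ i) * w ^ k $ (N - i))"
      unfolding fps_mult_nth
    proof (intro sum.cong refl arg_cong2[where f="(*)"])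
      fix i assume "i \<in> {0..N}"
      then show "(nest2 f $ k oo z) $ i = (\<Sum>j\<le>N. f (pair2 j k) * z ^ j $ i)"
        unfolding fps_compose_nth nest2_nth
        by (intro sum.mono_neutral_left) (auto intro!: fps_nth_power_low z)
    qed
    also have "\<dots> = (\<Sum>i=0..N. \<Sum>j\<le>N. f (pair2 j k) * (z ^ j $ i * w ^ k $ (N - i)))"
      by (simp add: sum_distrib_right sum_distrib_left mult_ac)
    also have "\<dots> = (\<Sum>j\<le>N. \<Sum>i=0..N. f (pair2 j k) * (z ^ j $ i * w ^ k $ (N - i)))"
      by (rule sum.swap)
    finally show ?thesis by (simp add: fps_mult_nth sum_distrib_left)
  qed
  have "along2 z w (nest2 f) $ N = (\<Sum>k\<le>N. \<Sum>j\<le>N. f (pair2 j k) * curve_monom ?c (pair2 j k) $ N)"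
    by (simp add: along2_nth * cm)
  also have "\<dots> = (\<Sum>(k,j)\<in>{..N}\<times>{..N}. f (pair2 j k) * curve_monom ?c (pair2 j k) $ N)"
    by (simp add: sum.cartesian_product)
  also have "\<dots> = (\<Sum>(k,j)\<in>{(k,j). k + j \<le> N}. f (pair2 j k) * curve_monom ?c (pair2 j k) $ N)"
    by (rule sum.mono_neutral_right) (auto simp: md intro!: curve_monom_nth_low c0)
  also have "\<dots> = (\<Sum>m | mdeg m \<le> N. f m * curve_monom ?c m $ N)"
    by (rule sum.reindex_bij_witness[where i="\<lambda>m. (m 1, m 0)" and j="\<lambda>(k,j). pair2 j k"])
       (auto simp: md pair2_eta mdeg_def sum_2')
  finally show "along ?c f $ N = along2 z w (nest2 f) $ N" by (simp add: along_nth)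
qed

text \<open>A binary form is determined by its values at \<open>(1, u)\<close>, even if finitely
  many \<open>u\<close> are omitted. Omitting \<open>u = 0\<close> makes it possible to cancel
  powers of the curve \<open>fps_const u * fps_X\<close> later.\<close>

lemma test_set_affine_line: "test_set {x :: 2 \<Rightarrow> complex. x 0 = 1 \<and> x 1 \<noteq> 0}"
  unfolding test_set_def
proof (intro allI impI)
  fix N and d :: "(2 \<Rightarrow> nat) \<Rightarrow> complex" and m :: "2 \<Rightarrow> nat"
  assume *: "\<forall>x\<in>{x :: 2 \<Rightarrow> complex. x 0 = 1 \<and> x 1 \<noteq> 0}.
      (\<Sum>m | mdeg m = N. d m * (\<Prod>v\<in>UNIV. x v ^ m v)) = 0"
    and m: "mdeg m = N"
  show "d m = 0"
  \<comment> \<open>In fixed degree the exponent of \<open>w\<close> determines that of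
    \<open>z\<close>, so one variable separates the monomials.\<close>
  proof (rule sum_monomials_eq_0D[of "{1}" "{m. mdeg m = N}" "\<lambda>_. - {0}"])
    show "m1 = m2" if "m1 \<in> {m. mdeg m = N}" "m2 \<in> {m. mdeg m = N}" "\<forall>v\<in>{1}. m1 v = m2 v"
      for m1 m2 :: "2 \<Rightarrow> nat"
      using that by (auto simp: fun_eq_iff all_2 mdeg_def sum_2')
    show "infinite (- {0::complex})" by (simp add: infinite_UNIV_char_0)
    fix x :: "2 \<Rightarrow> complex" assume "\<And>v. x v \<in> - {0}"
    then have "pair2 1 (x 1) \<in> {x :: 2 \<Rightarrow> complex. x 0 = 1 \<and> x 1 \<noteq> 0}" by simp
    from bspec[OF * this]
    show "(\<Sum>m | mdeg m = N. d m * (\<Prod>v\<in>{1}. x v ^ m v)) = 0" by (simp add: prod_2')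
  qed (use m in auto)
qed

lemma along2_eqI:
  assumes "\<And>u. u \<noteq> 0 \<Longrightarrow> along2 fps_X (fps_const u * fps_X) F = along2 fps_X (fps_const u * fps_X) G"
  shows "F = G"
proof -
  have "unnest2 F = unnest2 G"
  proof (rule test_set_eq[OF test_set_affine_line])
    fix x :: "2 \<Rightarrow> complex" assume x: "x \<in> {x. x 0 = 1 \<and> x 1 \<noteq> 0}"
    let ?c = "pair2 fps_X (fps_const (x 1) * fps_X)"
    have "along ?c (unnest2 F) = along ?c (unnest2 G)"
      using assms[of "x 1"] x by (simp add: along_pair2)
    moreover have "\<forall>v. ?c v $ 0 = 0 \<and> ?c v $ 1 = x v"
      using x by (simp add: all_2)
    ultimately show "\<exists>c. (\<forall>v. c v $ 0 = 0 \<and> c v $ 1 = x v) \<and> along c (unnest2 F) = along c (unnest2 G)"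
      by blast
  qed
  then show ?thesis by (metis nest2_unnest2)
qed

section \<open>Conjugate series, and series in the product of \<open>z\<close> with its
  conjugate\<close>

definition fps_cnj :: "complex fps \<Rightarrow> complex fps" where
  "fps_cnj f = Abs_fps (\<lambda>n. cnj (f $ n))"

lemma fps_cnj_nth [simp]: "fps_cnj f $ n = cnj (f $ n)"
  by (simp add: fps_cnj_def)

lemma fps_cnj_mult: "fps_cnj (f * g) = fps_cnj f * fps_cnj g"
  by (rule fps_ext) (simp add: fps_mult_nth)

lemma fps_cnj_const [simp]: "fps_cnj (fps_const c) = fps_const (cnj c)"
  by (rule fps_ext) simp

lemma fps_cnj_0 [simp]: "fps_cnj 0 = 0"
  by (rule fps_ext) simp

lemma fps_cnj_1 [simp]: "fps_cnj 1 = 1"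
  by (rule fps_ext) simp

lemma fps_cnj_X [simp]: "fps_cnj fps_X = fps_X"
  by (rule fps_ext) (simp add: fps_X_def)

lemma fps_cnj_sum: "fps_cnj (\<Sum>i\<in>A. f i) = (\<Sum>i\<in>A. fps_cnj (f i))"
  by (rule fps_ext) (simp add: fps_sum_nth)

definition nest_cnj :: "nest \<Rightarrow> nest" where
  "nest_cnj F = Abs_fps (\<lambda>k. fps_cnj (F $ k))"

lemma nest_cnj_nth [simp]: "nest_cnj F $ k = fps_cnj (F $ k)"
  by (simp add: nest_cnj_def)

lemma nest_cnj_mult: "nest_cnj (F * G) = nest_cnj F * nest_cnj G"
  by (rule fps_ext) (simp add: fps_mult_nth fps_cnj_sum fps_cnj_mult)

lemma nest_cnj_1 [simp]: "nest_cnj 1 = 1"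
  by (rule fps_ext) simp

lemma nest_cnj_X [simp]: "nest_cnj fps_X = fps_X"
  by (rule fps_ext) (simp add: fps_X_def)

lemma nest2_cnj: "nest2 (\<lambda>m. cnj (f m)) = nest_cnj (nest2 f)"
  by (intro fps_ext) (simp add: nest2_nth)

text \<open>\<open>e (z z\<^sup>*)\<close>, with outer variable \<open>z\<^sup>*\<close>.\<close>

lemma fps_const_sum: "fps_const (\<Sum>i\<in>A. f i) = (\<Sum>i\<in>A. fps_const (f i))"
  for f :: "_ \<Rightarrow> 'a::comm_monoid_add"
  by (rule fps_ext) (simp add: fps_sum_nth)

definition twist :: "complex fps \<Rightarrow> nest" where
  "twist e = Abs_fps (\<lambda>b. fps_const (e $ b) * fps_X ^ b)"

lemma twist_nth: "twist e $ b = fps_const (e $ b) * fps_X ^ b"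
  by (simp add: twist_def)

lemma twist_mult: "twist (e * f) = twist e * twist f"
proof (rule fps_ext)
  fix n
  have "(twist e * twist f) $ n = (\<Sum>i=0..n. fps_const (e $ i * f $ (n - i)) * fps_X ^ n)"
    unfolding fps_mult_nth twist_nth
  proof (rule sum.cong)
    fix i assume "i \<in> {0..n}"
    then have "fps_X ^ n = fps_X ^ i * (fps_X ^ (n - i) :: complex fps)" by (simp flip: power_add)
    then show "fps_const (e $ i) * fps_X ^ i * (fps_const (f $ (n - i)) * fps_X ^ (n - i)) =
         fps_const (e $ i * f $ (n - i)) * fps_X ^ n"
      by (simp add: mult_ac flip: fps_const_mult)
  qed simp
  also have "\<dots> = twist (e * f) $ n"
    by (simp add: twist_nth fps_mult_nth flip: fps_const_sum sum_distrib_right)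
  finally show "twist (e * f) $ n = (twist e * twist f) $ n" by simp
qed

definition outer :: "complex fps \<Rightarrow> nest" where
  "outer q = Abs_fps (\<lambda>b. fps_const (q $ b))"

lemma outer_nth: "outer q $ b = fps_const (q $ b)"
  by (simp add: outer_def)

lemma along2_twist: "along2 fps_X (fps_const y * fps_X) (twist e) = e oo (fps_const y * fps_X\<^sup>2)"
proof (rule fps_ext)
  fix N
  have "(twist e $ k oo fps_X) * (fps_const y * fps_X) ^ k = fps_const (e $ k) * (fps_const y * fps_X\<^sup>2) ^ k" for k
    by (simp add: twist_nth power_mult_distrib power2_eq_square mult_ac del: fps_const_power)
  then show "along2 fps_X (fps_const y * fps_X) (twist e) $ N = (e oo (fps_const y * fps_X\<^sup>2)) $ N"
    by (simp only: along2_nth fps_compose_nth atLeast0AtMost fps_mult_left_const_nth)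
qed

lemma along2_outer: "along2 z w (outer q) = q oo w"
  by (rule fps_ext) (simp add: along2_nth outer_nth fps_compose_nth atLeast0AtMost)

text \<open>The first terms of \<open>exp (\<i> m arcsin t)\<close>. They follow from
  \<open>E_fps_equation\<close> for \<open>m = 1\<close> and then by repeated multiplication with
  \<open>1 + \<i> t - t\<^sup>2 / 2\<close>, the cubic coefficient of \<open>E_fps\<close> being
  0.\<close>

lemma E_pow_nth:
  "(E_fps ^ m) $ 0 = 1" "(E_fps ^ m) $ 1 = \<i> * of_nat m" "(E_fps ^ m) $ 2 = - (of_nat m)\<^sup>2 / 2"
  "(E_fps ^ m) $ 3 = \<i> * (of_nat m - of_nat m ^ 3) / 6"
proof -
  have X: "(2 * fps_const \<i> * fps_X * E_fps) $ Suc n = 2 * \<i> * E_fps $ n" for n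
  proof -
    have "2 * fps_const \<i> * fps_X * E_fps = fps_const (2 * \<i>) * (fps_X * E_fps)"
      by (simp add: numeral_fps_const mult_ac flip: fps_const_mult)
    then show ?thesis
      by (simp only: fps_mult_left_const_nth fps_X_mult_nth) simp
  qed
  have eq: "(E_fps\<^sup>2 - 1) $ Suc n = 2 * \<i> * E_fps $ n" for n
    unfolding E_fps_equation by (rule X)
  have e1: "E_fps $ 1 = \<i>"
    using eq[of 0] by (simp add: power2_eq_square fps_mult_nth)
  have e2: "E_fps $ 2 = -1/2"
    using eq[of 1] e1 by (simp add: power2_eq_square fps_mult_nth numeral_2_eq_2)
      (simp add: complex_eq_iff)
  have e3: "E_fps $ 3 = 0"
    using eq[of 2] e1 e2 by (simp add: power2_eq_square fps_mult_nth numeral_2_eq_2 numeral_3_eq_3)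
  have "(E_fps ^ m) $ 0 = 1 \<and> (E_fps ^ m) $ 1 = \<i> * of_nat m \<and> (E_fps ^ m) $ 2 = - (of_nat m)\<^sup>2 / 2 \<and>
      (E_fps ^ m) $ 3 = \<i> * (of_nat m - of_nat m ^ 3) / 6"
  proof (induction m)
    case (Suc m)
    have p: "(E_fps * b) $ 1 = b $ 1 + \<i> * b $ 0" "(E_fps * b) $ 2 = b $ 2 + \<i> * b $ 1 - b $ 0 / 2"
        "(E_fps * b) $ 3 = b $ 3 + \<i> * b $ 2 - b $ 1 / 2" for b
      using e1 e2 e3 by (simp_all add: fps_mult_nth numeral_2_eq_2 numeral_3_eq_3)
    from Suc have IH: "(E_fps ^ m) $ 0 = 1" "(E_fps ^ m) $ 1 = \<i> * of_nat m"
      "(E_fps ^ m) $ 2 = - (of_nat m)\<^sup>2 / 2" "(E_fps ^ m) $ 3 = \<i> * (of_nat m - of_nat m ^ 3) / 6"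
      by blast+
    show ?case
      unfolding power_Suc p IH
      by (simp add: fps_nth_power_0) (simp add: field_simps power2_eq_square power3_eq_cube)
  qed simp_all
  then show "(E_fps ^ m) $ 0 = 1" "(E_fps ^ m) $ 1 = \<i> * of_nat m" "(E_fps ^ m) $ 2 = - (of_nat m)\<^sup>2 / 2"
    "(E_fps ^ m) $ 3 = \<i> * (of_nat m - of_nat m ^ 3) / 6" by blast+
qed

lemma twist_outer_nth:
  "(twist e * outer q) $ b $ n = (if n \<le> b then e $ n * q $ (b - n) else 0)"
proof -
  have "(twist e * outer q) $ b $ n = (\<Sum>i=0..b. if i = n then e $ n * q $ (b - n) else 0)"
    unfolding fps_mult_nth[of "twist e"] twist_nth outer_nth fps_sum_nth
  proof (intro sum.cong refl)
    fix i
    have "fps_const (e $ i) * fps_X ^ i * fps_const (q $ (b - i)) = fps_const (e $ i * q $ (b - i)) * fps_X ^ i"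
      by (simp add: mult_ac flip: fps_const_mult)
    then show "(fps_const (e $ i) * fps_X ^ i * fps_const (q $ (b - i))) $ n = (if i = n then e $ n * q $ (b - n) else 0)"
      by (simp only: fps_mult_left_const_nth fps_X_power_iff) auto
  qed
  then show ?thesis by simp
qed

lemma const_twist_nth:
  "(fps_const p * twist e) $ b $ n = (if b \<le> n then e $ b * p $ (n - b) else 0)"
proof -
  have "(fps_const p * twist e) $ b = fps_const (e $ b) * (fps_X ^ b * p)"
    by (simp add: twist_nth mult_ac)
  then show ?thesis
    by (simp only: fps_mult_left_const_nth fps_X_power_mult_nth) auto
qed

section \<open>The functional equation\<close>

abbreviation cc :: "complex \<Rightarrow> nest" where "cc a \<equiv> fps_const (fps_const a)"

lemma along2_cc [simp]: "along2 z w (cc a) = fps_const a"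
  by (simp add: along2_const)

lemma along2_sum: "along2 z w (\<Sum>i\<in>A. f i) = (\<Sum>i\<in>A. along2 z w (f i))"
  by (induction A rule: infinite_finite_induct) (auto simp: along2_add)

lemma cc_mult_nth [simp]: "(cc a * F) $ b $ n = a * F $ b $ n"
  by simp

lemma outer_X: "outer fps_X = fps_X"
  by (rule fps_ext) (auto simp: outer_nth fps_X_def)

lemma const_X_mult_nth: "(fps_const fps_X * F) $ b $ n = (if n = 0 then 0 else F $ b $ (n - 1))"
  for F :: nest
  by (simp add: fps_X_mult_nth)

text \<open>\<open>p\<close> stands for the new coefficient of \<open>P\<close> at level
  \<open>k\<close>, and \<open>h\<close> for that of \<open>f\<close> multiplied by
  \<open>cnj l\<close>. The two terms on the right are the products of the new coefficient of
  \<open>f\<close> with \<open>f\<^sub>0 = l z\<close> and with its conjugate, the factor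
  \<open>l\<close> being absorbed in \<open>h\<close>.\<close>

lemma linearized_coeffs:
  assumes eq: "twist (E_fps ^ 2) * outer (fps_cnj p) - fps_const p * twist (E_fps ^ k) =
     cc (2 * \<i>) * twist E_fps * (fps_const fps_X * outer (fps_cnj h) + fps_const h * twist (E_fps ^ k) * outer fps_X)"
  shows "(if n \<le> b then (E_fps ^ 2) $ n * cnj (p $ (b - n)) else 0) - (if b \<le> n then (E_fps ^ k) $ b * p $ (n - b) else 0)
    = 2 * \<i> * ((if 1 \<le> n \<and> n - 1 \<le> b then E_fps $ (n - 1) * cnj (h $ (b - (n - 1))) else 0)
       + (if 1 \<le> b \<and> b - 1 \<le> n then (E_fps ^ Suc k) $ (b - 1) * h $ (n - (b - 1)) else 0))"
proof -
  have "cc (2 * \<i>) * twist E_fps * (fps_const fps_X * outer (fps_cnj h) + fps_const h * twist (E_fps ^ k) * outer fps_X) =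
      cc (2 * \<i>) * (fps_const fps_X * (twist E_fps * outer (fps_cnj h)) + fps_X * (fps_const h * twist (E_fps ^ Suc k)))"
    by (simp only: power_Suc twist_mult outer_X distrib_left mult_ac)
  then have "(twist (E_fps ^ 2) * outer (fps_cnj p)) $ b $ n - (fps_const p * twist (E_fps ^ k)) $ b $ n =
      (cc (2 * \<i>) * (fps_const fps_X * (twist E_fps * outer (fps_cnj h)) + fps_X * (fps_const h * twist (E_fps ^ Suc k)))) $ b $ n"
    using eq by (metis fps_sub_nth)
  also have "\<dots> = 2 * \<i> * ((fps_const fps_X * (twist E_fps * outer (fps_cnj h))) $ b $ n + (fps_X * (fps_const h * twist (E_fps ^ Suc k))) $ b $ n)"
    by (simp only: cc_mult_nth fps_add_nth)
  also have "(fps_X * (fps_const h * twist (E_fps ^ Suc k))) $ b $ n = (if 1 \<le> b \<and> b - 1 \<le> n then (E_fps ^ Suc k) $ (b - 1) * h $ (n - (b - 1)) else 0)"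
    unfolding fps_X_mult_nth by (cases b) (simp_all add: const_twist_nth del: power_Suc fps_mult_left_const_nth)
  also have "(fps_const fps_X * (twist E_fps * outer (fps_cnj h))) $ b $ n = (if 1 \<le> n \<and> n - 1 \<le> b then E_fps $ (n - 1) * cnj (h $ (b - (n - 1))) else 0)"
    unfolding const_X_mult_nth twist_outer_nth by (auto simp: Suc_le_eq)
  finally show ?thesis by (simp only: twist_outer_nth const_twist_nth fps_cnj_nth)
qed

text \<open>Only the coefficients of order at most three in the conjugate variable are needed.\<close>

lemma linearized_kernel:
  assumes eq: "twist (E_fps ^ 2) * outer (fps_cnj p) - fps_const p * twist (E_fps ^ k) =
     cc (2 * \<i>) * twist E_fps * (fps_const fps_X * outer (fps_cnj h) + fps_const h * twist (E_fps ^ k) * outer fps_X)"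
    and k: "k \<ge> 1"
  shows "h = fps_const (h $ 0)" "p = fps_const (p $ 0) + fps_const (- 2 * \<i> * cnj (h $ 0)) * fps_X"
    "Im (p $ 0) = 0" "k \<noteq> 1 \<Longrightarrow> h $ 0 = 0" "k \<noteq> 2 \<Longrightarrow> p $ 0 = 0"
proof -
  \<comment> \<open>In \<open>co[of n b]\<close> the exponent of \<open>z\<close> is
    \<open>n\<close> and that of \<open>z\<^sup>*\<close> is \<open>b\<close>. The column
    \<open>b = 0\<close> fixes \<open>p\<close> up to \<open>p $ 0\<close> and \<open>h $ 0\<close>,
    the column \<open>b = 1\<close> bounds the degree of \<open>h\<close> by 2, and
    \<open>b = 2\<close>, \<open>b = 3\<close> yield the conditions on \<open>k\<close>.\<close>
  note co = linearized_coeffs[OF eq]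
  have E1: "E_fps $ 0 = 1" "E_fps $ Suc 0 = \<i>" "E_fps $ 2 = -1/2"
    using E_pow_nth[of 1] by simp_all
  have E2: "(E_fps ^ 2) $ 0 = 1" "(E_fps ^ 2) $ Suc 0 = 2 * \<i>" "(E_fps ^ 2) $ 2 = -2" "(E_fps ^ 2) $ 3 = - \<i>"
    using E_pow_nth[of 2] by simp_all
  have Ek: "(E_fps ^ m) $ 0 = 1" "(E_fps ^ m) $ Suc 0 = \<i> * of_nat m" "(E_fps ^ m) $ 2 = - (of_nat m)\<^sup>2 / 2"
  "(E_fps ^ m) $ 3 = \<i> * (of_nat m - of_nat m ^ 3) / 6" for m
    using E_pow_nth[of m] by simp_all
  define K :: complex where "K = of_nat k"
  have Ks: "of_nat (Suc k) = K + 1" by (simp add: K_def)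
  have K0: "K \<noteq> 0" "K + 2 \<noteq> 0"
    using k by (auto simp: K_def complex_eq_iff)
  have p0: "cnj (p $ 0) = p $ 0"
    using co[of 0 0] by (simp add: fps_nth_power_0)
  have p1: "p $ 1 = - 2 * \<i> * cnj (h $ 0)"
  proof -
    have "- p $ 1 = 2 * \<i> * cnj (h $ 0)"
      using co[of 1 0] by (simp add: fps_nth_power_0)
    from arg_cong[OF this, of uminus] show ?thesis by simp
  qed
  have pn: "p $ n = 0" if "n \<ge> 2" for n
    using co[of n 0] that by (simp add: fps_nth_power_0)
  have h1: "2 * \<i> * p $ 0 - \<i> * K * p $ 0 = 2 * \<i> * (cnj (h $ 1) + h $ 1)"
    using co[of 1 1] by (simp add: E1 E2 Ek p0 K_def mult_ac del: power_Suc)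
  have h2: "h $ 2 = \<i> * (K - 1) * cnj (h $ 0)"
  proof -
    have "- \<i> * K * p $ 1 = 2 * \<i> * (\<i> * cnj (h $ 0) + h $ 2)"
      using co[of 2 1] by (simp add: E1 E2 Ek K_def del: power_Suc)
    then have "2 * \<i> * h $ 2 = 2 * \<i> * (\<i> * (K - 1) * cnj (h $ 0))"
      unfolding p1 by (simp add: algebra_simps)
    then show ?thesis by (simp only: mult_cancel_left) simp
  qed
  have hn: "h $ n = 0" if "n \<ge> 3" for n
  proof -
    from \<open>n \<ge> 3\<close> obtain m where "n = Suc (Suc (Suc m))" by (metis Suc_le_D Suc_le_mono numeral_3_eq_3)
    then show ?thesis using co[of n 1] pn[of "n-1"] by (simp add: E1 E2 Ek del: power_Suc)
  qed
  have h1': "4 * h $ 1 = - (K - 2) * p $ 0"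
  proof -
    have "-2 * p $ 0 + K\<^sup>2 / 2 * p $ 0 = 2 * \<i> * (\<i> * cnj (h $ 1) + \<i> * (K + 1) * h $ 1)"
      using co[of 2 2] by (simp add: E1 E2 Ek Ks p0 del: power_Suc) (simp add: K_def algebra_simps)
    then have *: "(K\<^sup>2 / 2 - 2) * p $ 0 = -2 * cnj (h $ 1) - 2 * (K + 1) * h $ 1"
      by (simp add: algebra_simps)
    have "\<i> * (2 * cnj (h $ 1)) = \<i> * ((2 - K) * p $ 0 - 2 * h $ 1)"
      using h1 by (simp add: algebra_simps)
    then have "2 * cnj (h $ 1) = (2 - K) * p $ 0 - 2 * h $ 1"
      by (simp only: mult_cancel_left) simp
    with * have "(K\<^sup>2 / 2 - 2) * p $ 0 = - ((2 - K) * p $ 0 - 2 * h $ 1) - 2 * (K + 1) * h $ 1"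
      by (metis mult_minus_left)
    then have "K * (4 * h $ 1) = K * (- (K - 2) * p $ 0)"
      by (simp add: field_simps power2_eq_square)
    then show ?thesis using K0 by (simp only: mult_cancel_left) simp
  qed
  have h0: "(K\<^sup>2 - 1) * cnj (h $ 0) = 0"
  proof -
    have "K\<^sup>2 / 2 * p $ 1 = 2 * \<i> * (- cnj (h $ 0) / 2 + \<i> * (K + 1) * h $ 2)"
      using co[of 3 2] by (simp add: E1 E2 Ek Ks del: power_Suc) (simp add: K_def algebra_simps)
    then show ?thesis unfolding p1 h2 by (simp add: field_simps power2_eq_square)
  qed
  have cnj_h1: "cnj (h $ 1) = h $ 1"
  proof -
    have "cnj (4 * h $ 1) = 4 * h $ 1" unfolding h1' using p0 by (simp add: K_def)
    then show ?thesis by simp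
  qed
  \<comment> \<open>The coefficient with \<open>n = b = 3\<close>, which involves the cubic term of
    \<open>E ^ k\<close>; \<open>h $ 1\<close> is eliminated through \<open>h1'\<close>. For
    \<open>k \<ge> 1\<close> only \<open>k = 2\<close> leaves \<open>p $ 0\<close> free, and real:
    the source of \<open>s\<close>.\<close>
  have pK: "K * (K - 2) * (K + 2) * p $ 0 = 0"
  proof -
    have "- \<i> * p $ 0 - \<i> * (K - K ^ 3) / 6 * p $ 0 = 2 * \<i> * (- h $ 1 / 2 - (K + 1)\<^sup>2 / 2 * h $ 1)"
      using co[of 3 3] by (simp add: E1 E2 Ek Ks p0 cnj_h1[simplified] del: power_Suc) (simp add: K_def algebra_simps)
    then have "\<i> * (- p $ 0 - (K - K ^ 3) / 6 * p $ 0) = \<i> * (2 * (- h $ 1 / 2 - (K + 1)\<^sup>2 / 2 * h $ 1))"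
      by (simp add: algebra_simps)
    then have "- p $ 0 - (K - K ^ 3) / 6 * p $ 0 = 2 * (- h $ 1 / 2 - (K + 1)\<^sup>2 / 2 * h $ 1)"
      by (simp only: mult_cancel_left) simp
    then have "12 * p $ 0 + 2 * (K - K ^ 3) * p $ 0 = 3 * (4 * h $ 1) * (1 + (K + 1)\<^sup>2)"
      by (simp add: field_simps)
    then show ?thesis unfolding h1' by (simp add: algebra_simps power2_eq_square power3_eq_cube)
  qed
  show p00: "p $ 0 = 0" if "k \<noteq> 2"
  proof -
    have "K - 2 \<noteq> 0" using that of_nat_eq_iff[of k 2, where 'a = complex] by (simp add: K_def)
    then show ?thesis using pK K0 by simp
  qed
  show h00: "h $ 0 = 0" if "k \<noteq> 1"
  proof -
    have "K\<^sup>2 \<noteq> 1" using that k unfolding K_def by (metis of_nat_eq_1_iff of_nat_power power_eq_1_iff not_one_le_zero zero_neq_numeral nat_power_eq_Suc_0_iff One_nat_def)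
    then show ?thesis using h0 by simp
  qed
  have "h $ 1 = 0" using h1' p00 by (cases "k = 2") (auto simp: K_def)
  moreover have "h $ 2 = 0" using h2 h00 by (cases "k = 1") (auto simp: K_def)
  ultimately have "h $ n = 0" if "n > 0" for n
    using that hn[of n] by (cases "n = 1"; cases "n = 2") auto
  then show "h = fps_const (h $ 0)" by (intro fps_ext) auto
  show "Im (p $ 0) = 0" using p0 by (simp add: complex_eq_iff)
  show "p = fps_const (p $ 0) + fps_const (- 2 * \<i> * cnj (h $ 0)) * fps_X"
  proof (rule fps_ext)
    fix n show "p $ n = (fps_const (p $ 0) + fps_const (- 2 * \<i> * cnj (h $ 0)) * fps_X) $ n"
      using p1 pn[of n] by (cases n rule: nat.exhaust; cases "n = 1") (auto simp: fps_X_def)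
  qed
qed


section \<open>Splitting the functional equation into levels and solving them\<close>

abbreviation zz :: nest where "zz \<equiv> fps_const fps_X"
abbreviation ww :: nest where "ww \<equiv> fps_X"

definition theta_sq :: "complex \<Rightarrow> real \<Rightarrow> nest" where
  "theta_sq \<alpha> s = 1 - cc (2 * \<i> * cnj \<alpha>) * zz * ww - cc (of_real s + \<i> * of_real ((norm \<alpha>)\<^sup>2)) * ww\<^sup>2"

lemma nest_eqI: "(\<And>k n. F $ k $ n = G $ k $ n) \<Longrightarrow> F = G" for F G :: nest
  by (intro fps_ext) auto

lemma level_equations:
  fixes P f :: nest
  assumes eq: "\<And>y u. y \<noteq> 0 \<Longrightarrow> u \<noteq> 0 \<Longrightarrow>
      (let c = fps_const y * fps_X; t = fps_const u * fps_X; e = E_fps oo (fps_const y * fps_X\<^sup>2) in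
        e\<^sup>2 * along2 c t (nest_cnj P) - along2 fps_X (t * e) P =
        fps_const (2 * \<i>) * e * along2 fps_X (t * e) f * along2 c t (nest_cnj f))"
  shows "twist (E_fps ^ 2) * outer (fps_cnj (P $ k)) - fps_const (P $ k) * twist (E_fps ^ k) =
     cc (2 * \<i>) * twist E_fps * (\<Sum>j=0..k. fps_const (f $ j) * twist (E_fps ^ j) * outer (fps_cnj (f $ (k - j))))"
proof (rule along2_eqI)
  fix y :: complex assume y: "y \<noteq> 0"
  define c where "c = fps_const y * fps_X"
  define e where "e = E_fps oo (fps_const y * fps_X\<^sup>2)"
  \<comment> \<open>\<open>lft\<close> rewrites a series in \<open>z\<close>, \<open>w\<close> as
    one in \<open>z\<close>, \<open>w\<^sup>*\<close> through \<open>w = w\<^sup>* e\<close>;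
    \<open>rgt\<close> restricts a series in \<open>z\<^sup>*\<close>, \<open>w\<^sup>*\<close> to
    \<open>z\<^sup>* = c\<close>. Both keep \<open>w\<^sup>*\<close> as the outer variable.\<close>
  define lft where "lft = (\<lambda>A::nest. Abs_fps (\<lambda>k. A $ k * e ^ k))"
  define rgt where "rgt = (\<lambda>A::nest. Abs_fps (\<lambda>k. A $ k oo c))"
  have lft: "along2 fps_X t (lft A) = along2 fps_X (t * e) A" for t A
    by (rule fps_ext) (simp add: along2_nth lft_def power_mult_distrib mult_ac)
  have rgt: "along2 fps_X t (rgt A) = along2 c t A" for t A
    by (rule fps_ext) (simp add: along2_nth rgt_def)
  have "fps_const (e\<^sup>2) * rgt (nest_cnj P) - lft P = cc (2 * \<i>) * fps_const e * lft f * rgt (nest_cnj f)"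
  proof (rule along2_eqI)
    fix u :: complex assume u: "u \<noteq> 0"
    show "along2 fps_X (fps_const u * fps_X) (fps_const (e\<^sup>2) * rgt (nest_cnj P) - lft P) =
       along2 fps_X (fps_const u * fps_X) (cc (2 * \<i>) * fps_const e * lft f * rgt (nest_cnj f))"
      using eq[OF y u]
      by (simp add: along2_mult along2_diff lft rgt along2_const Let_def c_def e_def del: fps_const_mult fps_const_power)
  qed
  then have "(fps_const (e\<^sup>2) * rgt (nest_cnj P) - lft P) $ k = (cc (2 * \<i>) * (fps_const e * (lft f * rgt (nest_cnj f)))) $ k"
    by (simp only: mult.assoc)
  then have "e\<^sup>2 * (fps_cnj (P $ k) oo c) - P $ k * e ^ k =
      fps_const (2 * \<i>) * (e * (\<Sum>j=0..k. f $ j * e ^ j * (fps_cnj (f $ (k - j)) oo c)))"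
    by (simp only: fps_sub_nth fps_mult_left_const_nth fps_mult_nth[of "lft f"]) (simp add: lft_def rgt_def)
  moreover have tw: "along2 fps_X c (twist (E_fps ^ j)) = e ^ j" for j
    by (simp add: c_def e_def along2_twist fps_compose_power)
  moreover have "along2 fps_X c (twist E_fps) = e" using tw[of 1] by simp
  moreover have "c $ 0 = 0" by (simp add: c_def)
  ultimately show "along2 fps_X (fps_const y * fps_X) (twist (E_fps ^ 2) * outer (fps_cnj (P $ k)) - fps_const (P $ k) * twist (E_fps ^ k)) =
     along2 fps_X (fps_const y * fps_X) (cc (2 * \<i>) * twist E_fps * (\<Sum>j=0..k. fps_const (f $ j) * twist (E_fps ^ j) * outer (fps_cnj (f $ (k - j)))))"
    unfolding c_def[symmetric]
    by (simp add: along2_mult along2_diff along2_const along2_outer along2_sum mult.assoc del: fps_const_mult)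
qed

text \<open>Level 0 gives \<open>l \<noteq> 0\<close> because \<open>P $ 0 $ 0 \<noteq> 0\<close>;
  after that each level is the linear problem solved above, up to the products of
  \<open>f\<^sub>j\<close> with \<open>f\<^sub>k\<^sub>-\<^sub>j\<close> for
  \<open>1 \<le> j < k\<close>. These vanish unless \<open>k = 2\<close>, since
  \<open>f\<^sub>j = 0\<close> for \<open>j \<ge> 2\<close>.\<close>

lemma solve_level_equations:
  fixes P f :: nest
  assumes eq: "\<And>k. twist (E_fps ^ 2) * outer (fps_cnj (P $ k)) - fps_const (P $ k) * twist (E_fps ^ k) =
     cc (2 * \<i>) * twist E_fps * (\<Sum>j=0..k. fps_const (f $ j) * twist (E_fps ^ j) * outer (fps_cnj (f $ (k - j))))"
    and f00: "f $ 0 $ 0 = 0" and P00: "P $ 0 $ 0 \<noteq> 0"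
  obtains l \<alpha> :: complex and s :: real where "l \<noteq> 0" "P = cc (of_real ((norm l)\<^sup>2)) * theta_sq \<alpha> s"
    "f = cc l * (zz + cc \<alpha> * ww)"
proof -
  define l where "l = f $ 0 $ 1"
  define \<mu> where "\<mu> = f $ 1 $ 0"
  have eq0: "(twist (E_fps ^ 2) * outer (fps_cnj (P $ 0))) $ b $ n - (fps_const (P $ 0) * twist 1) $ b $ n =
      2 * \<i> * (f $ 0 * (twist E_fps * outer (fps_cnj (f $ 0))) $ b) $ n" for b n
  proof -
    have "twist 1 = 1" by (rule fps_ext) (auto simp: twist_nth)
    then have "twist (E_fps ^ 2) * outer (fps_cnj (P $ 0)) - fps_const (P $ 0) * twist 1 =
       cc (2 * \<i>) * (fps_const (f $ 0) * (twist E_fps * outer (fps_cnj (f $ 0))))"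
      using eq[of 0] by (simp add: mult_ac)
    then have "(twist (E_fps ^ 2) * outer (fps_cnj (P $ 0)) - fps_const (P $ 0) * twist 1) $ b $ n =
       (cc (2 * \<i>) * (fps_const (f $ 0) * (twist E_fps * outer (fps_cnj (f $ 0))))) $ b $ n" by simp
    then show ?thesis by (simp only: cc_mult_nth fps_sub_nth fps_mult_left_const_nth)
  qed
  have E1: "E_fps $ Suc 0 = \<i>" using E_pow_nth(2)[of 1] by simp
  have P0: "P $ 0 $ n = (if n = 0 then cnj (P $ 0 $ 0) else 0)" for n
  proof -
    have "(twist E_fps * outer (fps_cnj (f $ 0))) $ 0 = 0"
      by (rule fps_ext) (auto simp: twist_outer_nth f00 simp del: fps_mult_nth_0)
    then show ?thesis using eq0[of 0 n]
      by (simp add: twist_outer_nth const_twist_nth fps_nth_power_0 split: if_splits del: fps_mult_nth_0 fps_mult_left_const_nth)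
  qed
  \<comment> \<open>The terms of first order in \<open>z\<^sup>*\<close>. The case
    \<open>n = 1\<close> reads \<open>|l|\<^sup>2 = cnj (P $ 0 $ 0)\<close>; it makes this constant
    real and positive, hence \<open>l \<noteq> 0\<close>, so that the other cases determine
    \<open>f $ 0\<close>.\<close>
  have f0: "f $ 0 $ n * cnj l = (if n = 1 then cnj (P $ 0 $ 0) else 0)" for n
  proof -
    have "(twist E_fps * outer (fps_cnj (f $ 0))) $ 1 = fps_const (cnj l)"
    proof (rule fps_ext)
      fix n show "(twist E_fps * outer (fps_cnj (f $ 0))) $ 1 $ n = fps_const (cnj l) $ n"
        unfolding twist_outer_nth by (cases n; cases "n - 1") (auto simp: f00 l_def)
    qed
    then have "(twist (E_fps ^ 2) * outer (fps_cnj (P $ 0))) $ 1 $ n - (fps_const (P $ 0) * twist 1) $ 1 $ n =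
      2 * \<i> * (f $ 0 $ n * cnj l)"
      unfolding eq0 by simp
    moreover have "(fps_const (P $ 0) * twist 1) $ 1 $ n = 0" unfolding const_twist_nth by simp
    moreover have "(twist (E_fps ^ 2) * outer (fps_cnj (P $ 0))) $ 1 $ n = (if n = 1 then 2 * \<i> * cnj (P $ 0 $ 0) else 0)"
      unfolding twist_outer_nth using P0[of 1] E_pow_nth(2)[of 2] by (cases n; cases "n - 1") auto
    ultimately show ?thesis by (auto split: if_splits)
  qed
  define c where "c = (norm l)\<^sup>2"
  have cl: "l * cnj l = of_real c" unfolding c_def by (rule complex_norm_square[symmetric])
  have c: "P $ 0 $ 0 = of_real c"
    using f0[of 1] P0[of 0] cl by (simp add: l_def)
  then have l0: "l \<noteq> 0" and c0: "c \<noteq> 0" using P00 by (auto simp: c_def)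
  have f0': "f $ 0 = fps_const l * fps_X"
  proof (rule fps_ext)
    fix n show "f $ 0 $ n = (fps_const l * fps_X) $ n"
      using f0[of n] l0 by (cases "n = 1") (auto simp: l_def fps_X_def)
  qed
  have P0': "P $ 0 = fps_const (of_real c)"
    by (rule fps_ext, subst P0) (simp add: c)
  have out_const: "outer (fps_const a * q) = cc a * outer q" for a q
    by (rule fps_ext) (simp add: outer_nth)
  have out_const': "outer (q * fps_const a) = outer q * cc a" for a q
    using out_const by (simp add: mult.commute)
  have kernel_step: "f $ k = fps_const (f $ k $ 0) \<and>
      P $ k = fps_const (P $ k $ 0) + fps_const (- 2 * \<i> * l * cnj (f $ k $ 0)) * fps_X \<and>
      Im (P $ k $ 0) = - \<nu> \<and> (k \<noteq> 1 \<longrightarrow> f $ k $ 0 = 0) \<and> (k \<noteq> 2 \<longrightarrow> P $ k $ 0 = 0)"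
    if k: "k \<ge> 1" and \<nu>: "\<nu> = 0 \<or> k = 2"
      and mid: "(\<Sum>j=1..<k. fps_const (f $ j) * twist (E_fps ^ j) * outer (fps_cnj (f $ (k - j)))) = cc (of_real \<nu>) * twist E_fps"
    for k and \<nu> :: real
  proof -
    \<comment> \<open>The source \<open>2 \<i> \<nu> E\<^sup>2\<close> is removed by an imaginary
      shift: at \<open>k = 2\<close>, adding \<open>\<i> \<nu>\<close> to \<open>P $ k\<close>
      changes the left side of the level equation by \<open>- 2 \<i> \<nu> E\<^sup>2\<close>. The
      factor \<open>cnj l\<close> in \<open>h\<close> reduces \<open>f\<^sub>0 = l z\<close> to
      \<open>z\<close>.\<close>
    define q where "q = P $ k + fps_const (\<i> * of_real \<nu>)"
    define h where "h = fps_const (cnj l) * f $ k"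
    have "(\<Sum>j=0..k. fps_const (f $ j) * twist (E_fps ^ j) * outer (fps_cnj (f $ (k - j)))) =
        fps_const (f $ 0) * outer (fps_cnj (f $ k)) + fps_const (f $ k) * twist (E_fps ^ k) * outer (fps_cnj (f $ 0))
        + cc (of_real \<nu>) * twist E_fps"
    proof -
      have tw1: "twist 1 = 1" by (rule fps_ext) (auto simp: twist_nth)
      have "{0..k} = insert 0 (insert k {1..<k})" using k by auto
      then show ?thesis using k mid tw1 by simp
    qed
    also have "fps_const (f $ 0) * outer (fps_cnj (f $ k)) = fps_const fps_X * outer (fps_cnj h)"
      by (simp add: f0' h_def fps_cnj_mult out_const mult_ac flip: fps_const_mult)
    also have "fps_const (f $ k) * twist (E_fps ^ k) * outer (fps_cnj (f $ 0)) = fps_const h * twist (E_fps ^ k) * outer fps_X"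
      by (simp add: f0' h_def fps_cnj_mult out_const out_const' mult_ac flip: fps_const_mult)
    finally have e: "twist (E_fps ^ 2) * outer (fps_cnj (P $ k)) - fps_const (P $ k) * twist (E_fps ^ k) =
      cc (2 * \<i>) * twist E_fps * (fps_const fps_X * outer (fps_cnj h) + fps_const h * twist (E_fps ^ k) * outer fps_X)
      + cc (2 * \<i> * of_real \<nu>) * twist (E_fps ^ 2)"
      unfolding eq by (simp add: algebra_simps power2_eq_square twist_mult flip: fps_const_mult)
    have oq: "outer (fps_cnj q) = outer (fps_cnj (P $ k)) - cc (\<i> * of_real \<nu>)"
      by (rule nest_eqI) (auto simp: outer_nth q_def)
    have "twist (E_fps ^ 2) * outer (fps_cnj q) - fps_const q * twist (E_fps ^ k) =
      (twist (E_fps ^ 2) * outer (fps_cnj (P $ k)) - fps_const (P $ k) * twist (E_fps ^ k))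
      - cc (\<i> * of_real \<nu>) * (twist (E_fps ^ 2) + twist (E_fps ^ k))"
      unfolding oq by (simp add: q_def algebra_simps flip: fps_const_add)
    also have "cc (\<i> * of_real \<nu>) * (twist (E_fps ^ 2) + twist (E_fps ^ k)) = cc (2 * \<i> * of_real \<nu>) * twist (E_fps ^ 2)"
    proof (cases "\<nu> = 0")
      case False
      then have "k = 2" using \<nu> by simp
      moreover have "cc a * (T + T) = cc (2 * a) * T" for a T
        by (rule nest_eqI) simp
      ultimately show ?thesis by (simp add: mult.assoc)
    qed simp
    finally have hom: "twist (E_fps ^ 2) * outer (fps_cnj q) - fps_const q * twist (E_fps ^ k) =
      cc (2 * \<i>) * twist E_fps * (fps_const fps_X * outer (fps_cnj h) + fps_const h * twist (E_fps ^ k) * outer fps_X)"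
      unfolding e by simp
    note ker = linearized_kernel[OF hom k]
    have hn: "h $ n = cnj l * f $ k $ n" for n by (simp add: h_def)
    have "f $ k $ n = 0" if "n > 0" for n
    proof -
      have "h $ n = 0" by (subst ker(1)) (use that in simp)
      then show ?thesis using hn l0 by simp
    qed
    then have "f $ k = fps_const (f $ k $ 0)" by (intro fps_ext) auto
    moreover have "P $ k = fps_const (P $ k $ 0) + fps_const (- 2 * \<i> * l * cnj (f $ k $ 0)) * fps_X"
    proof -
      have "P $ k = q - fps_const (\<i> * of_real \<nu>)" by (simp add: q_def)
      also have "q = fps_const (q $ 0) + fps_const (- 2 * \<i> * l * cnj (f $ k $ 0)) * fps_X"
        using ker(2) by (simp add: hn mult.assoc)
      also have "q $ 0 = P $ k $ 0 + \<i> * of_real \<nu>" by (simp add: q_def)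
      finally show ?thesis by (simp flip: fps_const_add)
    qed
    moreover have "Im (P $ k $ 0) = - \<nu>" using ker(3) by (simp add: q_def)
    moreover have "f $ k $ 0 = 0" if "k \<noteq> 1" using ker(4)[OF that] hn[of 0] l0 by simp
    moreover have "P $ k $ 0 = 0" if "k \<noteq> 2" using ker(5)[OF that] \<nu> that by (simp add: q_def)
    ultimately show ?thesis by blast
  qed
  have k1: "f $ 1 = fps_const \<mu>" "P $ 1 = fps_const (- 2 * \<i> * l * cnj \<mu>) * fps_X"
    using kernel_step[of 1 0] by (auto simp: \<mu>_def)
  \<comment> \<open>The one possible source term is
    \<open>f\<^sub>1 E f\<^sub>1\<^sup>* = |\<mu>|\<^sup>2 E\<close>. It fixes the imaginary part of
    \<open>P $ 2 $ 0\<close>, while the real part stays free.\<close>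
  have k2: "f $ 2 = 0" "P $ 2 = fps_const (P $ 2 $ 0)" "Im (P $ 2 $ 0) = - (norm \<mu>)\<^sup>2"
  proof -
    have "{1..<2::nat} = {1}" by auto
    then have "(\<Sum>j=1..<2. fps_const (f $ j) * twist (E_fps ^ j) * outer (fps_cnj (f $ (2 - j)))) = cc (of_real ((norm \<mu>)\<^sup>2)) * twist E_fps"
    proof -
      have "outer (fps_const a) = cc a" for a by (rule nest_eqI) (simp add: outer_nth)
      then show ?thesis using \<open>{1..<2::nat} = {1}\<close> k1(1) complex_norm_square[of \<mu>]
        by (simp add: mult_ac flip: fps_const_mult)
    qed
    from kernel_step[OF _ _ this] show "f $ 2 = 0" "P $ 2 = fps_const (P $ 2 $ 0)" "Im (P $ 2 $ 0) = - (norm \<mu>)\<^sup>2"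
      by auto
  qed
  have k3: "f $ k = 0 \<and> P $ k = 0" if "k \<ge> 3" for k
    using that
  proof (induction k rule: less_induct)
    case (less k)
    have z: "f $ j = 0" if "2 \<le> j" "j < k" for j
      using that k2 less.IH[of j] by (cases "j = 2") auto
    have "(\<Sum>j=1..<k. fps_const (f $ j) * twist (E_fps ^ j) * outer (fps_cnj (f $ (k - j)))) = 0"
    proof (rule sum.neutral, rule ballI)
      \<comment> \<open>For \<open>k \<ge> 3\<close> at least one of \<open>j\<close> and
        \<open>k - j\<close> is 2 or more, and both are below \<open>k\<close>.\<close>
      fix j assume j: "j \<in> {1..<k}"
      have "outer 0 = 0" by (rule nest_eqI) (simp add: outer_nth)
      then show "fps_const (f $ j) * twist (E_fps ^ j) * outer (fps_cnj (f $ (k - j))) = 0"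
        using z[of j] z[of "k - j"] j less.prems by (cases "j \<ge> 2") auto
    qed
    then have "(\<Sum>j=1..<k. fps_const (f $ j) * twist (E_fps ^ j) * outer (fps_cnj (f $ (k - j)))) = cc (of_real 0) * twist E_fps"
      by simp
    from kernel_step[OF _ _ this] less.prems show ?case by auto
  qed
  define \<alpha> where "\<alpha> = \<mu> / l"
  define s where "s = - Re (P $ 2 $ 0) / c"
  have \<mu>: "\<mu> = l * \<alpha>" using l0 by (simp add: \<alpha>_def)
  have cases3: "k = 0 \<or> k = 1 \<or> k = 2 \<or> k \<ge> 3" for k :: nat by linarith
  have X01: "(fps_X ^ 2 :: complex fps fps) $ 0 = 0" "(fps_X ^ 2 :: complex fps fps) $ 1 = 0"
     "(fps_X ^ 2 :: complex fps fps) $ 2 = 1" "k \<ge> 3 \<Longrightarrow> (fps_X ^ 2 :: complex fps fps) $ k = 0" for k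
    by (auto simp: fps_X_power_iff)
  have "f = cc l * (zz + cc \<alpha> * ww)"
  proof (rule fps_ext)
    fix k show "f $ k = (cc l * (zz + cc \<alpha> * ww)) $ k"
      using cases3[of k] f0' k1 k2 k3[of k] \<mu> by (auto simp: distrib_left)
  qed
  moreover have "P = cc (of_real c) * theta_sq \<alpha> s"
  proof (rule fps_ext)
    fix k
    have n\<mu>: "(norm \<mu>)\<^sup>2 = c * (norm \<alpha>)\<^sup>2"
      by (simp add: c_def \<mu> norm_mult power_mult_distrib)
    have 1: "of_real c * cnj \<alpha> = l * cnj \<mu>"
      by (simp add: \<mu> mult_ac flip: cl)
    have 2: "P $ 2 $ 0 = - (of_real c * (of_real s + \<i> * of_real ((norm \<alpha>)\<^sup>2)))"
      using k2(3) c0 n\<mu> by (simp add: complex_eq_iff s_def)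
    have "(cc (of_real c) * theta_sq \<alpha> s) $ k = fps_const (of_real c) *
       (1 $ k - fps_const (2 * \<i> * cnj \<alpha>) * (fps_X * (fps_X $ k)) - fps_const (of_real s + \<i> * of_real ((norm \<alpha>)\<^sup>2)) * (fps_X ^ 2 :: nest) $ k)"
      by (simp add: theta_sq_def mult.assoc)
    also have "\<dots> = P $ k"
      using cases3[of k] P0' k1 k2(2) k3[of k] X01
      by (elim disjE) (simp_all add: 1 2 mult.assoc flip: fps_const_neg)
    finally show "P $ k = (cc (of_real c) * theta_sq \<alpha> s) $ k" ..
  qed
  ultimately show ?thesis using that l0 unfolding c_def by blast
qed

section \<open>Power series of holomorphic germs\<close>

definition cdiff :: "(complex \<times> complex \<Rightarrow> complex) \<Rightarrow> complex \<times> complex \<Rightarrow> bool" where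
  "cdiff f p \<longleftrightarrow> (\<exists>L. (f has_derivative L) (at p) \<and> (\<forall>c v. L (c * fst v, c * snd v) = c * L v))"

lemma cholo_imp_cdiff:
  assumes "cholo F U" "p \<in> U"
  shows "cdiff (\<lambda>p. fst (F p)) p" "cdiff (\<lambda>p. snd (F p)) p"
proof -
  obtain L where L: "(F has_derivative L) (at p)"
    "\<And>c v. L (c * fst v, c * snd v) = (c * fst (L v), c * snd (L v))"
    using assms unfolding cholo_def by blast
  show "cdiff (\<lambda>p. fst (F p)) p" unfolding cdiff_def
    by (rule exI[of _ "\<lambda>v. fst (L v)"]) (use L in \<open>auto intro!: derivative_eq_intros\<close>)
  show "cdiff (\<lambda>p. snd (F p)) p" unfolding cdiff_def
    by (rule exI[of _ "\<lambda>v. snd (L v)"]) (use L in \<open>auto intro!: derivative_eq_intros\<close>)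
qed

lemma cdiff_imp_continuous: "cdiff f p \<Longrightarrow> isCont f p"
  unfolding cdiff_def using has_derivative_continuous by blast

lemma cdiff_slice_snd:
  assumes "cdiff f (z, w)"
  shows "(\<lambda>w. f (z, w)) field_differentiable at w"
proof -
  obtain L where L: "(f has_derivative L) (at (z, w))" "\<And>c v. L (c * fst v, c * snd v) = c * L v"
    using assms unfolding cdiff_def by blast
  have "((\<lambda>w. (z, w)) has_derivative (\<lambda>h. (0, h))) (at w)"
    by (auto intro!: derivative_eq_intros)
  from has_derivative_compose[OF this L(1)]
  have "((\<lambda>w. f (z, w)) has_derivative (\<lambda>h. L (0, h))) (at w)" .
  moreover have "(\<lambda>h. L (0, h)) = (*) (L (0, 1))"
  proof
    fix h show "L (0, h) = L (0, 1) * h"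
      using L(2)[of h "(0, 1)"] by (simp add: mult.commute[of h])
  qed
  ultimately show ?thesis
    unfolding field_differentiable_def has_field_derivative_def by metis
qed

lemma cdiff_slice_fst:
  assumes "cdiff f (z, w)"
  shows "(\<lambda>z. f (z, w)) field_differentiable at z"
proof -
  obtain L where L: "(f has_derivative L) (at (z, w))" "\<And>c v. L (c * fst v, c * snd v) = c * L v"
    using assms unfolding cdiff_def by blast
  have "((\<lambda>z. (z, w)) has_derivative (\<lambda>h. (h, 0))) (at z)"
    by (auto intro!: derivative_eq_intros)
  from has_derivative_compose[OF this L(1)]
  have "((\<lambda>z. f (z, w)) has_derivative (\<lambda>h. L (h, 0))) (at z)" .
  moreover have "(\<lambda>h. L (h, 0)) = (*) (L (1, 0))"
  proof
    fix h show "L (h, 0) = L (1, 0) * h"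
      using L(2)[of h "(1, 0)"] by (simp add: mult.commute[of h])
  qed
  ultimately show ?thesis
    unfolding field_differentiable_def has_field_derivative_def by metis
qed

lemma geometric_has_sum:
  fixes x :: real
  assumes "0 \<le> x" "x < 1"
  shows "((\<lambda>n. x ^ n) has_sum (1 / (1 - x))) UNIV"
  by (rule norm_summable_imp_has_sum) (use assms in \<open>auto intro!: geometric_sums simp: summable_geometric\<close>)

lemma double_geometric_summable:
  fixes x y B :: real
  assumes "0 \<le> x" "x < 1" "0 \<le> y" "y < 1" "0 \<le> B"
  shows "(\<lambda>(k::nat, j::nat). B * x ^ k * y ^ j) summable_on UNIV"
proof -
  have "(\<lambda>(k::nat, j::nat). B * x ^ k * y ^ j) summable_on (SIGMA k:UNIV. UNIV)"
  proof (rule summable_on_SigmaI)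
    fix k :: nat
    show "((\<lambda>j. case (k, j) of (k, j) \<Rightarrow> B * x ^ k * y ^ j) has_sum (B * x ^ k * (1 / (1 - y)))) UNIV"
      using has_sum_cmult_right[OF geometric_has_sum[OF assms(3,4)], of "B * x ^ k"] by simp
    have "(\<lambda>k. x ^ k) summable_on UNIV" 
      using geometric_has_sum[OF assms(1,2)] by (auto simp: summable_on_def)
    then have "(\<lambda>k. (B / (1 - y)) * x ^ k) summable_on UNIV"
      by (rule summable_on_cmult_right)
    then show "(\<lambda>k. B * x ^ k * (1 / (1 - y))) summable_on UNIV" by (simp add: mult_ac)
  qed (use assms in auto)
  then show ?thesis by simp
qed

text \<open>Each coefficient \<open>c k\<close> is the uniform limit, as \<open>w\<close> tends to 0, of the difference quotients
\<open>(f (z, w) - (\<Sum>i<k. c i z * w ^ i)) / w ^ k\<close>, so no parameter integral is needed.\<close>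

lemma slice_coefficients_holomorphic:
  fixes f :: "complex \<times> complex \<Rightarrow> complex" and c :: "nat \<Rightarrow> complex \<Rightarrow> complex"
  assumes R: "0 < R" and B: "0 \<le> B"
    and hol: "\<And>w. norm w < R \<Longrightarrow> (\<lambda>z. f (z, w)) holomorphic_on ball 0 R"
    and sums: "\<And>z w. norm z < R \<Longrightarrow> norm w < R \<Longrightarrow> (\<lambda>k. c k z * w ^ k) sums f (z, w)"
    and bound: "\<And>z k. norm z < R \<Longrightarrow> norm (c k z) \<le> B / R ^ k"
  shows "c k holomorphic_on ball 0 R"
proof (induction k rule: less_induct)
  case (less k)
  \<comment> \<open>Sample points tending to 0. The shift by 2 keeps the ratio
    \<open>norm (v n) / R = 1 / (n + 2)\<close> at most 1/2, so the tail of the series in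
    \<open>w\<close> is dominated by a geometric series even for \<open>n = 0\<close>, with sum
    \<open>B / R ^ k / (n + 1)\<close>.\<close>
  define v where "v = (\<lambda>n::nat. complex_of_real (R / (real n + 2)))"
  define g where "g = (\<lambda>n z. (f (z, v n) - (\<Sum>i<k. c i z * v n ^ i)) / v n ^ k)"
  have nv: "norm (v n) = R / (real n + 2)" for n
    unfolding v_def norm_of_real using R by simp
  have "norm (v n) > 0" for n
    unfolding nv using R by (intro divide_pos_pos) auto
  then have v0: "v n \<noteq> 0" for n using norm_eq_zero by (metis less_irrefl)
  have vR: "norm (v n) < R" for n
    unfolding nv using R by (simp add: field_simps add_pos_nonneg)
  have ghol: "g n holomorphic_on ball 0 R" for n
    unfolding g_def by (intro holomorphic_intros hol vR less.IH) (auto simp: v0)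
  have est: "norm (g n z - c k z) \<le> B / R ^ k / (real n + 1)" if z: "norm z < R" for n z
  proof -
    have "(\<lambda>i. c (i + Suc k) z * v n ^ (i + Suc k)) sums (f (z, v n) - (\<Sum>i<Suc k. c i z * v n ^ i))"
      using sums[OF z vR] by (rule sums_split_initial_segment)
    then have "(\<lambda>i. c (i + Suc k) z * v n ^ (i + Suc k) / v n ^ k) sums ((f (z, v n) - (\<Sum>i<Suc k. c i z * v n ^ i)) / v n ^ k)"
      by (rule sums_divide)
    moreover have "(f (z, v n) - (\<Sum>i<Suc k. c i z * v n ^ i)) / v n ^ k = g n z - c k z"
      using v0[of n] by (simp add: g_def diff_divide_distrib add_divide_distrib)
    moreover have "c (i + Suc k) z * v n ^ (i + Suc k) / v n ^ k = c (i + Suc k) z * v n ^ Suc i" for i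
      using v0[of n] by (simp add: power_add)
    ultimately have s: "(\<lambda>i. c (i + Suc k) z * v n ^ Suc i) sums (g n z - c k z)" by simp
    define q where "q = 1 / (real n + 2)"
    have q: "0 < q" "q < 1" by (auto simp: q_def field_simps)
    have le: "norm (c (i + Suc k) z * v n ^ Suc i) \<le> B / R ^ k * q * q ^ i" for i
    proof -
      have "norm (c (i + Suc k) z * v n ^ Suc i) = norm (c (i + Suc k) z) * (R * q) ^ Suc i"
        by (simp add: norm_mult norm_power nv q_def)
      also have "\<dots> \<le> B / R ^ (i + Suc k) * (R * q) ^ Suc i"
        using bound[OF z, of "i + Suc k"] R q by (intro mult_right_mono) auto
      also have "\<dots> = B / R ^ k * q * q ^ i"
        using R by (simp add: power_add power_mult_distrib field_simps)
      finally show ?thesis .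
    qed
    have geo: "(\<lambda>i. B / R ^ k * q * q ^ i) sums (B / R ^ k * q * (1 / (1 - q)))"
      using q by (intro sums_mult geometric_sums) auto
    have "norm (g n z - c k z) \<le> B / R ^ k * q * (1 / (1 - q))"
      using sums_unique[OF s] sums_unique[OF geo] norm_suminf_le[OF le sums_summable[OF geo]] by simp
    also have "\<dots> = B / R ^ k / (real n + 1)"
    proof -
      have "1 - q = (real n + 1) / (real n + 2)" by (simp add: q_def field_simps)
      moreover have "real n + 2 \<noteq> 0" by linarith
      ultimately have "q * (1 / (1 - q)) = 1 / (real n + 1)" by (simp add: q_def)
      then show ?thesis by (simp only: mult.assoc) simp
    qed
    finally show ?thesis .
  qed
  have lim: "uniform_limit (ball 0 R) g (c k) sequentially"
  proof (rule uniform_limitI)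
    fix e :: real assume "e > 0"
    have "(\<lambda>n. B / R ^ k / (real n + 1)) \<longlonglongrightarrow> 0"
      by real_asymp
    then have "\<forall>\<^sub>F n in sequentially. B / R ^ k / (real n + 1) < e"
      using \<open>e > 0\<close> by (rule order_tendstoD)
    then show "\<forall>\<^sub>F n in sequentially. \<forall>z\<in>ball 0 R. dist (g n z) (c k z) < e"
    proof eventually_elim
      case (elim n)
      show ?case
      proof
        fix z :: complex assume "z \<in> ball 0 R"
        then show "dist (g n z) (c k z) < e" using est[of z n] elim by (simp add: dist_norm)
      qed
    qed
  qed
  show ?case
  proof (rule holomorphic_uniform_sequence[OF open_ball ghol])
    fix x assume "x \<in> ball (0::complex) R"
    then obtain d where "d > 0" "cball x d \<subseteq> ball 0 R"
      by (meson open_ball open_contains_cball)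
    then show "\<exists>d>0. cball x d \<subseteq> ball 0 R \<and> uniform_limit (cball x d) g (c k) sequentially"
      using uniform_limit_on_subset[OF lim] by blast
  qed
qed

lemma pair2_bij: "bij (\<lambda>(k, j). pair2 j k :: 2 \<Rightarrow> nat)"
  by (rule bij_betw_byWitness[where f' = "\<lambda>m. (m 1, m 0)"]) (auto simp: pair2_eta)

lemma mp_term_pair2: "mp_term h (pt2 z w) (pair2 j k) = h (pair2 j k) * (z ^ j * w ^ k)"
  by (simp add: mp_term_def pt2_def prod_2')

text \<open>The double series arises by expanding in \<open>w\<close> for fixed \<open>z\<close> and
  then each coefficient in \<open>z\<close>. Cauchy estimates in both steps bound the terms by a
  double geometric series, so the iterated sum can be rearranged into an unordered one.\<close>

lemma osgood:
  assumes U: "open U" "(0, 0) \<in> U" and f: "\<And>p. p \<in> U \<Longrightarrow> cdiff f p"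
  shows "\<exists>h::2 mps. mp_converges h \<and> (\<exists>\<delta>>0. \<forall>z w. norm z < \<delta> \<and> norm w < \<delta> \<longrightarrow> f (z, w) = mp_eval h (pt2 z w))"
proof -
  obtain A C where AC: "open A" "open C" "(0::complex) \<in> A" "(0::complex) \<in> C" "A \<times> C \<subseteq> U"
    using open_prod_elim[OF U] by (metis mem_Sigma_iff)
  obtain R1 R2 where "R1 > 0" "cball 0 R1 \<subseteq> A" "R2 > 0" "cball 0 R2 \<subseteq> C"
    using AC by (meson open_contains_cball)
  define R where "R = min R1 R2"
  have R: "R > 0" using \<open>R1 > 0\<close> \<open>R2 > 0\<close> by (simp add: R_def)
  have sub: "(z, w) \<in> U" if "norm z \<le> R" "norm w \<le> R" for z w
  proof -
    have "z \<in> cball 0 R1" "w \<in> cball 0 R2" using that by (auto simp: R_def)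
    then show ?thesis using \<open>cball 0 R1 \<subseteq> A\<close> \<open>cball 0 R2 \<subseteq> C\<close> AC(5) by blast
  qed
  have cont: "continuous_on U f"
    using f cdiff_imp_continuous continuous_at_imp_continuous_on by blast
  have "compact (cball (0::complex) R \<times> cball (0::complex) R)" by (intro compact_Times) auto
  moreover have "cball (0::complex) R \<times> cball (0::complex) R \<subseteq> U" using sub by auto
  ultimately have "bounded (f ` (cball 0 R \<times> cball 0 R))"
    using cont compact_continuous_image compact_imp_bounded continuous_on_subset by metis
  then obtain B where B: "B > 0" "\<And>z w. norm z \<le> R \<Longrightarrow> norm w \<le> R \<Longrightarrow> norm (f (z, w)) \<le> B"
    unfolding bounded_pos by fastforce
  have hol_snd: "(\<lambda>w. f (z, w)) holomorphic_on cball 0 R" if "norm z \<le> R" for z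
    unfolding holomorphic_on_def
  proof
    fix w assume "w \<in> cball (0::complex) R"
    then have "cdiff f (z, w)" using that by (intro f sub) auto
    then show "(\<lambda>w. f (z, w)) field_differentiable at w within cball 0 R"
      by (rule field_differentiable_at_within[OF cdiff_slice_snd])
  qed
  have hol_fst: "(\<lambda>z. f (z, w)) holomorphic_on cball 0 R" if "norm w \<le> R" for w
    unfolding holomorphic_on_def
  proof
    fix z assume "z \<in> cball (0::complex) R"
    then have "cdiff f (z, w)" using that by (intro f sub) auto
    then show "(\<lambda>z. f (z, w)) field_differentiable at z within cball 0 R"
      by (rule field_differentiable_at_within[OF cdiff_slice_fst])
  qed
  define c where "c = (\<lambda>k z. (deriv ^^ k) (\<lambda>w. f (z, w)) 0 / fact k)"
  have sums: "(\<lambda>k. c k z * w ^ k) sums f (z, w)" if "norm z < R" "norm w < R" for z w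
  proof -
    have "(\<lambda>w. f (z, w)) holomorphic_on ball 0 R"
      using hol_snd[of z] that by (auto intro: holomorphic_on_subset)
    from holomorphic_power_series[OF this, of w] show ?thesis
      using that by (simp add: c_def)
  qed
  have bound: "norm (c k z) \<le> B / R ^ k" if "norm z < R" for k z
  proof -
    have "norm ((deriv ^^ k) (\<lambda>w. f (z, w)) 0) \<le> fact k * B / R ^ k"
    proof (rule Cauchy_inequality[OF _ _ R])
      show "(\<lambda>w. f (z, w)) holomorphic_on ball 0 R"
        using hol_snd[of z] that by (auto intro: holomorphic_on_subset)
      show "continuous_on (cball 0 R) (\<lambda>w. f (z, w))"
        using hol_snd[of z] that by (auto intro: holomorphic_on_imp_continuous_on)
    qed (use that B in auto)
    then show ?thesis by (simp add: c_def norm_divide field_simps)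
  qed
  have chol: "c k holomorphic_on ball 0 R" for k
  proof (rule slice_coefficients_holomorphic[OF R _ _ sums bound])
    fix w :: complex assume "norm w < R"
    then show "(\<lambda>z. f (z, w)) holomorphic_on ball 0 R"
      using hol_fst[of w] holomorphic_on_subset[OF _ ball_subset_cball] by simp
  qed (use B in auto)
  define a where "a = (\<lambda>k j. (deriv ^^ j) (c k) 0 / fact j)"
  have csums: "(\<lambda>j. a k j * z ^ j) sums c k z" if "norm z < R" for k z
    using holomorphic_power_series[OF chol, of z k] that by (simp add: a_def)
  have abound: "norm (a k j) \<le> B / R ^ k / (R/2) ^ j" for k j
  proof -
    \<comment> \<open>The bound on \<open>c k\<close> is known on the open disc of radius
      \<open>R\<close>, and Cauchy's inequality needs a closed one; hence the radius
      \<open>R/2\<close> here and in the final domain.\<close>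
    have "norm ((deriv ^^ j) (c k) 0) \<le> fact j * (B / R ^ k) / (R/2) ^ j"
    proof (rule Cauchy_inequality)
      show "c k holomorphic_on ball 0 (R/2)"
        using chol R by (rule_tac holomorphic_on_subset) auto
      have "c k holomorphic_on cball 0 (R/2)"
        using chol R by (rule_tac holomorphic_on_subset) auto
      then show "continuous_on (cball 0 (R/2)) (c k)" by (rule holomorphic_on_imp_continuous_on)
    qed (use R bound in auto)
    then show ?thesis by (simp add: a_def norm_divide field_simps)
  qed
  define h :: "2 mps" where "h = (\<lambda>m. a (m 1) (m 0))"
  have hs: "(mp_term h (pt2 z w) has_sum f (z, w)) UNIV" if z: "norm z < R/2" and w: "norm w < R/2" for z w
  proof -
    have zR: "norm z < R" "norm w < R" using z w R by auto
    define t where "t = (\<lambda>(k, j). a k j * (z ^ j * w ^ k))"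
    have "(\<lambda>(k, j). B * (norm w / R) ^ k * (norm z / (R/2)) ^ j) summable_on UNIV"
      using z zR R B by (intro double_geometric_summable) auto
    then have "(\<lambda>p. norm (t p)) summable_on UNIV"
    proof (rule Infinite_Sum.abs_summable_on_comparison_test')
      fix p :: "nat \<times> nat"
      obtain k j where p: "p = (k, j)" by fastforce
      have "norm (t p) = norm (a k j) * (norm z ^ j * norm w ^ k)"
        by (simp add: p t_def norm_mult norm_power)
      also have "\<dots> \<le> B / R ^ k / (R/2) ^ j * (norm z ^ j * norm w ^ k)"
        by (intro mult_right_mono abound) auto
      also have "\<dots> = (case p of (k, j) \<Rightarrow> B * (norm w / R) ^ k * (norm z / (R/2)) ^ j)"
        by (simp add: p power_divide)
      finally show "norm (t p) \<le> (case p of (k, j) \<Rightarrow> B * (norm w / R) ^ k * (norm z / (R/2)) ^ j)" .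
    qed
    then have "t summable_on UNIV" by (rule abs_summable_summable)
    then obtain S where S: "(t has_sum S) UNIV" by (auto simp: summable_on_def)
    have "((\<lambda>j. t (k, j)) has_sum (c k z * w ^ k)) UNIV" for k
    proof (rule norm_summable_imp_has_sum)
      show "(\<lambda>j. t (k, j)) sums (c k z * w ^ k)"
        using sums_mult2[OF csums[OF zR(1), of k], of "w ^ k"] by (simp add: t_def mult_ac)
      have "(\<lambda>j. B / R ^ k * norm w ^ k * (norm z / (R/2)) ^ j) sums (B / R ^ k * norm w ^ k * (1 / (1 - norm z / (R/2))))"
        using z R by (intro sums_mult geometric_sums) auto
      then show "summable (\<lambda>j. norm (t (k, j)))"
      proof (intro summable_comparison_test'[OF sums_summable])
        fix j
        have "norm (t (k, j)) = norm (a k j) * (norm z ^ j * norm w ^ k)"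
          by (simp add: t_def norm_mult norm_power)
        also have "\<dots> \<le> B / R ^ k / (R/2) ^ j * (norm z ^ j * norm w ^ k)"
          by (intro mult_right_mono abound) auto
        finally show "norm (norm (t (k, j))) \<le> B / R ^ k * norm w ^ k * (norm z / (R/2)) ^ j"
          by (simp add: power_divide mult_ac)
      qed
    qed
    \<comment> \<open>Summing the unordered double series row by row identifies its value
      \<open>S\<close> with the iterated sum, which is \<open>f (z, w)\<close>.\<close>
    then have "((\<lambda>k. c k z * w ^ k) has_sum S) UNIV"
      using has_sum_SigmaD[where f=t and S=S and A=UNIV and B="\<lambda>_. UNIV"] S by simp
    then have "S = f (z, w)"
      using sums[OF zR] has_sum_imp_sums sums_unique2 by blast
    then have "(t has_sum f (z, w)) UNIV" using S by simp
    moreover have "t = (\<lambda>x. mp_term h (pt2 z w) ((\<lambda>(k, j). pair2 j k) x))"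
      by (auto simp: t_def mp_term_pair2 h_def)
    ultimately show ?thesis
      using has_sum_reindex_bij_betw[OF pair2_bij, of "mp_term h (pt2 z w)" "f (z, w)"] by simp
  qed
  have "mp_converges h" unfolding mp_converges_def
  proof (intro exI[of _ "R/2"] conjI allI impI)
    fix x :: "2 \<Rightarrow> complex" assume x: "\<forall>v. norm (x v) < R/2"
    have "x = pt2 (x 0) (x 1)" by (auto simp: pt2_def fun_eq_iff all_2)
    then show "mp_term h x summable_on UNIV"
      using hs[of "x 0" "x 1"] x by (metis summable_on_def)
  qed (use R in auto)
  moreover have "f (z, w) = mp_eval h (pt2 z w)" if "norm z < R/2" "norm w < R/2" for z w
    unfolding mp_eval_def using infsumI[OF hs[OF that]] by simp
  moreover have "R/2 > 0" using R by simp
  ultimately show ?thesis by blast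
qed

lemma holomorphic_has_series:
  assumes F: "cholo F U" and U: "(0, 0) \<in> U"
  shows "\<exists>H. represents H F"
proof -
  have op: "open U" using F by (simp add: cholo_def)
  obtain h0 \<delta>0 where h0: "mp_converges h0" "\<delta>0 > 0"
    "\<And>z w. norm z < \<delta>0 \<and> norm w < \<delta>0 \<Longrightarrow> fst (F (z, w)) = mp_eval h0 (pt2 z w)"
    using osgood[OF op U cholo_imp_cdiff(1)[OF F]] by blast
  obtain h1 \<delta>1 where h1: "mp_converges h1" "\<delta>1 > 0"
    "\<And>z w. norm z < \<delta>1 \<and> norm w < \<delta>1 \<Longrightarrow> snd (F (z, w)) = mp_eval h1 (pt2 z w)"
    using osgood[OF op U cholo_imp_cdiff(2)[OF F]] by blast
  have "represents (pair2 h0 h1) F"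
    unfolding represents_def using h0 h1
    by (intro conjI exI[of _ "min \<delta>0 \<delta>1"]) (auto simp: all_2 prod_eq_iff)
  then show ?thesis by blast
qed

section \<open>The convergent automorphisms\<close>

lemma cdiff_const [intro]: "cdiff (\<lambda>_. k) p"
  unfolding cdiff_def by (rule exI[of _ "\<lambda>_. 0"]) auto

lemma cdiff_fst [intro]: "cdiff fst p"
  unfolding cdiff_def by (rule exI[of _ fst]) (auto intro!: derivative_eq_intros)

lemma cdiff_snd [intro]: "cdiff snd p"
  unfolding cdiff_def by (rule exI[of _ snd]) (auto intro!: derivative_eq_intros)

lemma cdiff_add [intro]:
  assumes "cdiff f p" "cdiff g p"
  shows "cdiff (\<lambda>x. f x + g x) p"
proof -
  obtain L K where "(f has_derivative L) (at p)" "\<And>c v. L (c * fst v, c * snd v) = c * L v"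
    "(g has_derivative K) (at p)" "\<And>c v. K (c * fst v, c * snd v) = c * K v"
    using assms unfolding cdiff_def by blast
  then show ?thesis unfolding cdiff_def
    by (intro exI[of _ "\<lambda>v. L v + K v"]) (auto intro!: derivative_eq_intros simp: distrib_left)
qed

lemma cdiff_compose:
  assumes "cdiff f p" "(g has_field_derivative g') (at (f p))"
  shows "cdiff (\<lambda>x. g (f x)) p"
proof -
  obtain L where L: "(f has_derivative L) (at p)" "\<And>c v. L (c * fst v, c * snd v) = c * L v"
    using assms unfolding cdiff_def by blast
  have "((\<lambda>x. g (f x)) has_derivative (\<lambda>v. g' * L v)) (at p)"
    using has_derivative_compose[OF L(1), of g "(*) g'"] assms(2) by (simp add: has_field_derivative_def)
  then show ?thesis unfolding cdiff_def using L(2)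
    by (intro exI[of _ "\<lambda>v. g' * L v"]) auto
qed

lemma cdiff_mult [intro]:
  assumes "cdiff f p" "cdiff g p"
  shows "cdiff (\<lambda>x. f x * g x) p"
proof -
  obtain L K where "(f has_derivative L) (at p)" "\<And>c v. L (c * fst v, c * snd v) = c * L v"
    "(g has_derivative K) (at p)" "\<And>c v. K (c * fst v, c * snd v) = c * K v"
    using assms unfolding cdiff_def by blast
  then show ?thesis unfolding cdiff_def
    by (intro exI[of _ "\<lambda>v. f p * K v + L v * g p"]) (auto intro!: derivative_eq_intros simp: algebra_simps)
qed

lemma cdiff_Pair_imp_cholo:
  assumes "open U" "\<And>p. p \<in> U \<Longrightarrow> cdiff f p" "\<And>p. p \<in> U \<Longrightarrow> cdiff g p"
  shows "cholo (\<lambda>p. (f p, g p)) U"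
  unfolding cholo_def
proof (intro conjI ballI)
  fix p assume "p \<in> U"
  then obtain L K where "(f has_derivative L) (at p)" "\<And>c v. L (c * fst v, c * snd v) = c * L v"
    "(g has_derivative K) (at p)" "\<And>c v. K (c * fst v, c * snd v) = c * K v"
    using assms(2,3)[of p] unfolding cdiff_def by blast
  then show "\<exists>L. ((\<lambda>p. (f p, g p)) has_derivative L) (at p) \<and>
           (\<forall>c v. L (c * fst v, c * snd v) = (c * fst (L v), c * snd (L v)))"
    by (intro exI[of _ "\<lambda>v. (L v, K v)"]) (auto intro!: derivative_eq_intros)
qed (rule assms)

lemma cholo_cong:
  assumes "cholo F U" "\<And>p. p \<in> U \<Longrightarrow> F p = G p"
  shows "cholo G U"
  using assms has_derivative_transform_within_open unfolding cholo_def by metis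

lemma cholo_subset: "cholo F U \<Longrightarrow> open V \<Longrightarrow> V \<subseteq> U \<Longrightarrow> cholo F V"
  unfolding cholo_def by blast

definition radicand :: "complex \<Rightarrow> real \<Rightarrow> complex \<times> complex \<Rightarrow> complex" where
  "radicand \<alpha> s = (\<lambda>(z, w). 1 - 2 * \<i> * cnj \<alpha> * z * w - (of_real s + \<i> * of_real ((norm \<alpha>)\<^sup>2)) * w\<^sup>2)"

text \<open>Off the branch cut \<open>csqrt\<close> is holomorphic and commutes with inversion. As
  the radicand of the inverse map is the reciprocal of the original one, these sets correspond to
  each other under the maps without any shrinking.\<close>

definition slit :: "complex \<Rightarrow> real \<Rightarrow> (complex \<times> complex) set" where
  "slit \<alpha> s = {p. radicand \<alpha> s p \<notin> \<real>\<^sub>\<le>\<^sub>0}"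

lemma cdiff_radicand: "cdiff (radicand \<alpha> s) p"
proof -
  have "radicand \<alpha> s = (\<lambda>p. 1 + ((- 2 * \<i> * cnj \<alpha>) * (fst p * snd p) + (- (of_real s + \<i> * of_real ((norm \<alpha>)\<^sup>2))) * (snd p * snd p)))"
    by (auto simp: radicand_def fun_eq_iff power2_eq_square algebra_simps)
  then show ?thesis by (simp only:) (intro cdiff_add cdiff_mult cdiff_const cdiff_fst cdiff_snd)
qed

lemma isCont_radicand: "isCont (radicand \<alpha> s) p"
  by (rule cdiff_imp_continuous[OF cdiff_radicand])

lemma open_slit: "open (slit \<alpha> s)"
proof -
  have "open (radicand \<alpha> s -` (- \<real>\<^sub>\<le>\<^sub>0))"
    by (intro continuous_open_vimage) (auto simp: isCont_radicand open_Compl)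
  then show ?thesis by (simp add: slit_def vimage_def)
qed

lemma Hmap_eq: "Hmap \<epsilon> r \<alpha> s p =
   (\<epsilon> * (fst p + \<alpha> * snd p) * inverse (csqrt (radicand \<alpha> s p)), of_real r * snd p * inverse (csqrt (radicand \<alpha> s p)))"
  by (cases p) (simp add: Hmap_def theta_def radicand_def divide_inverse)

lemma cdiff_inverse_csqrt:
  assumes "p \<in> slit \<alpha> s"
  shows "cdiff (\<lambda>p. inverse (csqrt (radicand \<alpha> s p))) p"
proof -
  have D: "radicand \<alpha> s p \<notin> \<real>\<^sub>\<le>\<^sub>0" using assms by (simp add: slit_def)
  then have "radicand \<alpha> s p \<noteq> 0" by auto
  have "(\<lambda>x. inverse (csqrt x)) field_differentiable at (radicand \<alpha> s p)"
    using D \<open>radicand \<alpha> s p \<noteq> 0\<close> by (intro field_differentiable_inverse field_differentiable_at_csqrt) auto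
  then show ?thesis
    unfolding field_differentiable_def using cdiff_compose[OF cdiff_radicand] by blast
qed

lemma cholo_Hmap: "cholo (Hmap \<epsilon> r \<alpha> s) (slit \<alpha> s)"
proof -
  have "cholo (\<lambda>p. (\<epsilon> * (fst p + \<alpha> * snd p) * inverse (csqrt (radicand \<alpha> s p)), of_real r * snd p * inverse (csqrt (radicand \<alpha> s p)))) (slit \<alpha> s)"
    by (intro cdiff_Pair_imp_cholo open_slit cdiff_mult cdiff_add cdiff_const cdiff_fst cdiff_snd cdiff_inverse_csqrt)
  then show ?thesis by (rule cholo_cong) (simp add: Hmap_eq)
qed

text \<open>On \<open>\<zeta> = z / w\<close> the map acts as
  \<open>\<zeta> \<mapsto> (\<epsilon> / r) (\<zeta> + \<alpha>)\<close>; solving for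
  \<open>\<zeta>\<close> gives this translation parameter.\<close>

definition inv_alpha :: "complex \<Rightarrow> real \<Rightarrow> complex \<Rightarrow> complex" where
  "inv_alpha \<epsilon> r \<alpha> = - \<epsilon> * \<alpha> / of_real r"

text \<open>In the coordinates \<open>(z / w, - 1 / w\<^sup>2)\<close> the maps are affine automorphisms of the Heisenberg
sphere; this gives the parameters of the inverse.\<close>

lemma Hmap_inverse:
  assumes \<epsilon>: "norm \<epsilon> = 1" and r: "r \<noteq> 0" and p: "p \<in> slit \<alpha> s"
  defines "q \<equiv> Hmap \<epsilon> r \<alpha> s p"
  shows "radicand (inv_alpha \<epsilon> r \<alpha>) (- s / r\<^sup>2) q = inverse (radicand \<alpha> s p)"
    and "q \<in> slit (inv_alpha \<epsilon> r \<alpha>) (- s / r\<^sup>2)"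
    and "Hmap (cnj \<epsilon>) (1 / r) (inv_alpha \<epsilon> r \<alpha>) (- s / r\<^sup>2) q = p"
proof -
  obtain z w where zw: "p = (z, w)" by fastforce
  define D where "D = radicand \<alpha> s p"
  have D: "D \<notin> \<real>\<^sub>\<le>\<^sub>0" using p by (simp add: slit_def D_def)
  then have D0: "D \<noteq> 0" by auto
  define t where "t = csqrt D"
  have t2: "t\<^sup>2 = D" and t0: "t \<noteq> 0" using D0 by (auto simp: t_def)
  have q: "q = (\<epsilon> * (z + \<alpha> * w) / t, of_real r * w / t)"
    by (simp add: q_def Hmap_eq zw t_def D_def divide_inverse)
  have ee: "cnj \<epsilon> * \<epsilon> = 1" using complex_norm_square[of \<epsilon>] \<epsilon> by (simp add: mult.commute)
  have Dzw: "t * t = 1 - 2 * \<i> * cnj \<alpha> * z * w - (of_real s + \<i> * (\<alpha> * cnj \<alpha>)) * w\<^sup>2"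
    using t2 unfolding complex_norm_square[symmetric] by (simp add: D_def radicand_def zw power2_eq_square)
  define \<beta> where "\<beta> = inv_alpha \<epsilon> r \<alpha>"
  have n\<beta>: "of_real ((norm \<beta>)\<^sup>2) = \<alpha> * cnj \<alpha> / (of_real r)\<^sup>2"
  proof -
    have "(norm \<beta>)\<^sup>2 = (norm \<alpha>)\<^sup>2 / r\<^sup>2"
      using \<epsilon> by (simp add: \<beta>_def inv_alpha_def norm_mult norm_divide power_divide)
    then show ?thesis by (simp add: complex_norm_square[symmetric] del: of_real_power) simp
  qed
  have "radicand \<beta> (- s / r\<^sup>2) q = 1 - 2 * \<i> * cnj \<beta> * (\<epsilon> * (z + \<alpha> * w) / t) * (of_real r * w / t)
     - (of_real (- s / r\<^sup>2) + \<i> * (\<alpha> * cnj \<alpha> / (of_real r)\<^sup>2)) * (of_real r * w / t)\<^sup>2"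
    unfolding q radicand_def by (simp add: n\<beta> del: of_real_power)
  also have "\<dots> = 1 - 2 * \<i> * (of_real r * cnj \<beta> * \<epsilon>) * (z + \<alpha> * w) * w / (t * t)
     - (- of_real s + \<i> * (\<alpha> * cnj \<alpha>)) * w\<^sup>2 / (t * t)"
    using r t0 by (simp add: field_simps power2_eq_square)
  also have "of_real r * cnj \<beta> * \<epsilon> = - cnj \<alpha>"
    using r ee by (simp add: \<beta>_def inv_alpha_def field_simps)
  also have "1 - 2 * \<i> * (- cnj \<alpha>) * (z + \<alpha> * w) * w / (t * t) - (- of_real s + \<i> * (\<alpha> * cnj \<alpha>)) * w\<^sup>2 / (t * t)
     = (t * t + 2 * \<i> * cnj \<alpha> * (z + \<alpha> * w) * w - (- of_real s + \<i> * (\<alpha> * cnj \<alpha>)) * w\<^sup>2) / (t * t)"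
    using t0 by (simp add: field_simps)
  also have "t * t + 2 * \<i> * cnj \<alpha> * (z + \<alpha> * w) * w - (- of_real s + \<i> * (\<alpha> * cnj \<alpha>)) * w\<^sup>2 = 1"
    unfolding Dzw by (simp add: algebra_simps power2_eq_square)
  finally have dq: "radicand \<beta> (- s / r\<^sup>2) q = inverse D"
    using t2[unfolded power2_eq_square] by (simp add: inverse_eq_divide)
  then show "radicand (inv_alpha \<epsilon> r \<alpha>) (- s / r\<^sup>2) q = inverse (radicand \<alpha> s p)"
    by (simp add: \<beta>_def D_def)
  have iD: "inverse D \<notin> \<real>\<^sub>\<le>\<^sub>0" using D by (metis inverse_inverse_eq nonpos_Reals_inverse_I)
  then show "q \<in> slit (inv_alpha \<epsilon> r \<alpha>) (- s / r\<^sup>2)"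
    using dq by (simp add: slit_def \<beta>_def)
  have "csqrt (inverse D) = inverse t"
    unfolding t_def using D by (intro csqrt_inverse) auto
  then have th: "inverse (csqrt (radicand \<beta> (- s / r\<^sup>2) q)) = t" by (simp only: dq inverse_inverse_eq)
  have "Hmap (cnj \<epsilon>) (1 / r) \<beta> (- s / r\<^sup>2) q =
     (cnj \<epsilon> * (\<epsilon> * (z + \<alpha> * w) / t + \<beta> * (of_real r * w / t)) * t, of_real (1 / r) * (of_real r * w / t) * t)"
    unfolding Hmap_eq th by (simp add: q)
  also have "\<dots> = (z, w)"
  proof -
    have "cnj \<epsilon> * (\<epsilon> * (z + \<alpha> * w) / t + \<beta> * (of_real r * w / t)) * t = (cnj \<epsilon> * \<epsilon>) * (z + \<alpha> * w) + cnj \<epsilon> * (of_real r * \<beta>) * w"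
      using t0 by (simp add: field_simps)
    also have "of_real r * \<beta> = - \<epsilon> * \<alpha>" using r by (simp add: \<beta>_def inv_alpha_def)
    also have "cnj \<epsilon> * \<epsilon> * (z + \<alpha> * w) + cnj \<epsilon> * (- \<epsilon> * \<alpha>) * w = (cnj \<epsilon> * \<epsilon>) * z"
      by (simp add: algebra_simps)
    finally show ?thesis using ee r t0 by simp
  qed
  finally show "Hmap (cnj \<epsilon>) (1 / r) (inv_alpha \<epsilon> r \<alpha>) (- s / r\<^sup>2) q = p"
    by (simp add: zw \<beta>_def)
qed


section \<open>The hypersurface as a real quadratic equation with an inequality\<close>

lemma phi_real_equation:
  assumes "\<bar>t\<bar> < 1"
  shows "t * (1 + (phi t)\<^sup>2) = 2 * phi t"
proof -
  define q where "q = sqrt (1 - t\<^sup>2)"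
  have "t\<^sup>2 \<le> 1" using assms by (simp add: abs_square_le_1)
  then have q2: "q\<^sup>2 = 1 - t\<^sup>2" and q0: "q \<ge> 0" by (auto simp: q_def)
  have "1 + q \<noteq> 0" using q0 by linarith
  then have p: "(1 + q) * phi t = t" using phi_eq_quotient[OF assms] by (simp add: q_def)
  have "(1 + q)\<^sup>2 * (t * (1 + (phi t)\<^sup>2)) = t * ((1 + q)\<^sup>2 + ((1 + q) * phi t)\<^sup>2)"
    by (simp add: algebra_simps power2_eq_square)
  also have "\<dots> = t * ((1 + q)\<^sup>2 + (1 - q\<^sup>2))" unfolding p by (simp add: q2)
  also have "\<dots> = 2 * (1 + q) * t" by (simp add: algebra_simps power2_eq_square)
  also have "\<dots> = (1 + q)\<^sup>2 * (2 * phi t)"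
    by (subst p[symmetric]) (simp add: power2_eq_square)
  finally show ?thesis using q0 by (simp only: mult_cancel_left) auto
qed

lemma phi_bounds:
  assumes "0 \<le> t" "t < 1"
  shows "0 \<le> phi t" "phi t \<le> t"
proof -
  have "t\<^sup>2 \<le> 1" using assms by (simp add: abs_square_le_1)
  then have q0: "sqrt (1 - t\<^sup>2) \<ge> 0" by simp
  then show "0 \<le> phi t" using assms by (simp add: phi_eq_quotient)
  have "t / (1 + sqrt (1 - t\<^sup>2)) \<le> t / 1" using q0 assms by (intro divide_left_mono) (auto intro: add_pos_nonneg)
  then show "phi t \<le> t" using assms by (simp add: phi_eq_quotient)
qed

lemma M_iff_phi: "(z, w) \<in> M \<longleftrightarrow> norm z < 1 \<and> Im w = Re w * phi ((norm z)\<^sup>2)"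
proof -
  have "((norm z)\<^sup>2)\<^sup>2 = norm z ^ 4" by (simp flip: power_mult)
  then show ?thesis by (auto simp: M_def phi_def)
qed

text \<open>For fixed \<open>t = |z|\<^sup>2\<close> the quadratic equation in
  \<open>u = Re w\<close>, \<open>v = Im w\<close> describes the two lines \<open>v = u * f\<close>
  and \<open>u = v * f\<close>. As \<open>0 \<le> f < 1\<close>, the inequality selects the first.
  The maps transform the quadratic part exactly, which is hidden in the formulation with
  \<open>phi\<close>.\<close>

lemma M_iff_quadratic:
  "(z, w) \<in> M \<longleftrightarrow> norm z < 1 \<and> 2 * Re w * Im w = (norm z)\<^sup>2 * (norm w)\<^sup>2 \<and> \<bar>Im w\<bar> \<le> \<bar>Re w\<bar>"
proof (cases "norm z < 1")
  case True
  define t where "t = (norm z)\<^sup>2"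
  define f where "f = phi t"
  have t: "0 \<le> t" "t < 1" using True by (auto simp: t_def power_less_one_iff)
  have f: "0 \<le> f" "f < 1" using phi_bounds[OF t] t by (auto simp: f_def)
  have tf: "t * (1 + f\<^sup>2) = 2 * f" unfolding f_def by (rule phi_real_equation) (use t in auto)
  define u where "u = Re w"
  define v where "v = Im w"
  have nw: "(norm w)\<^sup>2 = u\<^sup>2 + v\<^sup>2" by (simp add: cmod_power2 u_def v_def)
  have "v = u * f \<longleftrightarrow> 2 * u * v = t * (u\<^sup>2 + v\<^sup>2) \<and> \<bar>v\<bar> \<le> \<bar>u\<bar>"
  proof
    assume v: "v = u * f"
    have "t * (u\<^sup>2 + v\<^sup>2) = u\<^sup>2 * (t * (1 + f\<^sup>2))" by (simp add: v algebra_simps power2_eq_square)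
    also have "\<dots> = 2 * u * v" unfolding tf by (simp add: v power2_eq_square)
    finally have "2 * u * v = t * (u\<^sup>2 + v\<^sup>2)" by simp
    moreover have "\<bar>u\<bar> * f \<le> \<bar>u\<bar> * 1" using f by (intro mult_left_mono) auto
    ultimately show "2 * u * v = t * (u\<^sup>2 + v\<^sup>2) \<and> \<bar>v\<bar> \<le> \<bar>u\<bar>" using f by (simp add: v abs_mult)
  next
    assume *: "2 * u * v = t * (u\<^sup>2 + v\<^sup>2) \<and> \<bar>v\<bar> \<le> \<bar>u\<bar>"
    show "v = u * f"
    proof (cases "t = 0")
      case True
      then have "v = 0" using * by auto
      moreover have "f = 0" using tf True by simp
      ultimately show ?thesis by simp
    next
      case False
      \<comment> \<open>The quadratic equation factors into its two lines by
        \<open>t * (1 + f\<^sup>2) = 2 * f\<close>.\<close>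
      have "t * ((v - u * f) * (v * f - u)) = f * (t * (u\<^sup>2 + v\<^sup>2)) - u * v * (t * (1 + f\<^sup>2))"
        by (simp add: algebra_simps power2_eq_square)
      also have "\<dots> = f * (2 * u * v) - u * v * (2 * f)" using * tf by simp
      finally have "v = u * f \<or> v * f = u" using False by auto
      moreover have "v = u * f" if "v * f = u"
      proof -
        have "\<bar>u\<bar> = \<bar>v\<bar> * f" using that f by (metis abs_mult abs_of_nonneg)
        also have "\<dots> \<le> \<bar>u\<bar> * f" using * f by (intro mult_right_mono) auto
        finally have "\<bar>u\<bar> * (1 - f) \<le> 0" by (simp add: algebra_simps)
        then have "u = 0" using f by (simp add: mult_le_0_iff)
        then show ?thesis using * by simp
      qed
      ultimately show ?thesis by blast
    qed
  qed
  then show ?thesis using True by (simp add: M_iff_phi nw f_def t_def u_def v_def)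
qed (simp add: M_def)

lemma quadratic_complex_iff:
  "2 * Re w * Im w = (norm z)\<^sup>2 * (norm w)\<^sup>2 \<longleftrightarrow> w\<^sup>2 - (cnj w)\<^sup>2 = 2 * \<i> * (z * cnj z) * (w * cnj w)"
proof -
  have "w\<^sup>2 - (cnj w)\<^sup>2 = \<i> * of_real (2 * (2 * Re w * Im w))"
    by (simp add: complex_eq_iff power2_eq_square)
  moreover have "2 * \<i> * (z * cnj z) * (w * cnj w) = \<i> * of_real (2 * ((norm z)\<^sup>2 * (norm w)\<^sup>2))"
    unfolding complex_norm_square[symmetric] by simp
  ultimately show ?thesis
    by (simp only: mult_cancel_left of_real_eq_iff) simp
qed

text \<open>The quadratic equation is preserved identically. The inequality that picks the right
  root survives near the origin, where \<open>w\<close> is multiplied by a factor close to a real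
  constant; this is what the smallness hypotheses secure.\<close>

lemma Hmap_preserves_M:
  assumes \<epsilon>: "norm \<epsilon> = 1" and r: "r \<noteq> 0" and p: "p \<in> slit \<alpha> s" "p \<in> M"
    and small: "norm (fst p) < 1/4" "norm (inverse (csqrt (radicand \<alpha> s p)) - 1) < 1/4" "norm (fst (Hmap \<epsilon> r \<alpha> s p)) < 1"
  shows "Hmap \<epsilon> r \<alpha> s p \<in> M"
proof -
  obtain z w where zw: "p = (z, w)" by fastforce
  define D where "D = radicand \<alpha> s p"
  have "D \<noteq> 0" using p by (auto simp: slit_def D_def)
  define t where "t = csqrt D"
  have t2: "t * t = D" and t0: "t \<noteq> 0"
    using \<open>D \<noteq> 0\<close> power2_csqrt[of D] by (auto simp: t_def power2_eq_square)
  define z' where "z' = \<epsilon> * (z + \<alpha> * w) / t"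
  define w' where "w' = of_real r * w / t"
  have H: "Hmap \<epsilon> r \<alpha> s p = (z', w')"
    by (simp add: Hmap_eq zw t_def D_def divide_inverse z'_def w'_def)
  have ee: "\<epsilon> * cnj \<epsilon> = 1" using complex_norm_square[of \<epsilon>] \<epsilon> by simp
  have wz: "w\<^sup>2 - (cnj w)\<^sup>2 = 2 * \<i> * (z * cnj z) * (w * cnj w)"
    using p(2) unfolding zw M_iff_quadratic quadratic_complex_iff by blast
  have Dzw: "D = 1 - 2 * \<i> * cnj \<alpha> * z * w - (of_real s + \<i> * (\<alpha> * cnj \<alpha>)) * w\<^sup>2"
    unfolding complex_norm_square[symmetric] by (simp add: D_def radicand_def zw)
  have cD: "cnj D = 1 + 2 * \<i> * \<alpha> * cnj z * cnj w - (of_real s - \<i> * (\<alpha> * cnj \<alpha>)) * (cnj w)\<^sup>2"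
    unfolding Dzw by (simp add: mult_ac)
  \<comment> \<open>The real parameter \<open>s\<close> cancels here, the term
    \<open>\<i> |\<alpha>|\<^sup>2\<close> supplies \<open>|\<alpha> w|\<^sup>2\<close>, and the
    mixed term completes the square to \<open>|z + \<alpha> w|\<^sup>2\<close>.\<close>
  have "w\<^sup>2 * cnj D - (cnj w)\<^sup>2 * D = (w\<^sup>2 - (cnj w)\<^sup>2) +
      2 * \<i> * (w * cnj w) * (\<alpha> * w * cnj z + cnj \<alpha> * z * cnj w + \<alpha> * cnj \<alpha> * (w * cnj w))"
    unfolding cD unfolding Dzw by (simp add: algebra_simps power2_eq_square)
  also have "\<dots> = 2 * \<i> * ((z + \<alpha> * w) * cnj (z + \<alpha> * w)) * (w * cnj w)"
    unfolding wz by (simp add: algebra_simps)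
  finally have key: "w\<^sup>2 * cnj D - (cnj w)\<^sup>2 * D = 2 * \<i> * ((z + \<alpha> * w) * cnj (z + \<alpha> * w)) * (w * cnj w)" .
  have cD0: "cnj D \<noteq> 0" "cnj t \<noteq> 0" using \<open>D \<noteq> 0\<close> t0 by auto
  have cDt: "cnj D = cnj t * cnj t" using t2 by (metis complex_cnj_mult)
  have "w'\<^sup>2 - (cnj w')\<^sup>2 = (of_real r)\<^sup>2 * (w\<^sup>2 * cnj D - (cnj w)\<^sup>2 * D) / (D * cnj D)"
    unfolding cDt unfolding t2[symmetric] w'_def using t0 cD0 by (simp add: field_simps power2_eq_square)
  also have "\<dots> = 2 * \<i> * (z' * cnj z') * (w' * cnj w')"
  proof -
    have "z' * cnj z' = (\<epsilon> * cnj \<epsilon>) * ((z + \<alpha> * w) * cnj (z + \<alpha> * w)) / (t * cnj t)"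
      by (simp add: z'_def)
    then have zz': "z' * cnj z' = ((z + \<alpha> * w) * cnj (z + \<alpha> * w)) / (t * cnj t)" by (simp only: ee mult_1)
    show ?thesis unfolding key unfolding zz' cDt unfolding t2[symmetric] w'_def using t0 cD0 by (simp add: field_simps power2_eq_square)
  qed
  finally have quad: "2 * Re w' * Im w' = (norm z')\<^sup>2 * (norm w')\<^sup>2"
    unfolding quadratic_complex_iff .
  \<comment> \<open>Here \<open>norm e \<le> norm w / 4 \<le> 17/64 * \<bar>Re w\<bar>\<close>, so
    the real part of \<open>w / t\<close> keeps at least 47/64 of \<open>\<bar>Re w\<bar>\<close>,
    and the imaginary part reaches at most 21/64 of it.\<close>
  define e where "e = w * (inverse t - 1)"
  have we: "w / t = w + e" by (simp add: e_def algebra_simps divide_inverse)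
  have "norm (inverse t - 1) \<le> 1/4" using small(2) by (simp add: t_def D_def)
  then have ne: "norm e \<le> norm w * (1/4)"
    unfolding e_def norm_mult by (intro mult_left_mono) auto
  have "(norm z)\<^sup>2 \<le> (1/4)\<^sup>2" using small(1) by (intro power_mono) (auto simp: zw)
  then have tz: "(norm z)\<^sup>2 \<le> 1/16" by (simp add: power2_eq_square)
  then have ph: "0 \<le> phi ((norm z)\<^sup>2)" "phi ((norm z)\<^sup>2) \<le> 1/16"
    using phi_bounds[of "(norm z)\<^sup>2"] by auto
  have "Im w = Re w * phi ((norm z)\<^sup>2)" using p(2) by (simp add: zw M_iff_phi)
  then have iw: "\<bar>Im w\<bar> \<le> \<bar>Re w\<bar> * (1/16)"
    using ph by (simp only: abs_mult) (intro mult_left_mono, auto)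
  have "\<bar>Im (w / t)\<bar> \<le> \<bar>Re (w / t)\<bar>"
    using iw ne abs_Re_le_cmod[of e] abs_Im_le_cmod[of e] cmod_le[of w] unfolding we plus_complex.sel by linarith
  moreover have "\<bar>Im (of_real r * y)\<bar> \<le> \<bar>Re (of_real r * y)\<bar>" if "\<bar>Im y\<bar> \<le> \<bar>Re y\<bar>" for y
    using that by (simp add: abs_mult mult_left_mono)
  moreover have "w' = of_real r * (w / t)" by (simp add: w'_def)
  ultimately have "\<bar>Im w'\<bar> \<le> \<bar>Re w'\<bar>" by metis
  then show ?thesis using quad small(3) unfolding H M_iff_quadratic by simp
qed

lemma slit_origin: "(0, 0) \<in> slit \<alpha> s"
  by (simp add: slit_def radicand_def)

lemma continuous_on_Hmap: "continuous_on (slit \<alpha> s) (Hmap \<epsilon> r \<alpha> s)"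
proof (rule continuous_at_imp_continuous_on, rule ballI)
  fix p assume "p \<in> slit \<alpha> s"
  then show "isCont (Hmap \<epsilon> r \<alpha> s) p"
    using cholo_Hmap[of \<epsilon> r \<alpha> s] has_derivative_continuous unfolding cholo_def by blast
qed

text \<open>The explicit inverse \<open>K\<close> takes the place of an inverse function theorem: it
  gives injectivity, openness of the image as a preimage under \<open>K\<close>, and holomorphy of
  the inverse.\<close>

lemma Hmap_in_Aut:
  assumes \<epsilon>: "norm \<epsilon> = 1" and r: "r \<noteq> 0" and F: "germ_eq F (Hmap \<epsilon> r \<alpha> s)"
  shows "F \<in> Aut_M0"
proof -
  let ?H = "Hmap \<epsilon> r \<alpha> s"
  define \<beta> where "\<beta> = inv_alpha \<epsilon> r \<alpha>"
  define s' where "s' = - s / r\<^sup>2"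
  define K where "K = Hmap (cnj \<epsilon>) (1 / r) \<beta> s'"
  have KH: "K (?H p) = p" "?H p \<in> slit \<beta> s'" if "p \<in> slit \<alpha> s" for p
    using Hmap_inverse[OF \<epsilon> r that] by (auto simp: K_def \<beta>_def s'_def)
  \<comment> \<open>Inverting the parameters twice returns them, so the other composition is a
    further instance of the same lemma.\<close>
  have inv: "inv_alpha (cnj \<epsilon>) (1 / r) \<beta> = \<alpha>" "- s' / (1 / r)\<^sup>2 = s"
  proof -
    have "cnj \<epsilon> * \<epsilon> = 1" using complex_norm_square[of \<epsilon>] \<epsilon> by (simp add: mult.commute)
    then show "inv_alpha (cnj \<epsilon>) (1 / r) \<beta> = \<alpha>"
      using r by (simp add: inv_alpha_def \<beta>_def flip: mult.assoc)
    show "- s' / (1 / r)\<^sup>2 = s" using r by (simp add: s'_def power_divide)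
  qed
  have HK: "?H (K q) = q" if "q \<in> slit \<beta> s'" for q
    using Hmap_inverse(3)[of "cnj \<epsilon>" "1 / r" q \<beta> s'] that \<epsilon> r unfolding K_def inv by simp
  obtain U0 where U0: "open U0" "(0, 0) \<in> U0" "\<And>p. p \<in> U0 \<Longrightarrow> F p = ?H p"
    using F unfolding germ_eq_def by blast
  \<comment> \<open>The smallness conditions for the invariance of \<open>M\<close>, packed into one
    continuous function with value \<open>- 1/4\<close> at the origin; the neighbourhood is cut out
    by \<open>g < 0\<close>.\<close>
  define g where "g = (\<lambda>p. max (norm (fst p) - 1/4) (max (norm (inverse (csqrt (radicand \<alpha> s p)) - 1) - 1/4) (norm (fst (?H p)) - 1)))"
  have ck: "continuous_on (slit \<alpha> s) (\<lambda>p. inverse (csqrt (radicand \<alpha> s p)))"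
    using cdiff_imp_continuous[OF cdiff_inverse_csqrt] by (intro continuous_at_imp_continuous_on) blast
  have cg: "continuous_on (slit \<alpha> s) g"
    unfolding g_def
    by (intro continuous_on_max continuous_on_diff continuous_on_norm continuous_on_const ck
        continuous_on_fst continuous_on_Hmap continuous_on_id)
  define U where "U = U0 \<inter> (slit \<alpha> s \<inter> g -` {..<0})"
  have oU: "open U"
    unfolding U_def using U0 by (intro open_Int continuous_open_preimage[OF cg open_slit]) auto
  have U: "p \<in> slit \<alpha> s" "F p = ?H p" "norm (fst p) < 1/4"
    "norm (inverse (csqrt (radicand \<alpha> s p)) - 1) < 1/4" "norm (fst (?H p)) < 1" if "p \<in> U" for p
    using that U0(3) by (auto simp: U_def g_def)
  have zU: "(0, 0) \<in> U"
    using U0(2) slit_origin[of \<alpha> s] by (simp add: U_def g_def radicand_def Hmap_eq)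
  have img: "F ` U = slit \<beta> s' \<inter> K -` U"
  proof (intro equalityI subsetI)
    fix q assume "q \<in> F ` U"
    then obtain p where "p \<in> U" "q = ?H p" using U(2) by auto
    then show "q \<in> slit \<beta> s' \<inter> K -` U" using KH[OF U(1)] by simp
  next
    fix q assume q: "q \<in> slit \<beta> s' \<inter> K -` U"
    then have "F (K q) = q" using U(2)[of "K q"] HK by simp
    then show "q \<in> F ` U" using q by (metis IntD2 image_eqI vimageD)
  qed
  have oF: "open (F ` U)"
    unfolding img K_def by (intro continuous_open_preimage[OF continuous_on_Hmap open_slit] oU)
  have inj: "inj_on F U"
    by (rule inj_onI) (metis KH(1) U(1,2))
  have "cholo ?H U" using cholo_subset[OF cholo_Hmap oU] U(1) by blast
  then have cF: "cholo F U" by (rule cholo_cong) (simp add: U(2))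
  have "cholo K (F ` U)" unfolding K_def by (rule cholo_subset[OF cholo_Hmap oF]) (simp add: img)
  moreover have "K q = inv_into U F q" if "q \<in> F ` U" for q
  proof -
    obtain p where p: "p \<in> U" "q = F p" using \<open>q \<in> F ` U\<close> by blast
    then show ?thesis using KH(1)[OF U(1)[OF p(1)]] inj by (simp add: U(2))
      (metis U(2) inv_into_f_f)
  qed
  ultimately have cK: "cholo (inv_into U F) (F ` U)" by (rule cholo_cong)
  have "F p \<in> M" if "p \<in> M \<inter> U" for p
    using Hmap_preserves_M[OF \<epsilon> r, of p] U[of p] that by simp
  moreover have "F (0, 0) = (0, 0)" using U(2)[OF zU] by (simp add: Hmap_eq)
  ultimately show ?thesis unfolding Aut_M0_def using oU zU cF inj oF cK by blast
qed

section \<open>Asymptotic expansions\<close>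

definition order_ge :: "(real \<Rightarrow> complex) \<Rightarrow> nat \<Rightarrow> bool" where
  "order_ge h n \<longleftrightarrow> (\<exists>K\<ge>0. \<forall>\<^sub>F s in at_right 0. norm (h s) \<le> K * s ^ n)"

lemma eventually_small: "\<forall>\<^sub>F s in at_right (0::real). 0 < s \<and> s < 1"
  by (rule eventually_mono[OF eventually_at_right_real[of 0 1]]) auto

lemma order_ge_mono:
  assumes "order_ge h n" "m \<le> n"
  shows "order_ge h m"
proof -
  obtain K where K: "K \<ge> 0" "\<forall>\<^sub>F s in at_right 0. norm (h s) \<le> K * s ^ n"
    using assms unfolding order_ge_def by blast
  have "\<forall>\<^sub>F s in at_right 0. norm (h s) \<le> K * s ^ m"
    using K(2) eventually_small
  proof eventually_elim
    case (elim s)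
    have "s ^ n \<le> s ^ m" using elim \<open>m \<le> n\<close> by (intro power_decreasing) auto
    then have "K * s ^ n \<le> K * s ^ m" using K(1) by (rule mult_left_mono)
    then show ?case using elim by linarith
  qed
  then show ?thesis using K(1) unfolding order_ge_def by blast
qed

lemma order_ge_add:
  assumes "order_ge h n" "order_ge k n"
  shows "order_ge (\<lambda>s. h s + k s) n"
proof -
  obtain K L where K: "K \<ge> 0" "\<forall>\<^sub>F s in at_right 0. norm (h s) \<le> K * s ^ n"
    and L: "L \<ge> 0" "\<forall>\<^sub>F s in at_right 0. norm (k s) \<le> L * s ^ n"
    using assms unfolding order_ge_def by blast
  have "\<forall>\<^sub>F s in at_right 0. norm (h s + k s) \<le> (K + L) * s ^ n"
    using K(2) L(2)
  proof eventually_elim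
    case (elim s)
    then show ?case using norm_triangle_ineq[of "h s" "k s"] by (simp add: distrib_right)
  qed
  then show ?thesis unfolding order_ge_def by (intro exI[of _ "K + L"]) (use K L in auto)
qed

lemma order_ge_mult:
  assumes "order_ge h n" "order_ge k m"
  shows "order_ge (\<lambda>s. h s * k s) (n + m)"
proof -
  obtain K L where K: "K \<ge> 0" "\<forall>\<^sub>F s in at_right 0. norm (h s) \<le> K * s ^ n"
    and L: "L \<ge> 0" "\<forall>\<^sub>F s in at_right 0. norm (k s) \<le> L * s ^ m"
    using assms unfolding order_ge_def by blast
  have "\<forall>\<^sub>F s in at_right 0. norm (h s * k s) \<le> (K * L) * s ^ (n + m)"
    using K(2) L(2) eventually_small
  proof eventually_elim
    case (elim s)
    have "norm (h s) * norm (k s) \<le> (K * s ^ n) * (L * s ^ m)"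
      using elim K(1) by (intro mult_mono) auto
    then show ?case by (simp add: norm_mult power_add mult_ac)
  qed
  then show ?thesis unfolding order_ge_def by (intro exI[of _ "K * L"]) (use K L in auto)
qed

lemma order_ge_cong:
  assumes "\<forall>\<^sub>F s in at_right 0. h s = k s" "order_ge h n"
  shows "order_ge k n"
proof -
  obtain K where K: "K \<ge> 0" "\<forall>\<^sub>F s in at_right 0. norm (h s) \<le> K * s ^ n"
    using assms unfolding order_ge_def by blast
  have "\<forall>\<^sub>F s in at_right 0. norm (k s) \<le> K * s ^ n"
    using K(2) assms(1) by eventually_elim simp
  then show ?thesis using K unfolding order_ge_def by blast
qed

lemma order_ge_0: "order_ge (\<lambda>_. 0) n"
  unfolding order_ge_def by (rule exI[of _ 0]) simp

lemma order_ge_uminus: "order_ge h n \<Longrightarrow> order_ge (\<lambda>s. - h s) n"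
  by (simp add: order_ge_def)

lemma order_ge_diff: "order_ge h n \<Longrightarrow> order_ge k n \<Longrightarrow> order_ge (\<lambda>s. h s - k s) n"
  using order_ge_add[OF _ order_ge_uminus, of h n k] by simp

lemma order_ge_cnj: "order_ge (\<lambda>s. cnj (h s)) n \<longleftrightarrow> order_ge h n"
  by (simp add: order_ge_def)

lemma tendsto_imp_order_ge_0:
  assumes "(h \<longlongrightarrow> l) (at_right 0)"
  shows "order_ge h 0"
proof -
  have "\<forall>\<^sub>F s in at_right 0. dist (h s) l < 1"
    using assms by (rule tendstoD) simp
  then have "\<forall>\<^sub>F s in at_right 0. norm (h s) \<le> (norm l + 1) * s ^ 0"
  proof eventually_elim
    case (elim s)
    then show ?case using norm_triangle_sub[of "h s" l] by (simp add: dist_norm)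
  qed
  then show ?thesis unfolding order_ge_def by (intro exI[of _ "norm l + 1"]) auto
qed

lemma poly_of_real_tendsto:
  fixes q :: "complex poly"
  shows "((\<lambda>s. poly q (of_real s)) \<longlongrightarrow> poly q 0) (at_right (0::real))"
proof -
  have "isCont (\<lambda>s::real. poly q (of_real s)) 0" by (rule isCont_o2[OF _ poly_isCont]) simp
  then have "((\<lambda>s. poly q (of_real s)) \<longlongrightarrow> poly q 0) (at (0::real))" by (simp add: isCont_def)
  then show ?thesis by (rule filterlim_mono) (auto simp: at_within_le_at)
qed

lemma order_ge_poly_0: "order_ge (\<lambda>s. poly q (of_real s)) 0"
  by (rule tendsto_imp_order_ge_0[OF poly_of_real_tendsto])

lemma order_ge_power: "order_ge (\<lambda>s. of_real s ^ n) n"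
  unfolding order_ge_def
  by (rule exI[of _ 1], simp add: norm_power, use eventually_small in eventually_elim) auto

lemma order_ge_Suc_imp_tendsto:
  assumes "order_ge h (Suc n)"
  shows "(h \<longlongrightarrow> 0) (at_right 0)"
proof -
  have "order_ge h 1" using assms by (rule order_ge_mono) simp
  then obtain K where K: "\<forall>\<^sub>F s in at_right 0. norm (h s) \<le> K * s ^ 1"
    unfolding order_ge_def by blast
  have "((\<lambda>s::real. K * s ^ 1) \<longlongrightarrow> K * 0 ^ 1) (at_right 0)" by (intro tendsto_intros)
  then have "((\<lambda>s::real. K * s ^ 1) \<longlongrightarrow> 0) (at_right 0)" by simp
  from Lim_null_comparison[OF K this] show ?thesis .
qed

lemma order_ge_poly_coeff:
  assumes "order_ge (\<lambda>s. poly q (of_real s)) N" "n < N"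
  shows "coeff q n = 0"
  using assms
proof (induction N arbitrary: q n)
  case (Suc N)
  have "((\<lambda>s. poly q (of_real s)) \<longlongrightarrow> 0) (at_right 0)"
    using Suc.prems(1) by (rule order_ge_Suc_imp_tendsto)
  then have 0: "poly q 0 = 0" using poly_of_real_tendsto[of q] tendsto_unique[OF trivial_limit_at_right_real] by blast
  obtain a q' where q: "q = pCons a q'" by (cases q)
  then have a: "a = 0" using 0 by simp
  obtain K where K: "K \<ge> 0" "\<forall>\<^sub>F s in at_right 0. norm (poly q (of_real s)) \<le> K * s ^ Suc N"
    using Suc.prems(1) unfolding order_ge_def by blast
  have "\<forall>\<^sub>F s in at_right 0. norm (poly q' (of_real s)) \<le> K * s ^ N"
    using K(2) eventually_small
  proof eventually_elim
    case (elim s)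
    then have "s * norm (poly q' (of_real s)) \<le> s * (K * s ^ N)"
      by (simp add: q a norm_mult mult_ac)
    then show ?case using elim by (simp add: mult_le_cancel_left_pos)
  qed
  then have IH: "order_ge (\<lambda>s. poly q' (of_real s)) N" using K(1) unfolding order_ge_def by blast
  show ?case using Suc.IH[OF IH] Suc.prems(2) by (cases n) (auto simp: q a)
qed simp

text \<open>The variable is real so that conjugating \<open>h\<close> conjugates the coefficients.\<close>

definition expands :: "(real \<Rightarrow> complex) \<Rightarrow> complex fps \<Rightarrow> bool" where
  "expands h Q \<longleftrightarrow> (\<forall>N. \<exists>q. (\<forall>n\<le>N. coeff q n = Q $ n) \<and> order_ge (\<lambda>s. h s - poly q (of_real s)) (Suc N))"

lemma expandsE:
  assumes "expands h Q"
  obtains q where "\<And>n. n \<le> N \<Longrightarrow> coeff q n = Q $ n" "order_ge (\<lambda>s. h s - poly q (of_real s)) (Suc N)"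
  using assms unfolding expands_def by blast

text \<open>Composites and multiple series are approximated by finite expressions depending on the
  order \<open>N\<close>. Each of these expands by the algebraic rules, and only its coefficients up
  to \<open>N\<close> have to be right.\<close>

lemma expands_trunc:
  assumes "\<And>N. \<exists>k Q'. expands k Q' \<and> (\<forall>m\<le>N. Q' $ m = Q $ m) \<and> order_ge (\<lambda>s. h s - k s) (Suc N)"
  shows "expands h Q"
  unfolding expands_def
proof
  fix N
  obtain k Q' where k: "expands k Q'" "\<forall>m\<le>N. Q' $ m = Q $ m" "order_ge (\<lambda>s. h s - k s) (Suc N)"
    using assms by blast
  obtain q where q: "\<And>n. n \<le> N \<Longrightarrow> coeff q n = Q' $ n" "order_ge (\<lambda>s. k s - poly q (of_real s)) (Suc N)"
    using expandsE[OF k(1)] by metis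
  have "order_ge (\<lambda>s. h s - poly q (of_real s)) (Suc N)"
    using order_ge_add[OF k(3) q(2)] by simp
  then show "\<exists>q. (\<forall>n\<le>N. coeff q n = Q $ n) \<and> order_ge (\<lambda>s. h s - poly q (of_real s)) (Suc N)"
    using q(1) k(2) by auto
qed

lemma expands_unique:
  assumes "expands h Q" "expands h R"
  shows "Q = R"
proof (rule fps_ext)
  fix n
  obtain q where q: "\<And>m. m \<le> n \<Longrightarrow> coeff q m = Q $ m" "order_ge (\<lambda>s. h s - poly q (of_real s)) (Suc n)"
    using expandsE[OF assms(1)] by metis
  obtain r where r: "\<And>m. m \<le> n \<Longrightarrow> coeff r m = R $ m" "order_ge (\<lambda>s. h s - poly r (of_real s)) (Suc n)"
    using expandsE[OF assms(2)] by metis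
  have "order_ge (\<lambda>s. poly (q - r) (of_real s)) (Suc n)"
    using order_ge_diff[OF r(2) q(2)] by simp
  from order_ge_poly_coeff[OF this, of n] show "Q $ n = R $ n" using q(1) r(1) by simp
qed

lemma expands_cong:
  assumes "\<forall>\<^sub>F s in at_right 0. h s = k s" "expands h Q"
  shows "expands k Q"
  unfolding expands_def
proof
  fix N
  obtain q where q: "\<And>n. n \<le> N \<Longrightarrow> coeff q n = Q $ n" "order_ge (\<lambda>s. h s - poly q (of_real s)) (Suc N)"
    using expandsE[OF assms(2)] by metis
  have "\<forall>\<^sub>F s in at_right 0. h s - poly q (of_real s) = k s - poly q (of_real s)"
    using assms(1) by eventually_elim simp
  then have "order_ge (\<lambda>s. k s - poly q (of_real s)) (Suc N)" using q(2) by (rule order_ge_cong)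
  then show "\<exists>q. (\<forall>n\<le>N. coeff q n = Q $ n) \<and> order_ge (\<lambda>s. k s - poly q (of_real s)) (Suc N)"
    using q(1) by blast
qed

lemma expands_poly: "expands (\<lambda>s. poly q (of_real s)) (fps_of_poly q)"
  unfolding expands_def by (intro allI exI[of _ q]) (auto simp: order_ge_0)

lemma expands_const: "expands (\<lambda>_. c) (fps_const c)"
  using expands_poly[of "[:c:]"] by (simp add: fps_of_poly_const)

lemma expands_0: "expands (\<lambda>_. 0) 0"
  using expands_const[of 0] by simp

lemma expands_1: "expands (\<lambda>_. 1) 1"
  using expands_const[of 1] by simp

lemma expands_X: "expands (\<lambda>s. of_real s) fps_X"
  using expands_poly[of "[:0, 1:]"] by (simp add: fps_of_poly_pCons)

lemma expands_add:
  assumes "expands h Q" "expands k R"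
  shows "expands (\<lambda>s. h s + k s) (Q + R)"
  unfolding expands_def
proof
  fix N
  obtain q where q: "\<And>m. m \<le> N \<Longrightarrow> coeff q m = Q $ m" "order_ge (\<lambda>s. h s - poly q (of_real s)) (Suc N)"
    using expandsE[OF assms(1)] by metis
  obtain r where r: "\<And>m. m \<le> N \<Longrightarrow> coeff r m = R $ m" "order_ge (\<lambda>s. k s - poly r (of_real s)) (Suc N)"
    using expandsE[OF assms(2)] by metis
  have "order_ge (\<lambda>s. h s + k s - poly (q + r) (of_real s)) (Suc N)"
    using order_ge_add[OF q(2) r(2)] by (simp add: algebra_simps)
  then show "\<exists>q. (\<forall>n\<le>N. coeff q n = (Q + R) $ n) \<and> order_ge (\<lambda>s. h s + k s - poly q (of_real s)) (Suc N)"
    by (intro exI[of _ "q + r"]) (use q(1) r(1) in auto)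
qed

lemma expands_order_ge_0:
  assumes "expands h Q"
  shows "order_ge h 0"
proof -
  obtain q where q: "order_ge (\<lambda>s. h s - poly q (of_real s)) (Suc 0)"
    using expandsE[OF assms] by metis
  have "order_ge (\<lambda>s. h s - poly q (of_real s)) 0" using q by (rule order_ge_mono) simp
  from order_ge_add[OF this order_ge_poly_0[of q]] show ?thesis by simp
qed

lemma expands_order_ge_1:
  assumes "expands h Q" "Q $ 0 = 0"
  shows "order_ge h 1"
proof -
  obtain q where q: "coeff q 0 = Q $ 0" "order_ge (\<lambda>s. h s - poly q (of_real s)) (Suc 0)"
    using expandsE[OF assms(1), of 0] by (metis order_refl)
  obtain a q' where q': "q = pCons a q'" by (cases q)
  have "order_ge (\<lambda>s. of_real s ^ 1 * poly q' (of_real s)) (1 + 0)"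
    by (rule order_ge_mult[OF order_ge_power order_ge_poly_0])
  then have "order_ge (\<lambda>s. poly q (of_real s)) 1"
    using q(1) assms(2) by (simp add: q')
  from order_ge_add[OF q(2)[folded One_nat_def] this] show ?thesis by simp
qed

lemma expands_mult:
  assumes "expands h Q" "expands k R"
  shows "expands (\<lambda>s. h s * k s) (Q * R)"
  unfolding expands_def
proof
  fix N
  obtain q where q: "\<And>m. m \<le> N \<Longrightarrow> coeff q m = Q $ m" "order_ge (\<lambda>s. h s - poly q (of_real s)) (Suc N)"
    using expandsE[OF assms(1)] by metis
  obtain r where r: "\<And>m. m \<le> N \<Longrightarrow> coeff r m = R $ m" "order_ge (\<lambda>s. k s - poly r (of_real s)) (Suc N)"
    using expandsE[OF assms(2)] by metis
  have "order_ge (\<lambda>s. h s * (k s - poly r (of_real s)) + (h s - poly q (of_real s)) * poly r (of_real s)) (Suc N)"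
    using order_ge_mult[OF expands_order_ge_0[OF assms(1)] r(2)] order_ge_mult[OF q(2) order_ge_poly_0[of r]]
    by (intro order_ge_add) auto
  then have "order_ge (\<lambda>s. h s * k s - poly (q * r) (of_real s)) (Suc N)"
    by (simp add: algebra_simps)
  moreover have "coeff (q * r) n = (Q * R) $ n" if "n \<le> N" for n
    using that q(1) r(1) by (simp add: coeff_mult fps_mult_nth atLeast0AtMost)
  ultimately show "\<exists>q. (\<forall>n\<le>N. coeff q n = (Q * R) $ n) \<and> order_ge (\<lambda>s. h s * k s - poly q (of_real s)) (Suc N)"
    by blast
qed

lemma expands_diff:
  assumes "expands h Q" "expands k R"
  shows "expands (\<lambda>s. h s - k s) (Q - R)"
proof -
  have "expands (\<lambda>s. h s + (-1) * k s) (Q + fps_const (-1) * R)"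
    by (intro expands_add expands_mult expands_const assms)
  then show ?thesis by (simp flip: fps_const_neg)
qed

lemma expands_cnj:
  assumes "expands h Q"
  shows "expands (\<lambda>s. cnj (h s)) (fps_cnj Q)"
  unfolding expands_def
proof
  fix N
  obtain q where q: "\<And>m. m \<le> N \<Longrightarrow> coeff q m = Q $ m" "order_ge (\<lambda>s. h s - poly q (of_real s)) (Suc N)"
    using expandsE[OF assms(1)] by metis
  have "poly (map_poly cnj q) (of_real s) = cnj (poly q (of_real s))" for s
    by (induction q) (auto simp: map_poly_pCons)
  then have "order_ge (\<lambda>s. cnj (h s) - poly (map_poly cnj q) (of_real s)) (Suc N)"
    using q(2) order_ge_cnj[of "\<lambda>s. h s - poly q (of_real s)"] by simp
  then show "\<exists>q. (\<forall>n\<le>N. coeff q n = fps_cnj Q $ n) \<and> order_ge (\<lambda>s. cnj (h s) - poly q (of_real s)) (Suc N)"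
    by (intro exI[of _ "map_poly cnj q"]) (use q(1) in \<open>auto simp: coeff_map_poly\<close>)
qed

lemma expands_power: "expands h Q \<Longrightarrow> expands (\<lambda>s. h s ^ n) (Q ^ n)"
  by (induction n) (auto intro: expands_1 expands_mult)

lemma expands_sum: "(\<And>i. i \<in> A \<Longrightarrow> expands (h i) (Q i)) \<Longrightarrow> expands (\<lambda>s. \<Sum>i\<in>A. h i s) (\<Sum>i\<in>A. Q i)"
  by (induction A rule: infinite_finite_induct) (auto intro: expands_0 expands_add)

lemma expands_prod: "(\<And>i. i \<in> A \<Longrightarrow> expands (h i) (Q i)) \<Longrightarrow> expands (\<lambda>s. \<Prod>i\<in>A. h i s) (\<Prod>i\<in>A. Q i)"
  by (induction A rule: infinite_finite_induct) (auto intro: expands_1 expands_mult)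

lemma order_ge_1_imp_tendsto: "order_ge h 1 \<Longrightarrow> (h \<longlongrightarrow> 0) (at_right 0)"
  using order_ge_Suc_imp_tendsto[of h 0] by simp

lemma order_ge_pow: "order_ge h 1 \<Longrightarrow> order_ge (\<lambda>s. h s ^ n) n"
proof (induction n)
  case 0
  then show ?case using expands_order_ge_0[OF expands_1] by simp
next
  case (Suc n)
  then show ?case using order_ge_mult[of h 1 "\<lambda>s. h s ^ n" n] by simp
qed

text \<open>Taylor's formula in the form \<open>g t = p t + t ^ Suc N * u t\<close> with
  \<open>u\<close> continuous at 0. As \<open>h\<close> has order at least 1, the remainder has
  order at least \<open>Suc N\<close>, and the polynomial part expands term by term.\<close>

lemma expands_compose:
  assumes g: "g has_fps_expansion G" and h: "expands h Q" and Q0: "Q $ 0 = 0"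
  shows "expands (\<lambda>s. g (h s)) (G oo Q)"
proof (rule expands_trunc)
  fix N
  define T where "T = (\<Sum>n\<le>N. fps_const (G $ n) * fps_X ^ n)"
  define p where "p = (\<lambda>t. \<Sum>n\<le>N. G $ n * t ^ n)"
  have o1: "order_ge h 1" using h Q0 by (rule expands_order_ge_1)
  have "p has_fps_expansion T" unfolding p_def T_def by (intro fps_expansion_intros)
  then have gp: "(\<lambda>t. g t - p t) has_fps_expansion (G - T)" using g by (intro fps_expansion_intros)
  have nth: "(G - T) $ n = 0" if "n \<le> N" for n
    using that by (simp add: T_def fps_sum_nth fps_X_power_iff if_distrib[of "(*) _"] cong: if_cong)
  obtain u where u: "isCont u 0" "\<And>t. t \<noteq> 0 \<Longrightarrow> g t - p t = t ^ Suc N * u t"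
  \<comment> \<open>The zero series has subdegree 0, so the shift rule does not cover it; in that
    case \<open>g\<close> and \<open>p\<close> agree near 0.\<close>
  proof (cases "G - T = 0")
    case True
    then have z: "(\<lambda>t. g t - p t) has_fps_expansion 0" using gp by simp
    have "\<forall>\<^sub>F t in nhds 0. g t - p t = 0"
      using z by (auto simp: has_fps_expansion_def elim: eventually_mono)
    then have "\<forall>\<^sub>F t in nhds 0. (g t - p t) / t ^ Suc N = 0" by eventually_elim simp
    then have "isCont (\<lambda>t. (g t - p t) / t ^ Suc N) 0"
      using isCont_cong[of "\<lambda>t. (g t - p t) / t ^ Suc N" "\<lambda>_. 0" 0] by simp
    then show ?thesis by (rule that) simp
  next
    case False
    then have "Suc N \<le> subdegree (G - T)"
      using nth by (intro subdegree_geI) auto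
    from has_fps_expansion_shift[OF gp this refl]
    have "isCont (\<lambda>t. if t = 0 then (G - T) $ Suc N else (g t - p t) / t ^ Suc N) 0"
      by (rule has_fps_expansion_imp_continuous)
    then show ?thesis by (rule that) simp
  qed
  \<comment> \<open>\<open>h s\<close> may be 0 for arbitrarily small \<open>s\<close>, so the
    factorisation must hold at \<open>t = 0\<close> as well.\<close>
  have g0: "g 0 = p 0"
  proof -
    have "g 0 = G $ 0" using has_fps_expansion_imp_0_eq_fps_nth_0[OF g] .
    moreover have "p 0 = (\<Sum>n\<le>N. if n = 0 then G $ 0 else 0)" unfolding p_def by (intro sum.cong) auto
    ultimately show ?thesis by simp
  qed
  have eq: "g t - p t = t ^ Suc N * u t" for t
    using u(2)[of t] g0 by (cases "t = 0") auto
  have "(u \<longlongrightarrow> u 0) (at 0)" using u(1) by (simp add: isCont_def)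
  then have "((\<lambda>s. u (h s)) \<longlongrightarrow> u 0) (at_right 0)"
    using isCont_tendsto_compose[OF u(1) order_ge_1_imp_tendsto[OF o1]] by simp
  then have "order_ge (\<lambda>s. u (h s)) 0" by (rule tendsto_imp_order_ge_0)
  from order_ge_mult[OF order_ge_pow[OF o1, of "Suc N"] this]
  have "order_ge (\<lambda>s. g (h s) - p (h s)) (Suc N)" by (simp only: eq add_0_right)
  moreover have "expands (\<lambda>s. p (h s)) (\<Sum>n\<le>N. fps_const (G $ n) * Q ^ n)"
    unfolding p_def by (intro expands_sum expands_mult expands_const expands_power h)
  moreover have "(\<Sum>n\<le>N. fps_const (G $ n) * Q ^ n) $ m = (G oo Q) $ m" if "m \<le> N" for m
  proof -
    have "(G oo Q) $ m = (\<Sum>n\<le>N. G $ n * (Q ^ n) $ m)"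
      unfolding fps_compose_nth
      by (rule sum.mono_neutral_left) (use that Q0 in \<open>auto intro!: fps_nth_power_low\<close>)
    then show ?thesis by (simp add: fps_sum_nth)
  qed
  ultimately show "\<exists>k Q'. expands k Q' \<and> (\<forall>m\<le>N. Q' $ m = (G oo Q) $ m) \<and> order_ge (\<lambda>s. g (h s) - k s) (Suc N)"
    by blast
qed

text \<open>Comparison with the point whose coordinates all equal \<open>r\<close>, where the series
  converges absolutely: a term of degree above \<open>N\<close> at \<open>x\<close> is at most
  \<open>(\<rho> / r) ^ Suc N\<close> times the corresponding term at that point, in absolute
  value.\<close>

lemma mp_eval_remainder:
  fixes f :: "('v::finite) mps"
  assumes "mp_converges f"
  shows "\<exists>r K. r > 0 \<and> K \<ge> 0 \<and> (\<forall>x \<rho>. 0 \<le> \<rho> \<longrightarrow> \<rho> \<le> r \<longrightarrow> (\<forall>v. norm (x v) \<le> \<rho>) \<longrightarrow>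
     norm (mp_eval f x - (\<Sum>m | mdeg m \<le> N. mp_term f x m)) \<le> K * \<rho> ^ Suc N)"
proof -
  obtain R where R: "R > 0" "\<And>x. (\<forall>v. norm (x v) < R) \<Longrightarrow> mp_term f x summable_on UNIV"
    using assms unfolding mp_converges_def by blast
  define r where "r = R / 2"
  have r: "r > 0" "r < R" using R by (auto simp: r_def)
  define y :: "'v \<Rightarrow> complex" where "y = (\<lambda>_. of_real r)"
  define C where "C = - {m::'v\<Rightarrow>nat. mdeg m \<le> N}"
  have "mp_term f y summable_on UNIV" using R(2) r by (simp add: y_def)
  then have "(\<lambda>m. norm (mp_term f y m)) summable_on UNIV"
    using summable_on_iff_abs_summable_on_complex by blast
  then have sy: "(\<lambda>m. norm (mp_term f y m)) summable_on C"
    by (rule summable_on_subset_banach) simp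
  define K where "K = infsum (\<lambda>m. norm (mp_term f y m)) C"
  have K: "K \<ge> 0" unfolding K_def by (rule infsum_nonneg) simp
  have "norm (mp_eval f x - (\<Sum>m | mdeg m \<le> N. mp_term f x m)) \<le> K / r ^ Suc N * \<rho> ^ Suc N"
    if \<rho>: "0 \<le> \<rho>" "\<rho> \<le> r" and x: "\<forall>v. norm (x v) \<le> \<rho>" for x \<rho>
  proof -
    have sx: "mp_term f x summable_on UNIV"
      using R(2)[of x] x \<rho> r by (meson le_less_trans)
    then have sxC: "mp_term f x summable_on C" by (rule summable_on_subset_banach) simp
    have "mp_eval f x = infsum (mp_term f x) ({m. mdeg m \<le> N} \<union> C)"
      unfolding mp_eval_def C_def by (simp add: Compl_partition)
    also have "\<dots> = infsum (mp_term f x) {m. mdeg m \<le> N} + infsum (mp_term f x) C"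
      by (rule infsum_Un_disjoint[OF _ sxC]) (auto simp: C_def)
    finally have eq: "mp_eval f x - (\<Sum>m | mdeg m \<le> N. mp_term f x m) = infsum (mp_term f x) C"
      by simp
    have le: "norm (mp_term f x m) \<le> (\<rho> / r) ^ Suc N * norm (mp_term f y m)" if "m \<in> C" for m
    proof -
      have "norm (mp_term f x m) = norm (f m) * (\<Prod>v\<in>UNIV. norm (x v) ^ m v)"
        by (simp add: mp_term_def norm_mult prod_norm[symmetric] norm_power)
      also have "\<dots> \<le> norm (f m) * (\<Prod>v\<in>UNIV. \<rho> ^ m v)"
        using x by (intro mult_left_mono prod_mono conjI power_mono) auto
      also have "(\<Prod>v\<in>UNIV. \<rho> ^ m v) = \<rho> ^ mdeg m" by (simp add: mdeg_def power_sum)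
      also have "\<rho> ^ mdeg m = (\<rho> / r) ^ mdeg m * r ^ mdeg m"
        using r by (simp add: power_divide)
      also have "(\<rho> / r) ^ mdeg m \<le> (\<rho> / r) ^ Suc N"
        using that \<rho> r by (intro power_decreasing) (auto simp: C_def)
      also have "norm (f m) * ((\<rho> / r) ^ Suc N * r ^ mdeg m) = (\<rho> / r) ^ Suc N * norm (mp_term f y m)"
        using r by (simp add: mp_term_def norm_mult prod_norm[symmetric] norm_power y_def mdeg_def power_sum mult_ac)
      finally show ?thesis using r by (simp add: mult_left_mono mult_right_mono)
    qed
    have "norm (infsum (mp_term f x) C) \<le> (\<rho> / r) ^ Suc N * K"
    proof (rule norm_infsum_le[OF has_sum_infsum[OF sxC]])
      show "((\<lambda>m. (\<rho> / r) ^ Suc N * norm (mp_term f y m)) has_sum ((\<rho> / r) ^ Suc N * K)) C"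
        unfolding K_def by (intro has_sum_cmult_right has_sum_infsum sy)
    qed (use le in auto)
    then show ?thesis unfolding eq by (simp add: power_divide mult_ac)
  qed
  moreover have "K / r ^ Suc N \<ge> 0" using K r by simp
  ultimately show ?thesis using r(1) by blast
qed

lemma expands_mp_eval:
  fixes f :: "('v::finite) mps"
  assumes f: "mp_converges f" and c: "\<And>v. expands (\<lambda>s. c v s) (C v)" and C0: "\<And>v. C v $ 0 = 0"
  shows "expands (\<lambda>s. mp_eval f (\<lambda>v. c v s)) (along C f)"
proof (rule expands_trunc)
  fix N
  define k where "k = (\<lambda>s. \<Sum>m | mdeg m \<le> N. f m * (\<Prod>v\<in>UNIV. c v s ^ m v))"
  have k: "expands k (\<Sum>m | mdeg m \<le> N. fps_const (f m) * curve_monom C m)"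
    unfolding k_def curve_monom_def by (intro expands_sum expands_mult expands_const expands_prod expands_power c)
  have nth: "(\<Sum>m | mdeg m \<le> N. fps_const (f m) * curve_monom C m) $ n = along C f $ n" if "n \<le> N" for n
    using along_nth_ge[where f = f, OF C0 that] by (simp add: fps_sum_nth)
  obtain r K where rK: "r > 0" "K \<ge> 0" and rem: "\<And>x \<rho>. 0 \<le> \<rho> \<Longrightarrow> \<rho> \<le> r \<Longrightarrow> (\<And>v. norm (x v) \<le> \<rho>) \<Longrightarrow>
     norm (mp_eval f x - (\<Sum>m | mdeg m \<le> N. mp_term f x m)) \<le> K * \<rho> ^ Suc N"
    using mp_eval_remainder[OF f, of N] by blast
  have "\<forall>v. \<exists>L\<ge>0. \<forall>\<^sub>F s in at_right 0. norm (c v s) \<le> L * s"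
    using expands_order_ge_1[OF c C0] unfolding order_ge_def by simp
  then obtain L where L: "\<And>v. L v \<ge> 0" "\<And>v. \<forall>\<^sub>F s in at_right 0. norm (c v s) \<le> L v * s"
    by metis
  define B where "B = (\<Sum>v\<in>UNIV. L v)"
  have LB: "L v \<le> B" for v unfolding B_def using L(1) by (intro member_le_sum) auto
  have B: "B \<ge> 0" using L(1)[of undefined] LB[of undefined] by linarith
  have "((\<lambda>s. B * s) \<longlongrightarrow> B * 0) (at_right (0::real))" by (intro tendsto_intros)
  then have "\<forall>\<^sub>F s in at_right 0. B * s < r" using rK(1) by (intro order_tendstoD) auto
  moreover have "\<forall>\<^sub>F s in at_right 0. \<forall>v. norm (c v s) \<le> L v * s"
    using L(2) by (intro eventually_all_finite) auto
  ultimately have "\<forall>\<^sub>F s in at_right 0. norm (mp_eval f (\<lambda>v. c v s) - k s) \<le> (K * B ^ Suc N) * s ^ Suc N"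
    using eventually_small
  proof eventually_elim
    case (elim s)
    have "norm (c v s) \<le> B * s" for v
    proof -
      have "L v * s \<le> B * s" using LB elim by (intro mult_right_mono) auto
      then show ?thesis using elim(2) by (meson order.trans)
    qed
    then have "norm (mp_eval f (\<lambda>v. c v s) - (\<Sum>m | mdeg m \<le> N. mp_term f (\<lambda>v. c v s) m)) \<le> K * (B * s) ^ Suc N"
      using elim B by (intro rem) auto
    then show ?case by (simp add: k_def mp_term_def power_mult_distrib mult_ac)
  qed
  then have "order_ge (\<lambda>s. mp_eval f (\<lambda>v. c v s) - k s) (Suc N)"
    unfolding order_ge_def using rK B by (intro exI[of _ "K * B ^ Suc N"]) auto
  then show "\<exists>k Q'. expands k Q' \<and> (\<forall>m\<le>N. Q' $ m = along C f $ m) \<and> order_ge (\<lambda>s. mp_eval f (\<lambda>v. c v s) - k s) (Suc N)"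
    using k nth by blast
qed

section \<open>Division by the defining function\<close>

type_synonym nest4 = "complex fps fps fps fps"

text \<open>The nesting order, from the outside in, is \<open>w\<^sup>*, w, z\<^sup>*, z\<close>.\<close>

definition nest4 :: "4 mps \<Rightarrow> nest4" where
  "nest4 f = Abs_fps (\<lambda>n. Abs_fps (\<lambda>j. Abs_fps (\<lambda>k. Abs_fps (\<lambda>i. f (quad i j k n)))))"

definition unnest4 :: "nest4 \<Rightarrow> 4 mps" where
  "unnest4 F = (\<lambda>m. F $ m 3 $ m 1 $ m 2 $ m 0)"

lemma nest4_nth: "nest4 f $ n $ j $ k $ i = f (quad i j k n)"
  by (simp add: nest4_def)

lemma nest4_unnest4 [simp]: "nest4 (unnest4 F) = F"
  by (intro fps_ext) (simp add: nest4_nth unnest4_def)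

lemma unnest4_nest4 [simp]: "unnest4 (nest4 f) = f"
  by (simp add: fun_eq_iff nest4_nth unnest4_def quad_eta)

lemma nest4_mult: "nest4 (mpmult f g) = nest4 f * nest4 g"
proof (intro fps_ext)
  fix n j k i
  define h where "h = (\<lambda>(n', j', k', i'). f (quad i' j' k' n') * g (quad (i - i') (j - j') (k - k') (n - n')))"
  have "nest4 (mpmult f g) $ n $ j $ k $ i =
      (\<Sum>a | \<forall>v. a v \<le> quad i j k n v. f a * g (\<lambda>v. quad i j k n v - a v))"
    by (simp add: nest4_nth mpmult_def)
  also have "\<dots> = (\<Sum>p\<in>{0..n} \<times> {0..j} \<times> {0..k} \<times> {0..i}. h p)"
  proof (rule sum.reindex_bij_witness[where i = "\<lambda>(n', j', k', i'). quad i' j' k' n'"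
        and j = "\<lambda>a. (a 3, a 1, a 2, a 0)"])
    fix a :: "4 \<Rightarrow> nat"
    have "(\<lambda>v. quad i j k n v - a v) = quad (i - a 0) (j - a 1) (k - a 2) (n - a 3)"
      by (simp add: fun_eq_iff all_4)
    then show "h (a 3, a 1, a 2, a 0) = f a * g (\<lambda>v. quad i j k n v - a v)"
      by (simp add: h_def quad_eta)
  qed (auto simp: quad_eta all_4)
  also have "\<dots> = (\<Sum>n'=0..n. \<Sum>j'=0..j. \<Sum>k'=0..k. \<Sum>i'=0..i. h (n', j', k', i'))"
    by (simp add: sum.cartesian_product)
  also have "\<dots> = (nest4 f * nest4 g) $ n $ j $ k $ i"
    by (simp add: fps_mult_nth fps_sum_nth h_def nest4_nth)
  finally show "nest4 (mpmult f g) $ n $ j $ k $ i = (nest4 f * nest4 g) $ n $ j $ k $ i" .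
qed

lemma unnest4_mult: "unnest4 (F * G) = mpmult (unnest4 F) (unnest4 G)"
  by (metis nest4_mult nest4_unnest4 unnest4_nest4)

lemma unnest4_add: "unnest4 (F + G) = mpadd (unnest4 F) (unnest4 G)"
  by (simp add: unnest4_def mpadd_def)

text \<open>\<open>w - w\<^sup>* E (z z\<^sup>*)\<close>, which is \<open>rho_ser\<close> up to a unit and has leading coefficient 1 in
\<open>w\<close>.\<close>

definition main_divisor :: "4 mps" where
  "main_divisor = mpadd (mpvar 1) (mpscale (-1) (mpmult (mpvar 3) (diag E_fps)))"

lemma nest4_var1: "nest4 (mpvar 1) = fps_const fps_X"
  by (intro fps_ext) (auto simp: nest4_nth mpvar_def fun_eq_iff all_4 fps_X_def)

lemma nest4_var3: "nest4 (mpvar 3) = fps_X"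
  by (intro fps_ext) (auto simp: nest4_nth mpvar_def fun_eq_iff all_4 fps_X_def)

lemma nest4_diag: "nest4 (diag e) = fps_const (fps_const (twist e))"
  by (intro fps_ext) (auto simp: nest4_nth diag_def twist_nth fps_X_power_iff)

lemma nest4_main_divisor:
  "nest4 main_divisor = fps_const fps_X - fps_X * fps_const (fps_const (twist E_fps))"
proof -
  have "nest4 main_divisor = nest4 (mpvar 1) - nest4 (mpmult (mpvar 3) (diag E_fps))"
    by (intro fps_ext) (simp add: nest4_nth main_divisor_def mpadd_def mpscale_def)
  then show ?thesis by (simp add: nest4_mult nest4_var1 nest4_var3 nest4_diag)
qed

text \<open>Weierstrass division by a divisor that is monic of degree one in \<open>w\<close>. In
  powers of \<open>w\<^sup>*\<close>, the equation at order \<open>n\<close> reads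
  \<open>T $ n = q n * w - q (n - 1) * e + R $ n\<close>, without the middle term for
  \<open>n = 0\<close>. As \<open>R $ n\<close> is to be free of \<open>w\<close>, this forces
  \<open>q n\<close>, and the quotient is found by recursion.\<close>

lemma divide_by_main_divisor:
  fixes S :: "4 mps"
  shows "\<exists>a R. S = mpadd (mpmult a main_divisor) R \<and> (\<forall>m. m 1 \<noteq> 0 \<longrightarrow> R m = 0)"
proof -
  define T where "T = nest4 S"
  define e where "e = fps_const (twist E_fps)"
  define q where "q = rec_nat (fps_shift 1 (T $ 0)) (\<lambda>n b. fps_shift 1 (T $ Suc n + b * e))"
  have q: "q 0 = fps_shift 1 (T $ 0)" "q (Suc n) = fps_shift 1 (T $ Suc n + q n * e)" for n
    by (simp_all add: q_def)
  define A where "A = Abs_fps q"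
  define R where "R = T - A * (fps_const fps_X - fps_X * fps_const e)"
  have R: "R $ n $ j = 0" if "j \<noteq> 0" for n j
  proof -
    have X: "(fps_shift 1 G * fps_X) $ j = G $ j" for G :: "complex fps fps fps"
      using that by (cases j) auto
    have "A * (fps_const fps_X - fps_X * fps_const e) = A * fps_const fps_X - fps_X * (A * fps_const e)"
      by (simp add: algebra_simps)
    then have "R $ n = T $ n - (q n * fps_X - (if n = 0 then 0 else q (n - 1) * e))"
      by (simp add: R_def A_def fps_X_mult_nth)
    then have "R $ n $ j = (T $ n + (if n = 0 then 0 else q (n - 1) * e)) $ j - (q n * fps_X) $ j"
      by (cases n) simp_all
    also have "q n = fps_shift 1 (T $ n + (if n = 0 then 0 else q (n - 1) * e))"
      using q by (cases n) auto
    finally show ?thesis by (simp only: X diff_self)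
  qed
  have "T = A * nest4 main_divisor + R"
    by (simp add: R_def nest4_main_divisor e_def)
  then have "unnest4 T = unnest4 (A * nest4 main_divisor + R)" by simp
  then have "S = mpadd (mpmult (unnest4 A) main_divisor) (unnest4 R)"
    unfolding unnest4_add unnest4_mult T_def unnest4_nest4 .
  moreover have "unnest4 R m = 0" if "m 1 \<noteq> 0" for m
    using R[OF that] by (simp add: unnest4_def)
  ultimately show ?thesis by blast
qed

lemma along_main_divisor:
  assumes c: "\<And>v. c v $ 0 = 0"
  shows "along c main_divisor = c 1 - c 3 * (E_fps oo (c 0 * c 2))"
  by (simp add: main_divisor_def along_add along_scale along_mult c along_var along_diag flip: fps_const_neg)

text \<open>Writing \<open>\<rho>\<close> for the defining function,
  \<open>2 \<i> \<rho> = w (1 - \<i> phi) - w\<^sup>* (1 + \<i> phi)\<close>; multiplying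
  \<open>\<rho>\<close> by this unit leaves \<open>w - w\<^sup>* E\<close>.\<close>

definition rho_cofactor :: "complex fps" where
  "rho_cofactor = fps_const (2 * \<i>) * inverse (1 - fps_const \<i> * phi_fps)"

lemma along_main_divisor_rho:
  assumes c: "\<And>v. c v $ 0 = 0"
  shows "along c main_divisor = along c (diag rho_cofactor) * along c rho_ser"
proof -
  define p where "p = phi_fps oo (c 0 * c 2)"
  define V where "V = inverse (1 - fps_const \<i> * phi_fps) oo (c 0 * c 2)"
  have cc0: "(c 0 * c 2) $ 0 = 0" using c by simp
  have "inverse (1 - fps_const \<i> * phi_fps) * (1 - fps_const \<i> * phi_fps) = 1"
    by (rule inverse_mult_eq_1) simp
  then have V: "V * (1 - fps_const \<i> * p) = 1"
    unfolding V_def p_def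
    by (metis cc0 fps_compose_mult_distrib fps_compose_sub_distrib fps_compose_1 fps_const_compose)
  have E: "E_fps oo (c 0 * c 2) = (1 + fps_const \<i> * p) * V"
    by (simp add: E_fps_def fps_compose_mult_distrib[OF cc0] fps_compose_add_distrib V_def p_def)
  have k: "fps_const (2 * \<i>) * fps_const (1 / (2 * \<i>)) = 1" "fps_const (2 * \<i>) * fps_const (1/2) = fps_const \<i>"
    by simp_all
  have "along c (diag rho_cofactor) * along c rho_ser = fps_const (2 * \<i>) * V *
     (fps_const (1 / (2 * \<i>)) * (c 1 - c 3) - fps_const (1/2) * ((c 1 + c 3) * p))"
    by (simp add: along_diag c along_rho rho_cofactor_def fps_compose_mult_distrib[OF cc0] V_def p_def)
  also have "\<dots> = V * ((fps_const (2 * \<i>) * fps_const (1 / (2 * \<i>))) * (c 1 - c 3) - (fps_const (2 * \<i>) * fps_const (1/2)) * ((c 1 + c 3) * p))"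
    by (simp only: right_diff_distrib mult_ac)
  also have "\<dots> = V * ((c 1 - c 3) - fps_const \<i> * ((c 1 + c 3) * p))"
    by (simp only: k mult_1)
  also have "\<dots> = c 1 * (V * (1 - fps_const \<i> * p)) - c 3 * ((1 + fps_const \<i> * p) * V)"
    by (simp add: algebra_simps)
  also have "\<dots> = along c main_divisor" by (simp add: V E along_main_divisor c)
  finally show ?thesis ..
qed

lemma along_independent:
  assumes "\<And>m. m u \<noteq> 0 \<Longrightarrow> f m = 0"
  shows "along (c(u := d)) f = along c f"
proof (rule fps_ext)
  fix n
  have "f m * curve_monom (c(u := d)) m $ n = f m * curve_monom c m $ n" for m
  proof (cases "m u = 0")
    case True
    then have "curve_monom (c(u := d)) m = curve_monom c m" unfolding curve_monom_def by (intro prod.cong) auto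
    then show ?thesis by simp
  qed (simp add: assms)
  then show "along (c(u := d)) f $ n = along c f $ n"
    unfolding along_nth by (intro sum.cong refl)
qed

text \<open>On the hypersurface \<open>w\<close> is a function of the other variables, so its
  leading coefficient cannot be prescribed independently, while a test vector has four entries. The
  remainder of the division does not contain \<open>w\<close>; this component of the curve may
  therefore be replaced by any line.\<close>

lemma divisible_by_rho:
  fixes S :: "4 mps"
  assumes X: "test_set X"
    and c: "\<And>x. x \<in> X \<Longrightarrow> \<exists>c. (\<forall>v. c v $ 0 = 0) \<and> (\<forall>v. v \<noteq> 1 \<longrightarrow> c v $ 1 = x v) \<and> along c S = 0 \<and> along c rho_ser = 0"
  shows "\<exists>a. S = mpmult a rho_ser"
proof -
  obtain a R where S: "S = mpadd (mpmult a main_divisor) R" and R: "\<And>m. m 1 \<noteq> 0 \<Longrightarrow> R m = 0"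
    using divide_by_main_divisor[of S] by blast
  have alongS: "along c S = along c a * (along c (diag rho_cofactor) * along c rho_ser) + along c R"
    if "\<And>v. c v $ 0 = 0" for c
    using that by (simp add: S along_add along_mult along_main_divisor_rho)
  have "R = (\<lambda>_. 0)"
  proof (rule test_set_eq[OF X])
    fix x assume "x \<in> X"
    from c[OF this] obtain c where c: "\<And>v. c v $ 0 = 0" "\<And>v. v \<noteq> 1 \<Longrightarrow> c v $ 1 = x v" "along c S = 0" "along c rho_ser = 0"
      by blast
    define d where "d = c(1 := fps_const (x 1) * fps_X)"
    have "along c R = 0" using alongS[OF c(1)] c(3,4) by simp
    then have "along d R = 0" unfolding d_def using along_independent[of 1 R] R by metis
    moreover have "along d (\<lambda>_. 0) = 0" by (rule fps_ext) (simp add: along_nth)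
    moreover have "\<forall>v. d v $ 0 = 0 \<and> d v $ 1 = x v" using c by (simp add: d_def)
    ultimately show "\<exists>c. (\<forall>v. c v $ 0 = 0 \<and> c v $ 1 = x v) \<and> along c R = along c (\<lambda>_. 0)" by metis
  qed
  then have R0: "along c R = 0" for c by (intro fps_ext) (simp add: along_nth)
  have "S = mpmult (mpmult a (diag rho_cofactor)) rho_ser"
  proof (rule test_set_eq[OF test_set_UNIV])
    fix x :: "4 \<Rightarrow> complex"
    define l where "l = (\<lambda>v. fps_const (x v) * fps_X)"
    have l: "l v $ 0 = 0" "l v $ 1 = x v" for v by (auto simp: l_def)
    have "along l S = along l (mpmult (mpmult a (diag rho_cofactor)) rho_ser)"
      by (simp add: alongS[OF l(1)] R0 along_mult l(1) mult.assoc)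
    then show "\<exists>c. (\<forall>v. c v $ 0 = 0 \<and> c v $ 1 = x v) \<and> along c S = along c (mpmult (mpmult a (diag rho_cofactor)) rho_ser)"
      using l by blast
  qed
  then show ?thesis by blast
qed

lemma infinite_unit_circle: "infinite {z::complex. norm z = 1}"
proof -
  \<comment> \<open>The Cayley transform, which maps the real line injectively into the
    circle.\<close>
  define f where "f = (\<lambda>t::real. (1 + \<i> * of_real t) / (1 - \<i> * of_real t))"
  have nz: "1 - \<i> * of_real t \<noteq> 0" "1 + \<i> * of_real t \<noteq> 0" for t :: real
    by (auto simp: complex_eq_iff)
  have "inj f"
  proof (rule injI)
    fix s t assume "f s = f t"
    then have "(1 + \<i> * of_real s) * (1 - \<i> * of_real t) = (1 + \<i> * of_real t) * (1 - \<i> * of_real s)"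
      using nz by (simp add: f_def divide_eq_eq eq_divide_eq mult.commute)
    then show "s = t" by (simp add: complex_eq_iff)
  qed
  then have "infinite (range f)" by (simp add: finite_image_iff infinite_UNIV_char_0)
  moreover have "range f \<subseteq> {z. norm z = 1}"
  proof
    fix z assume "z \<in> range f"
    then obtain t where z: "z = f t" by blast
    have "norm (1 + \<i> * of_real t) = norm (cnj (1 - \<i> * of_real t))" by simp
    also have "\<dots> = norm (1 - \<i> * of_real t)" by (rule complex_mod_cnj)
    finally show "z \<in> {z. norm z = 1}" using nz[of t] by (simp add: z f_def norm_divide)
  qed
  ultimately show ?thesis by (rule infinite_super[rotated])
qed

text \<open>With \<open>z = \<omega> v\<close>, \<open>v\<close> real and \<open>\<omega>\<close> on the unit circle, the monomials in \<open>z\<close> and its conjugate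
become monomials in \<open>\<omega>\<close> and \<open>v\<close>, up to the common factor \<open>\<omega>\<^sup>N\<close>.\<close>

lemma test_set_totally_real: "test_set {x :: 4 \<Rightarrow> complex. x 2 = cnj (x 0) \<and> x 3 \<in> \<real>}"
  unfolding test_set_def
proof (intro allI impI)
  fix N and d :: "(4 \<Rightarrow> nat) \<Rightarrow> complex" and m :: "4 \<Rightarrow> nat"
  assume *: "\<forall>x\<in>{x :: 4 \<Rightarrow> complex. x 2 = cnj (x 0) \<and> x 3 \<in> \<real>}.
      (\<Sum>m | mdeg m = N. d m * (\<Prod>v\<in>UNIV. x v ^ m v)) = 0"
    and m: "mdeg m = N"
  define D where "D = {m::4\<Rightarrow>nat. mdeg m = N}"
  \<comment> \<open>Exponents after the substitution: that of \<open>\<omega>\<close> is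
    \<open>m 0 - m 2\<close>, shifted by \<open>N\<close> to remain a natural number, and that of
    \<open>v\<close> is \<open>m 0 + m 2\<close>. They are stored at the indices 0 and 2.\<close>
  define \<psi> where "\<psi> = (\<lambda>m::4\<Rightarrow>nat. quad (N + m 0 - m 2) (m 1) (m 0 + m 2) (m 3))"
  have le: "m 2 \<le> N" if "m \<in> D" for m using that by (auto simp: D_def mdeg_def sum_4')
  have inj: "inj_on \<psi> D"
  proof (rule inj_onI)
    fix a b assume ab: "a \<in> D" "b \<in> D" "\<psi> a = \<psi> b"
    then have "\<psi> a 0 = \<psi> b 0" "\<psi> a 1 = \<psi> b 1" "\<psi> a 2 = \<psi> b 2" "\<psi> a 3 = \<psi> b 3" by simp_all
    then have "a 0 = b 0" "a 1 = b 1" "a 2 = b 2" "a 3 = b 3"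
      using le[OF ab(1)] le[OF ab(2)] by (auto simp: \<psi>_def)
    then show "a = b" by (simp add: fun_eq_iff all_4)
  qed
  define A :: "4 \<Rightarrow> complex set" where "A = quad {z. norm z = 1} UNIV \<real> \<real>"
  have infR: "infinite (\<real> :: complex set)"
  proof -
    have "infinite (range (of_real :: real \<Rightarrow> complex))"
      by (simp add: finite_image_iff infinite_UNIV_char_0 inj_on_def)
    then show ?thesis by (simp add: Reals_def)
  qed
  have "d (inv_into D \<psi> (\<psi> m)) = 0"
  proof (rule sum_monomials_eq_0D[of UNIV "\<psi> ` D" A "\<lambda>m. d (inv_into D \<psi> m)"])
    show "infinite (A v)" for v
    proof -
      have "\<forall>v. infinite (A v)" unfolding all_4
        using infinite_unit_circle infR by (simp add: A_def infinite_UNIV_char_0)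
      then show ?thesis by blast
    qed
    fix y assume "\<And>v. y v \<in> A v"
    then have "y 0 \<in> A 0" "y 2 \<in> A 2" "y 3 \<in> A 3" by blast+
    then have y: "norm (y 0) = 1" "y 2 \<in> \<real>" "y 3 \<in> \<real>" by (simp_all add: A_def)
    define x where "x = quad (y 0 * y 2) (y 1) (cnj (y 0) * y 2) (y 3)"
    have yy: "y 0 * cnj (y 0) = 1" using complex_norm_square[of "y 0"] y(1) by simp
    have x0: "(\<Sum>m\<in>D. d m * (\<Prod>v\<in>UNIV. x v ^ m v)) = 0"
      unfolding D_def using y by (intro bspec[OF *]) (simp add: x_def Reals_cnj_iff)
    have mon: "(\<Prod>v\<in>UNIV. y v ^ \<psi> m v) = y 0 ^ N * (\<Prod>v\<in>UNIV. x v ^ m v)" if "m \<in> D" for m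
    proof -
      have "y 0 ^ (N + m 0 - m 2) = y 0 ^ (N + m 0 - m 2) * (y 0 * cnj (y 0)) ^ m 2" using yy by simp
      also have "\<dots> = y 0 ^ (N + m 0 - m 2 + m 2) * cnj (y 0) ^ m 2"
        by (simp add: power_mult_distrib power_add mult_ac)
      also have "N + m 0 - m 2 + m 2 = N + m 0" using le[OF that] by simp
      finally show ?thesis
        by (simp add: prod_4' \<psi>_def x_def power_mult_distrib power_add mult_ac)
    qed
    have "(\<Sum>m\<in>\<psi> ` D. d (inv_into D \<psi> m) * (\<Prod>v\<in>UNIV. y v ^ m v)) = (\<Sum>m\<in>D. d m * (\<Prod>v\<in>UNIV. y v ^ \<psi> m v))"
      by (subst sum.reindex[OF inj]) (auto simp: inv_into_f_f[OF inj])
    also have "\<dots> = (\<Sum>m\<in>D. y 0 ^ N * (d m * (\<Prod>v\<in>UNIV. x v ^ m v)))"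
      by (intro sum.cong) (auto simp: mon)
    also have "\<dots> = 0" using x0 by (simp flip: sum_distrib_left)
    finally show "(\<Sum>m\<in>\<psi> ` D. d (inv_into D \<psi> m) * (\<Prod>v\<in>UNIV. y v ^ m v)) = 0" .
  qed (use m in \<open>auto simp: D_def fun_eq_iff\<close>)
  then show "d m = 0" using m inv_into_f_f[OF inj] by (simp add: D_def)
qed

lemma along_cnj: "along (\<lambda>v. fps_cnj (c v)) (\<lambda>m. cnj (f m)) = fps_cnj (along c f)"
proof (rule fps_ext)
  fix n
  have pw: "fps_cnj (a ^ k) = fps_cnj a ^ k" for a k by (induction k) (auto simp: fps_cnj_mult)
  have pr: "fps_cnj (\<Prod>i\<in>A. g i) = (\<Prod>i\<in>A. fps_cnj (g i))" for g :: "'a \<Rightarrow> complex fps" and A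
    by (induction A rule: infinite_finite_induct) (auto simp: fps_cnj_mult)
  have "curve_monom (\<lambda>v. fps_cnj (c v)) m = fps_cnj (curve_monom c m)" for m
    by (simp add: curve_monom_def pw pr)
  then show "along (\<lambda>v. fps_cnj (c v)) (\<lambda>m. cnj (f m)) $ n = fps_cnj (along c f) $ n"
    by (simp add: along_nth)
qed

abbreviation pullback :: "(2 \<Rightarrow> 2 mps) \<Rightarrow> 4 \<Rightarrow> 4 mps" where
  "pullback H \<equiv> \<lambda>v. if v = 0 then hol_emb (H 0) else if v = 1 then hol_emb (H 1)
             else if v = 2 then ahol_emb (H 0) else ahol_emb (H 1)"

lemma along_pullback_rho:
  assumes c: "\<And>v. c v $ 0 = 0" and H: "\<And>i. H i (\<lambda>_. 0) = 0"
  defines "a \<equiv> pair2 (c 0) (c 1)" and "b \<equiv> pair2 (c 2) (c 3)"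
  shows "along c (mpsubst4 rho_ser (pullback H)) =
     fps_const (1 / (2 * \<i>)) * (along a (H 1) - along b (\<lambda>m. cnj (H 1 m)))
     - fps_const (1/2) * ((along a (H 1) + along b (\<lambda>m. cnj (H 1 m))) * (phi_fps oo (along a (H 0) * along b (\<lambda>m. cnj (H 0 m)))))"
proof -
  have p0: "pullback H v (\<lambda>_. 0) = 0" for v
    using H by (auto simp: hol_emb_def ahol_emb_def)
  have "along c (mpsubst4 rho_ser (pullback H)) = along (\<lambda>v. along c (pullback H v)) rho_ser"
    by (rule along_subst4) (use c p0 in auto)
  also have "\<dots> = fps_const (1 / (2 * \<i>)) * (along c (pullback H 1) - along c (pullback H 3))
     - fps_const (1/2) * ((along c (pullback H 1) + along c (pullback H 3)) * (phi_fps oo (along c (pullback H 0) * along c (pullback H 2))))"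
    by (rule along_rho) (simp only: along_nth_0 p0)
  finally show ?thesis by (simp add: along_hol_emb along_ahol_emb a_def b_def)
qed

section \<open>The stability group\<close>

lemma expands_represented:
  assumes H: "represents H F"
    and z: "expands zc Z" "Z $ 0 = 0" and w: "expands wc W" "W $ 0 = 0"
  shows "expands (\<lambda>s. fst (F (zc s, wc s))) (along (pair2 Z W) (H 0))"
    "expands (\<lambda>s. snd (F (zc s, wc s))) (along (pair2 Z W) (H 1))"
proof -
  obtain \<delta> where \<delta>: "\<delta> > 0" "\<And>z w. norm z < \<delta> \<Longrightarrow> norm w < \<delta> \<Longrightarrow>
        F (z, w) = (mp_eval (H 0) (pt2 z w), mp_eval (H 1) (pt2 z w))"
    using H unfolding represents_def by blast
  have "\<forall>\<^sub>F s in at_right 0. dist (zc s) 0 < \<delta>" "\<forall>\<^sub>F s in at_right 0. dist (wc s) 0 < \<delta>"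
    using order_ge_1_imp_tendsto[OF expands_order_ge_1[OF z]] order_ge_1_imp_tendsto[OF expands_order_ge_1[OF w]] \<delta>(1)
    by (auto dest: tendstoD)
  then have ev: "\<forall>\<^sub>F s in at_right 0. F (zc s, wc s) = (mp_eval (H 0) (pt2 (zc s) (wc s)), mp_eval (H 1) (pt2 (zc s) (wc s)))"
    by eventually_elim (simp add: \<delta>(2))
  have pt: "pt2 (zc s) (wc s) = (\<lambda>v. pair2 zc wc v s)" for s
    by (auto simp: pt2_def pair2_def)
  have c: "expands (\<lambda>s. pair2 zc wc v s) (pair2 Z W v)" and C0: "pair2 Z W v $ 0 = 0" for v
    using z w by (auto simp: pair2_def)
  have conv: "mp_converges (H i)" for i using H by (simp add: represents_def)
  have "expands (\<lambda>s. mp_eval (H i) (\<lambda>v. pair2 zc wc v s)) (along (pair2 Z W) (H i))" for i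
    by (rule expands_mp_eval[OF conv c C0])
  then show "expands (\<lambda>s. fst (F (zc s, wc s))) (along (pair2 Z W) (H 0))"
    "expands (\<lambda>s. snd (F (zc s, wc s))) (along (pair2 Z W) (H 1))"
    by (rule expands_cong[rotated], use ev in \<open>eventually_elim, simp add: pt\<close>)+
qed

lemma along_line_nth_1:
  "along (pair2 (fps_const x * fps_X) (fps_const u * fps_X)) f $ 1 = f (unitidx 0) * x + f (unitidx 1) * u"
proof -
  have idx: "unitidx 0 = pair2 1 0" "unitidx 1 = pair2 0 1"
    by (auto simp: fun_eq_iff all_2 unitidx_def)
  have "along (pair2 (fps_const x * fps_X) (fps_const u * fps_X)) f $ 1
     = (\<Sum>k\<le>Suc 0. ((nest2 f $ k oo (fps_const x * fps_X)) * (fps_const u * fps_X) ^ k) $ Suc 0)"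
    by (simp add: along_pair2 along2_nth)
  also have "\<dots> = f (unitidx 0) * x + f (unitidx 1) * u"
    by (simp add: fps_compose_nth nest2_nth idx fps_mult_nth)
  finally show ?thesis .
qed

text \<open>An expansion without terms of order 0 and 1 gives \<open>h = O(s\<^sup>2)\<close>,
  whereas differentiability gives \<open>h s = s d + o(s)\<close>; the two are compared after
  division by \<open>s\<close>.\<close>

lemma derivative_zero_of_order_2:
  fixes h :: "real \<Rightarrow> complex"
  assumes d: "(h has_derivative (\<lambda>s. s *\<^sub>R d)) (at 0)" and h0: "h 0 = 0"
    and expands: "expands h Q" "Q $ 0 = 0" "Q $ 1 = 0"
  shows "d = 0"
proof -
  obtain q where q: "\<And>n. n \<le> 1 \<Longrightarrow> coeff q n = Q $ n" "order_ge (\<lambda>s. h s - poly q (of_real s)) (Suc 1)"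
    using expandsE[OF expands(1)] by metis
  obtain a b q' where q': "q = pCons a (pCons b q')" by (metis pCons_cases)
  have "a = 0" "b = 0" using q(1)[of 0] q(1)[of 1] expands by (auto simp: q')
  have "order_ge (\<lambda>s. of_real s ^ 2 * poly q' (of_real s)) (2 + 0)"
    by (rule order_ge_mult[OF order_ge_power order_ge_poly_0])
  then have "order_ge (\<lambda>s. poly q (of_real s)) 2"
    by (simp add: q' \<open>a = 0\<close> \<open>b = 0\<close> power2_eq_square mult.assoc)
  moreover have "order_ge (\<lambda>s. h s - poly q (of_real s)) 2" using q(2) by (simp add: numeral_2_eq_2)
  ultimately have "order_ge (\<lambda>s. h s - poly q (of_real s) + poly q (of_real s)) 2"
    by (intro order_ge_add)
  then have "order_ge h 2" by simp
  then obtain K where K: "\<forall>\<^sub>F s in at_right 0. norm (h s) \<le> K * s ^ 2"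
    unfolding order_ge_def by blast
  have "((\<lambda>s. norm ((h s - h 0) - (s - 0) *\<^sub>R d) / norm (s - 0)) \<longlongrightarrow> 0) (at 0)"
    using d[unfolded has_derivative_iff_norm] by (rule conjunct2)
  then have "((\<lambda>s. norm ((h s - h 0) - (s - 0) *\<^sub>R d) / norm (s - 0)) \<longlongrightarrow> 0) (at_right 0)"
    by (rule tendsto_mono[rotated]) (rule at_le, simp)
  then have "((\<lambda>s. norm (h s - s *\<^sub>R d) / norm s) \<longlongrightarrow> 0) (at_right 0)"
    by (simp only: h0 diff_0_right)
  then have "((\<lambda>s. norm (h s - s *\<^sub>R d) / norm s + K * s) \<longlongrightarrow> 0 + K * 0) (at_right 0)"
    by (intro tendsto_intros)
  moreover have "\<forall>\<^sub>F s in at_right 0. norm d \<le> norm (h s - s *\<^sub>R d) / norm s + K * s"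
    using K eventually_small
  proof eventually_elim
    case (elim s)
    have "s * norm d = norm (s *\<^sub>R d)" using elim by simp
    also have "\<dots> \<le> norm (h s - s *\<^sub>R d) + norm (h s)"
      by (metis norm_minus_commute norm_triangle_sub add.commute)
    also have "\<dots> \<le> norm (h s - s *\<^sub>R d) + K * s\<^sup>2" using elim by simp
    finally show ?case using elim by (simp add: field_simps power2_eq_square)
  qed
  ultimately have "norm d \<le> 0 + K * 0"
    by (intro tendsto_lowerbound[of _ _ "at_right 0"]) auto
  then show ?thesis by simp
qed

text \<open>The determinant concerns coefficients of \<open>H\<close>, invertibility the derivative
  of \<open>F\<close>. They meet on the real line through a kernel vector \<open>(x, u)\<close>:
  vanishing first-order coefficients there make the derivative of \<open>F\<close> vanish on
  \<open>(x, u)\<close>, against the chain rule for the inverse.\<close>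

lemma Aut_jacobian:
  assumes F0: "F (0, 0) = (0, 0)" and U: "open U" "(0, 0) \<in> U" "cholo F U" "inj_on F U"
    "cholo (inv_into U F) (F ` U)" and H: "represents H F" and H0: "\<And>i. H i (\<lambda>_. 0) = 0"
  shows "H 0 (unitidx 0) * H 1 (unitidx 1) - H 0 (unitidx 1) * H 1 (unitidx 0) \<noteq> 0"
proof
  define a b c d where abcd: "a = H 0 (unitidx 0)" "b = H 0 (unitidx 1)" "c = H 1 (unitidx 0)" "d = H 1 (unitidx 1)"
  assume "H 0 (unitidx 0) * H 1 (unitidx 1) - H 0 (unitidx 1) * H 1 (unitidx 0) = 0"
  then have det: "a * d = b * c" by (simp add: abcd)
  have "\<exists>x u. (x, u) \<noteq> (0, 0) \<and> a * x + b * u = 0 \<and> c * x + d * u = 0"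
  proof (cases "a = 0 \<and> b = 0")
    case True
    then show ?thesis
      by (cases "c = 0 \<and> d = 0", intro exI[of _ 1] exI[of _ 0], simp,
          intro exI[of _ d] exI[of _ "- c"], auto)
  next
    case False
    then show ?thesis using det by (intro exI[of _ b] exI[of _ "- a"]) (auto simp: mult.commute)
  qed
  then obtain x u where xu: "(x, u) \<noteq> (0, 0)" "a * x + b * u = 0" "c * x + d * u = 0" by blast
  obtain L where L: "(F has_derivative L) (at (0, 0))"
    using U unfolding cholo_def by blast
  have "(0, 0) \<in> F ` U" using F0 U(2) by (metis imageI)
  then obtain L' where L': "(inv_into U F has_derivative L') (at (0, 0))"
    using U(5) unfolding cholo_def by blast
  have "(inv_into U F \<circ> F has_derivative L' \<circ> L) (at (0, 0))"
    using diff_chain_at[OF L] L' F0 by simp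
  then have "((\<lambda>p. p) has_derivative L' \<circ> L) (at (0, 0))"
    by (rule has_derivative_transform_within_open[OF _ U(1,2)]) (use U(4) in simp)
  then have "L' \<circ> L = (\<lambda>p. p)" by (rule has_derivative_unique) (rule has_derivative_ident)
  then have inj: "L v = 0 \<Longrightarrow> v = 0" for v
    using has_derivative_linear[OF L'] linear_0 by (metis comp_apply)
  have line: "((\<lambda>s::real. (of_real s * x, of_real s * u)) has_derivative (\<lambda>s. s *\<^sub>R (x, u))) (at 0)"
    by (auto intro!: derivative_eq_intros simp: scaleR_conv_of_real)
  have "((\<lambda>s::real. F (of_real s * x, of_real s * u)) has_derivative (\<lambda>s. L (s *\<^sub>R (x, u)))) (at 0)"
    using has_derivative_compose[OF line, of F L] L by (simp add: zero_prod_def)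
  then have D: "((\<lambda>s::real. F (of_real s * x, of_real s * u)) has_derivative (\<lambda>s. s *\<^sub>R L (x, u))) (at 0)"
    unfolding linear_cmul[OF has_derivative_linear[OF L]] .
  have A: "expands (\<lambda>s. of_real s * y) (fps_const y * fps_X)" for y
    using expands_mult[OF expands_X expands_const[of y]] by (simp add: mult.commute)
  let ?Q = "\<lambda>i. along (pair2 (fps_const x * fps_X) (fps_const u * fps_X)) (H i)"
  have Q: "?Q i $ 0 = 0" for i by (simp add: along_nth_0 H0)
  have Q1: "?Q 0 $ 1 = 0" "?Q 1 $ 1 = 0"
    unfolding along_line_nth_1 using xu by (simp_all add: abcd)
  have "fst (L (x, u)) = 0"
  proof (rule derivative_zero_of_order_2[OF _ _ expands_represented(1)[OF H A _ A] Q Q1(1)])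
    show "((\<lambda>s::real. fst (F (of_real s * x, of_real s * u))) has_derivative (\<lambda>s. s *\<^sub>R fst (L (x, u)))) (at 0)"
      using has_derivative_fst[OF D] by simp
  qed (use F0 in auto)
  moreover have "snd (L (x, u)) = 0"
  proof (rule derivative_zero_of_order_2[OF _ _ expands_represented(2)[OF H A _ A] Q Q1(2)])
    show "((\<lambda>s::real. snd (F (of_real s * x, of_real s * u))) has_derivative (\<lambda>s. s *\<^sub>R snd (L (x, u)))) (at 0)"
      using has_derivative_snd[OF D] by simp
  qed (use F0 in auto)
  ultimately have "L (x, u) = 0" by (simp add: prod_eq_iff)
  then have "(x, u) = 0" by (rule inj)
  then show False using xu(1) by (simp add: zero_prod_def)
qed

text \<open>Along \<open>z = a s\<close> the argument \<open>z * cnj z\<close> is real, so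
  \<open>phi_cx\<close> there is the real \<open>phi\<close>; uniqueness of expansions then makes
  the coefficients of \<open>P\<close> real.\<close>

lemma real_phi_curve:
  fixes a :: complex
  defines "P \<equiv> phi_fps oo ((fps_const a * fps_X) * (fps_const (cnj a) * fps_X))"
    and "p \<equiv> \<lambda>s::real. phi_cx ((a * of_real s) * (cnj a * of_real s))"
  shows "expands p P" "fps_cnj P = P" "\<forall>\<^sub>F s in at_right 0. norm (a * of_real s) < 1"
    "\<forall>\<^sub>F s in at_right 0. p s = of_real (phi ((norm (a * of_real s))\<^sup>2))"
proof -
  have A: "expands (\<lambda>s. y * of_real s) (fps_const y * fps_X)" for y
    by (rule expands_mult[OF expands_const expands_X])
  show expands: "expands p P" unfolding p_def P_def
    by (rule expands_compose[OF phi_fps_expansion expands_mult[OF A A]]) simp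
  have "\<forall>\<^sub>F s in at_right 0. dist (a * of_real s) 0 < 1"
    using order_ge_1_imp_tendsto[OF expands_order_ge_1[OF A[of a]]] by (intro tendstoD) auto
  then show small: "\<forall>\<^sub>F s in at_right 0. norm (a * of_real s) < 1" by simp
  show real: "\<forall>\<^sub>F s in at_right 0. p s = of_real (phi ((norm (a * of_real s))\<^sup>2))"
    using small
  proof eventually_elim
    case (elim s)
    have "(a * of_real s) * (cnj a * of_real s) = of_real ((norm (a * of_real s))\<^sup>2)"
      unfolding complex_norm_square by simp
    moreover have "\<bar>(norm (a * of_real s))\<^sup>2\<bar> < 1" using elim by (simp add: power_less_one_iff)
    ultimately show ?case unfolding p_def by (simp only: of_real_phi)
  qed
  have "\<forall>\<^sub>F s in at_right 0. cnj (p s) = p s" using real by eventually_elim simp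
  from expands_cong[OF this expands_cnj[OF expands]] expands show "fps_cnj P = P" by (rule expands_unique)
qed

text \<open>\<open>F\<close> maps real curves in \<open>M\<close> into \<open>M\<close>, so the
  defining function composed with \<open>F\<close> vanishes along them as a function of the real
  parameter, and hence as a series. Such curves run in enough directions for the division
  criterion.\<close>

lemma Aut_imp_formal_aut:
  assumes F: "F \<in> Aut_M0" and H: "represents H F"
  shows "formal_aut H"
proof -
  obtain U where F0: "F (0, 0) = (0, 0)" and U: "open U" "(0, 0) \<in> U" "cholo F U" "inj_on F U"
    "cholo (inv_into U F) (F ` U)" and FM: "\<And>p. p \<in> M \<inter> U \<Longrightarrow> F p \<in> M"
    using F unfolding Aut_M0_def by blast
  have H0: "H i (\<lambda>_. 0) = 0" for i
  proof -
    \<comment> \<open>The constant curve at the origin reads off the constant terms.\<close>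
    have "expands (\<lambda>s. fst (F (0, 0))) (along (pair2 0 0) (H 0))" "expands (\<lambda>s. snd (F (0, 0))) (along (pair2 0 0) (H 1))"
      by (rule expands_represented[OF H expands_0 _ expands_0]; simp)+
    then have "along (pair2 0 0) (H 0) = 0" "along (pair2 0 0) (H 1) = 0"
      using expands_unique[OF _ expands_0] F0 by auto
    then have "H 0 (\<lambda>_. 0) = 0 \<and> H 1 (\<lambda>_. 0) = 0"
      by (metis along_nth_0 fps_zero_nth)
    then have "\<forall>i. H i (\<lambda>_. 0) = 0" unfolding all_2 .
    then show ?thesis ..
  qed
  have "\<exists>a. mpsubst4 rho_ser (pullback H) = mpmult a rho_ser"
  proof (rule divisible_by_rho[OF test_set_totally_real])
    fix x :: "4 \<Rightarrow> complex" assume x: "x \<in> {x. x 2 = cnj (x 0) \<and> x 3 \<in> \<real>}"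
    define a where "a = x 0"
    obtain u where u: "x 3 = of_real u" using x by (auto elim: Reals_cases)
    define P where "P = phi_fps oo ((fps_const a * fps_X) * (fps_const (cnj a) * fps_X))"
    define p where "p = (\<lambda>s::real. phi_cx ((a * of_real s) * (cnj a * of_real s)))"
    note phi = real_phi_curve[of a, folded P_def p_def]
    have p_real: "\<forall>\<^sub>F s in at_right 0. p s = of_real (phi ((norm (a * of_real s))\<^sup>2))"
      using phi(4) unfolding p_def .
    define Z where "Z = fps_const a * fps_X"
    \<comment> \<open>The curve in \<open>M\<close> with \<open>Re w = u * s\<close>, which requires
      \<open>u\<close> to be real. As \<open>P\<close> has no constant term, the conjugate series
      also has leading coefficient \<open>u\<close>, the prescribed entry \<open>x 3\<close>; the
      entry \<open>x 1\<close> is left unmatched.\<close>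
    define W where "W = fps_const (of_real u) * fps_X * (1 + fps_const \<i> * P)"
    define zc where "zc = (\<lambda>s::real. a * of_real s)"
    define wc where "wc = (\<lambda>s::real. of_real u * of_real s * (1 + \<i> * p s))"
    have Z: "expands zc Z" "Z $ 0 = 0" unfolding zc_def Z_def by (auto intro: expands_mult expands_const expands_X)
    have W: "expands wc W" "W $ 0 = 0" unfolding wc_def W_def
      by (auto intro!: expands_mult expands_add expands_1 expands_const expands_X phi(1))
    have fZ: "fps_cnj Z = fps_const (cnj a) * fps_X" by (simp add: Z_def fps_cnj_mult)
    have fW: "fps_cnj W = fps_const (of_real u) * fps_X * (1 - fps_const \<i> * P)"
    proof -
      have "fps_cnj (1 + fps_const \<i> * P) = 1 + fps_const (- \<i>) * fps_cnj P"
        by (rule fps_ext) (simp add: fps_one_def)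
      then show ?thesis by (simp add: W_def fps_cnj_mult phi(2) flip: fps_const_neg)
    qed
    define c where "c = quad Z W (fps_cnj Z) (fps_cnj W)"
    have c0: "c v $ 0 = 0" for v
    proof -
      have "\<forall>v. c v $ 0 = 0" unfolding all_4 by (simp add: c_def Z W)
      then show ?thesis ..
    qed
    have P0: "P $ 0 = 0" by (simp add: P_def)
    have c1: "\<forall>v. v \<noteq> 1 \<longrightarrow> c v $ 1 = x v"
      unfolding all_4 using x by (simp add: c_def fZ fW, simp add: Z_def a_def u P0 mult.assoc)
    have rho0: "along c rho_ser = 0"
    proof -
      have "along c rho_ser = fps_const (1 / (2 * \<i>)) * (W - fps_cnj W) - fps_const (1/2) * ((W + fps_cnj W) * P)"
        by (subst along_rho[OF c0]) (simp add: c_def fZ, simp add: Z_def P_def)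
      also have "W - fps_cnj W = fps_const (2 * \<i>) * (fps_const (of_real u) * fps_X * P)"
      proof -
        have "k * (1 + I * P) - k * (1 - I * P) = (2 * I) * (k * P)" for k I :: "complex fps"
          by (simp add: algebra_simps)
        moreover have "2 * fps_const \<i> = fps_const (2 * \<i>)" by (simp add: numeral_fps_const)
        ultimately show ?thesis unfolding fW unfolding W_def by metis
      qed
      also have "W + fps_cnj W = fps_const 2 * (fps_const (of_real u) * fps_X)"
      proof -
        have "k * (1 + I * P) + k * (1 - I * P) = 2 * k" for k I :: "complex fps"
          by (simp add: algebra_simps)
        moreover have "2 * f = fps_const 2 * f" for f :: "complex fps" by (simp add: numeral_fps_const)
        ultimately show ?thesis unfolding fW unfolding W_def by metis
      qed
      finally show ?thesis by (simp add: mult.assoc flip: mult.assoc[of "fps_const _" "fps_const _"])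
    qed
    define G where "G = along (pair2 Z W) (H 1)"
    define A where "A = along (pair2 Z W) (H 0)"
    have conj: "along (pair2 (fps_cnj Z) (fps_cnj W)) (\<lambda>m. cnj (f m)) = fps_cnj (along (pair2 Z W) f)" for f
    proof -
      have "pair2 (fps_cnj Z) (fps_cnj W) = (\<lambda>v. fps_cnj (pair2 Z W v))" by (auto simp: pair2_def)
      then show ?thesis by (simp add: along_cnj)
    qed
    have S: "along c (mpsubst4 rho_ser (pullback H)) = fps_const (1 / (2 * \<i>)) * (G - fps_cnj G)
       - fps_const (1/2) * ((G + fps_cnj G) * (phi_fps oo (A * fps_cnj A)))"
      by (subst along_pullback_rho[where H = H and c = c, OF c0 H0]) (simp add: c_def conj G_def A_def)
    define gf where "gf = (\<lambda>s. snd (F (zc s, wc s)))"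
    define af where "af = (\<lambda>s. fst (F (zc s, wc s)))"
    have G: "expands gf G" and A: "expands af A"
      unfolding gf_def af_def G_def A_def by (rule expands_represented[OF H Z W])+
    have A0: "(A * fps_cnj A) $ 0 = 0" by (simp add: A_def along_nth_0 H0)
    have "expands (\<lambda>s. 1 / (2 * \<i>) * (gf s - cnj (gf s)) - 1/2 * ((gf s + cnj (gf s)) * phi_cx (af s * cnj (af s))))
      (along c (mpsubst4 rho_ser (pullback H)))"
      unfolding S
      by (intro expands_diff expands_mult expands_const expands_add expands_cnj G expands_compose[OF phi_fps_expansion expands_mult[OF A expands_cnj[OF A]] A0])
    moreover have "\<forall>\<^sub>F s in at_right 0. 1 / (2 * \<i>) * (gf s - cnj (gf s)) - 1/2 * ((gf s + cnj (gf s)) * phi_cx (af s * cnj (af s))) = 0"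
    proof -
      have "((\<lambda>s. (zc s, wc s)) \<longlongrightarrow> (0, 0)) (at_right 0)"
        using order_ge_1_imp_tendsto[OF expands_order_ge_1[OF Z]] order_ge_1_imp_tendsto[OF expands_order_ge_1[OF W]]
        by (rule tendsto_Pair)
      then have "\<forall>\<^sub>F s in at_right 0. (zc s, wc s) \<in> U"
        using U(1,2) by (rule topological_tendstoD)
      then show ?thesis using phi(3) p_real
      proof eventually_elim
        case (elim s)
        have "(zc s, wc s) \<in> M"
          unfolding M_iff_phi using elim by (simp add: zc_def wc_def)
        then have "F (zc s, wc s) \<in> M" using FM elim by blast
        then have "(af s, gf s) \<in> M" by (simp add: af_def gf_def)
        then have m: "norm (af s) < 1" "Im (gf s) = Re (gf s) * phi ((norm (af s))\<^sup>2)"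
          by (simp_all add: M_iff_phi)
        have "\<bar>(norm (af s))\<^sup>2\<bar> < 1" using m(1) by (simp add: power_less_one_iff)
        from of_real_phi[OF this] have ph: "phi_cx (af s * cnj (af s)) = of_real (phi ((norm (af s))\<^sup>2))"
          unfolding complex_norm_square by simp
        have 1: "1 / (2 * \<i>) * (g - cnj g) = of_real (Im g)" "g + cnj g = of_real (2 * Re g)" for g
          by (simp_all add: complex_eq_iff)
        show ?case unfolding ph 1 m(2) by simp
      qed
    qed
    ultimately have "expands (\<lambda>_. 0) (along c (mpsubst4 rho_ser (pullback H)))"
      by (rule expands_cong[rotated])
    then have "along c (mpsubst4 rho_ser (pullback H)) = 0" using expands_0 by (rule expands_unique)
    then show "\<exists>c. (\<forall>v. c v $ 0 = 0) \<and> (\<forall>v. v \<noteq> 1 \<longrightarrow> c v $ 1 = x v) \<and>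
       along c (mpsubst4 rho_ser (pullback H)) = 0 \<and> along c rho_ser = 0"
      using c0 c1 rho0 by blast
  qed
  then show ?thesis
    unfolding formal_aut_def using H0 Aut_jacobian[OF F0 U H H0] by blast
qed


text \<open>Eliminates \<open>phi\<close>: the relation \<open>g - g' = \<i> (g + g') p\<close> is
  multiplied by \<open>g + g'\<close>, and \<open>T (1 + p\<^sup>2) = 2 p\<close> turns it into the
  quadratic equation, up to the unit \<open>1 + p\<^sup>2\<close>, which cancels in a
  domain.\<close>

lemma rho_vanishing_imp_squared:
  fixes g g' T :: "complex fps"
  assumes S: "fps_const (1 / (2 * \<i>)) * (g - g') - fps_const (1/2) * ((g + g') * (phi_fps oo T)) = 0"
    and T: "T $ 0 = 0"
  shows "g\<^sup>2 - g'\<^sup>2 = fps_const (2 * \<i>) * T * (g * g')"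
proof -
  define p where "p = phi_fps oo T"
  define I where "I = fps_const \<i>"
  have I2: "I * I = -1" unfolding I_def by (rule fps_const_i_square)
  have two: "fps_const (2 * \<i>) = 2 * I" by (simp add: I_def numeral_fps_const)
  have "fps_const (2 * \<i>) * fps_const (1 / (2 * \<i>)) = 1" "fps_const (2 * \<i>) * fps_const (1/2) = I"
    by (simp_all add: I_def)
  moreover have "fps_const (2 * \<i>) * (fps_const (1 / (2 * \<i>)) * (g - g') - fps_const (1/2) * ((g + g') * p))
     = (fps_const (2 * \<i>) * fps_const (1 / (2 * \<i>))) * (g - g') - (fps_const (2 * \<i>) * fps_const (1/2)) * ((g + g') * p)"
    by (simp only: right_diff_distrib mult.assoc)
  ultimately have d: "g - g' = I * ((g + g') * p)"
    using S by (simp add: p_def)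
  have Tp: "T * (1 + p\<^sup>2) = 2 * p"
  proof -
    have "(fps_X * (1 + phi_fps\<^sup>2)) oo T = (2 * phi_fps) oo T" by (simp only: phi_fps_equation)
    then have "T * (1 + p\<^sup>2) = (fps_const 2 oo T) * p"
      unfolding numeral_fps_const[symmetric]
      by (simp add: fps_compose_mult_distrib[OF T] fps_compose_add_distrib fps_compose_power[OF T] T p_def)
    then show ?thesis by (simp add: numeral_fps_const)
  qed
  have "(g - g')\<^sup>2 = (I * I) * ((g + g')\<^sup>2 * p\<^sup>2)"
    unfolding d by (simp add: power2_eq_square mult_ac)
  then have "(1 + p\<^sup>2) * (g + g')\<^sup>2 = (g + g')\<^sup>2 - (g - g')\<^sup>2"
    unfolding I2 by (simp add: algebra_simps)
  also have "\<dots> = 4 * (g * g')" by (simp add: power2_eq_square algebra_simps)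
  finally have s: "(1 + p\<^sup>2) * (g + g')\<^sup>2 = 4 * (g * g')" .
  have "(1 + p\<^sup>2) * (g\<^sup>2 - g'\<^sup>2) = (1 + p\<^sup>2) * ((g - g') * (g + g'))"
    by (simp add: power2_eq_square algebra_simps)
  also have "\<dots> = I * p * ((1 + p\<^sup>2) * (g + g')\<^sup>2)"
    unfolding d by (simp add: power2_eq_square mult_ac)
  also have "\<dots> = 2 * I * (2 * p) * (g * g')" unfolding s by (simp add: mult_ac)
  also have "\<dots> = (1 + p\<^sup>2) * (2 * I * T * (g * g'))" unfolding Tp[symmetric] by (simp only: mult_ac)
  finally have "(1 + p\<^sup>2) * (g\<^sup>2 - g'\<^sup>2) = (1 + p\<^sup>2) * (2 * I * T * (g * g'))" .
  moreover have "1 + p\<^sup>2 \<noteq> 0"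
  proof
    assume "1 + p\<^sup>2 = 0"
    then have "(1 + p\<^sup>2) $ 0 = 0" by simp
    then show False by (simp add: p_def power2_eq_square)
  qed
  ultimately show ?thesis by (simp add: two)
qed

lemma along_rho_eq_0:
  assumes c: "\<And>v. c v $ 0 = 0" and "c 1 = c 3 * (E_fps oo (c 0 * c 2))"
  shows "along c rho_ser = 0"
proof -
  have "along c (diag rho_cofactor) * along c rho_ser = 0"
    using assms by (simp add: along_main_divisor flip: along_main_divisor_rho)
  moreover have "along c (diag rho_cofactor) $ 0 \<noteq> 0"
    by (simp add: along_nth_0 diag_def rho_cofactor_def)
  ultimately show ?thesis by (metis fps_zero_nth mult_eq_0_iff)
qed

text \<open>The curve lies in the complexified hypersurface: \<open>z\<close> and \<open>z'\<close>
  are unrelated, only \<open>w\<close> is tied to \<open>w'\<close>. This independence is what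
  allows coefficients in \<open>z\<close> and \<open>z\<^sup>*\<close> to be compared
  separately.\<close>

lemma formal_aut_on_curve:
  assumes H: "formal_aut H"
    and c: "z $ 0 = 0" "w $ 0 = 0" "z' $ 0 = 0" "w' $ 0 = 0" and w: "w = w' * (E_fps oo (z * z'))"
  defines "F \<equiv> nest2 (H 0)" and "G \<equiv> nest2 (H 1)"
  shows "fps_const (1 / (2 * \<i>)) * (along2 z w G - along2 z' w' (nest_cnj G))
     - fps_const (1/2) * ((along2 z w G + along2 z' w' (nest_cnj G)) * (phi_fps oo (along2 z w F * along2 z' w' (nest_cnj F)))) = 0"
proof -
  define c where "c = quad z w z' w'"
  have c0: "c v $ 0 = 0" for v
  proof -
    have "\<forall>v. c v $ 0 = 0" unfolding all_4 using c by (simp add: c_def)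
    then show ?thesis ..
  qed
  obtain a where "mpsubst4 rho_ser (pullback H) = mpmult a rho_ser" and H0: "\<And>i. H i (\<lambda>_. 0) = 0"
    using H unfolding formal_aut_def by blast
  then have "along c (mpsubst4 rho_ser (pullback H)) = along c a * along c rho_ser"
    using along_mult[OF c0] by simp
  also have "along c rho_ser = 0" using w by (intro along_rho_eq_0 c0) (simp add: c_def)
  finally show ?thesis
    by (subst (asm) along_pullback_rho[where H = H and c = c, OF c0 H0])
       (simp add: c_def along_pair2 c nest2_cnj F_def G_def)
qed

lemma along2_w_0: "along2 z 0 G = G $ 0 oo z"
proof (rule fps_ext)
  fix N
  have "along2 z 0 G $ N = (\<Sum>k\<le>N. if k = 0 then (G $ 0 oo z) $ N else 0)"
    unfolding along2_nth by (intro sum.cong) (auto simp: power_0_left)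
  then show "along2 z 0 G $ N = (G $ 0 oo z) $ N" by simp
qed

lemma formal_aut_normal_form:
  assumes H: "formal_aut H"
  defines "F \<equiv> nest2 (H 0)" and "G \<equiv> nest2 (H 1)"
  obtains \<epsilon> \<alpha> :: complex and r s :: real and \<gamma> :: nest where "norm \<epsilon> = 1" "r \<noteq> 0" "G = ww * \<gamma>" "\<gamma> $ 0 $ 0 = of_real r"
    "\<gamma>\<^sup>2 * theta_sq \<alpha> s = cc (of_real (r\<^sup>2))" "cc (of_real r) * F = cc \<epsilon> * (zz + cc \<alpha> * ww) * \<gamma>"
proof -
  have H0: "H i (\<lambda>_. 0) = 0" for i using H by (simp add: formal_aut_def)
  have p00: "pair2 0 0 = (\<lambda>_::2. 0::nat)" by (auto simp: fun_eq_iff all_2)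
  have F00: "F $ 0 $ 0 = 0" and G00: "G $ 0 $ 0 = 0" by (simp_all add: F_def G_def nest2_nth p00 H0)
  \<comment> \<open>For \<open>w = w\<^sup>* = 0\<close> and \<open>z\<^sup>* = 0\<close> the
    equation reduces to \<open>G (z, 0) = 0\<close>.\<close>
  have G0: "G $ 0 = 0"
  proof -
    have "fps_const (1 / (2 * \<i>)) * (along2 fps_X 0 G - along2 0 0 (nest_cnj G))
     - fps_const (1/2) * ((along2 fps_X 0 G + along2 0 0 (nest_cnj G)) * (phi_fps oo (along2 fps_X 0 F * along2 0 0 (nest_cnj F)))) = 0"
      unfolding F_def G_def by (rule formal_aut_on_curve[OF H]) auto
    then show ?thesis by (simp add: along2_w_0 F00 G00)
  qed
  define \<gamma> where "\<gamma> = fps_shift 1 G"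
  have G: "G = ww * \<gamma>"
    by (rule fps_ext) (use G0 in \<open>auto simp: \<gamma>_def fps_X_mult_nth\<close>)
  have idx: "unitidx 0 = pair2 1 0" "unitidx 1 = pair2 0 1"
    by (auto simp: fun_eq_iff all_2 unitidx_def)
  have G01: "H 1 (unitidx 0) = 0" using G0 by (metis G_def idx(1) nest2_nth fps_zero_nth)
  then have "H 1 (unitidx 1) \<noteq> 0" using H by (auto simp: formal_aut_def)
  then have \<gamma>00: "\<gamma> $ 0 $ 0 \<noteq> 0" by (simp add: \<gamma>_def G_def nest2_nth idx)
  \<comment> \<open>By \<open>G01\<close> the Jacobian is a product with the factor
    \<open>H 1 (unitidx 1)\<close>, so \<open>\<gamma> = G / w\<close> has a nonzero constant term.
    Its coefficients form a ring of series, not a field, so the inverse is built from the inverse of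
    \<open>\<gamma> $ 0\<close>.\<close>
  define \<kappa> where "\<kappa> = fps_right_inverse \<gamma> (inverse (\<gamma> $ 0))"
  have "inverse (\<gamma> $ 0) * \<gamma> $ 0 = 1" by (rule inverse_mult_eq_1[OF \<gamma>00])
  then have \<gamma>\<kappa>: "\<gamma> * \<kappa> = 1"
    unfolding \<kappa>_def by (intro fps_right_inverse) (simp add: mult.commute)
  have \<gamma>\<kappa>00: "\<gamma> $ 0 $ 0 * \<kappa> $ 0 $ 0 = 1"
    using arg_cong[OF \<gamma>\<kappa>, of "\<lambda>f. f $ 0 $ 0"] by simp
  define P where "P = \<kappa>\<^sup>2"
  define f where "f = F * \<kappa>"
  have level: "let c = fps_const y * fps_X; t = fps_const u * fps_X; e = E_fps oo (fps_const y * fps_X\<^sup>2) in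
        e\<^sup>2 * along2 c t (nest_cnj P) - along2 fps_X (t * e) P =
        fps_const (2 * \<i>) * e * along2 fps_X (t * e) f * along2 c t (nest_cnj f)" if u: "u \<noteq> 0" for y u
  proof -
    define c where "c = fps_const y * fps_X"
    define t where "t = fps_const u * fps_X"
    define e where "e = E_fps oo (fps_const y * fps_X\<^sup>2)"
    have z: "c $ 0 = 0" "t $ 0 = 0" "(t * e) $ 0 = 0" by (simp_all add: c_def t_def)
    have t0: "t \<noteq> 0" using u by (simp add: t_def)
    define C where "C = along2 fps_X (t * e)"
    define C' where "C' = (\<lambda>A. along2 c t (nest_cnj A))"
    have Cm: "C (A * B) = C A * C B" for A B by (simp add: C_def along2_mult z)
    have C'm: "C' (A * B) = C' A * C' B" for A B by (simp add: C'_def along2_mult z nest_cnj_mult)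
    have CX: "C ww = t * e" "C' ww = t" by (simp_all add: C_def C'_def along2_X z)
    have C1: "C \<gamma> * C \<kappa> = 1" "C' \<gamma> * C' \<kappa> = 1"
      by (simp_all only: \<gamma>\<kappa> Cm[symmetric] C'm[symmetric]) (simp_all add: C_def C'_def)
    have Fc0: "(C F * C' F) $ 0 = 0"
      using F00 by (simp add: C_def along2_nth)
    have "fps_X * c = fps_const y * fps_X\<^sup>2" by (simp add: c_def power2_eq_square mult_ac)
    then have "fps_const (1 / (2 * \<i>)) * (C G - C' G) - fps_const (1/2) * ((C G + C' G) * (phi_fps oo (C F * C' F))) = 0"
      unfolding C_def C'_def F_def G_def
      by (intro formal_aut_on_curve[OF H] z) (simp_all add: e_def)
    from rho_vanishing_imp_squared[OF this Fc0]
    have "(t * e * C \<gamma>)\<^sup>2 - (t * C' \<gamma>)\<^sup>2 = fps_const (2 * \<i>) * (C F * C' F) * ((t * e * C \<gamma>) * (t * C' \<gamma>))"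
      by (simp add: G Cm C'm CX)
    then have "t\<^sup>2 * (e\<^sup>2 * (C \<gamma>)\<^sup>2 - (C' \<gamma>)\<^sup>2) = t\<^sup>2 * (fps_const (2 * \<i>) * e * (C F * C' F) * (C \<gamma> * C' \<gamma>))"
      by (simp add: power_mult_distrib right_diff_distrib power2_eq_square mult_ac)
    then have "e\<^sup>2 * (C \<gamma>)\<^sup>2 - (C' \<gamma>)\<^sup>2 = fps_const (2 * \<i>) * e * (C F * C' F) * (C \<gamma> * C' \<gamma>)"
      using t0 by (simp only: mult_cancel_left) simp
    then have "(e\<^sup>2 * (C \<gamma>)\<^sup>2 - (C' \<gamma>)\<^sup>2) * ((C \<kappa>)\<^sup>2 * (C' \<kappa>)\<^sup>2) =
      fps_const (2 * \<i>) * e * (C F * C' F) * (C \<gamma> * C' \<gamma>) * ((C \<kappa>)\<^sup>2 * (C' \<kappa>)\<^sup>2)" by simp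
    moreover have "(e\<^sup>2 * (C \<gamma>)\<^sup>2 - (C' \<gamma>)\<^sup>2) * ((C \<kappa>)\<^sup>2 * (C' \<kappa>)\<^sup>2) =
      e\<^sup>2 * (C \<gamma> * C \<kappa>)\<^sup>2 * (C' \<kappa>)\<^sup>2 - (C' \<gamma> * C' \<kappa>)\<^sup>2 * (C \<kappa>)\<^sup>2"
      by (simp only: left_diff_distrib right_diff_distrib power2_eq_square mult_ac)
    moreover have "fps_const (2 * \<i>) * e * (C F * C' F) * (C \<gamma> * C' \<gamma>) * ((C \<kappa>)\<^sup>2 * (C' \<kappa>)\<^sup>2) =
      fps_const (2 * \<i>) * e * (C F * C \<kappa>) * (C' F * C' \<kappa>) * ((C \<gamma> * C \<kappa>) * (C' \<gamma> * C' \<kappa>))"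
      by (simp only: power2_eq_square mult_ac)
    ultimately have "e\<^sup>2 * (C \<gamma> * C \<kappa>)\<^sup>2 * (C' \<kappa>)\<^sup>2 - (C' \<gamma> * C' \<kappa>)\<^sup>2 * (C \<kappa>)\<^sup>2 =
      fps_const (2 * \<i>) * e * (C F * C \<kappa>) * (C' F * C' \<kappa>) * ((C \<gamma> * C \<kappa>) * (C' \<gamma> * C' \<kappa>))"
      by metis
    then have "e\<^sup>2 * C' P - C P = fps_const (2 * \<i>) * e * C f * C' f"
      unfolding C1 by (simp add: P_def f_def power2_eq_square Cm C'm)
    then show ?thesis unfolding Let_def C_def C'_def c_def t_def e_def .
  qed
  have f00: "f $ 0 $ 0 = 0" by (simp add: f_def F00)
  have P00: "P $ 0 $ 0 = (\<kappa> $ 0 $ 0)\<^sup>2" by (simp add: P_def power2_eq_square)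
  then have P00n: "P $ 0 $ 0 \<noteq> 0" using \<gamma>\<kappa>00 by auto
  obtain l \<alpha> s where l: "l \<noteq> 0" "P = cc (of_real ((norm l)\<^sup>2)) * theta_sq \<alpha> s" "f = cc l * (zz + cc \<alpha> * ww)"
    using solve_level_equations[OF level_equations f00 P00n] level by metis
  define r where "r = Re (\<gamma> $ 0 $ 0)"
  have "(\<kappa> $ 0 $ 0)\<^sup>2 = of_real ((norm l)\<^sup>2)"
    using P00 unfolding l(2) by (simp add: theta_sq_def power2_eq_square)
  then have "(\<kappa> $ 0 $ 0)\<^sup>2 = (of_real (norm l))\<^sup>2" by simp
  \<comment> \<open>The square of \<open>\<kappa> $ 0 $ 0\<close> is a positive real, so the number
    itself is real but its sign is free; this sign becomes the sign of \<open>r\<close>.\<close>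
  then have "\<kappa> $ 0 $ 0 = of_real (norm l) \<or> \<kappa> $ 0 $ 0 = - of_real (norm l)"
    by (simp only: power2_eq_iff)
  then obtain k :: real where k: "\<kappa> $ 0 $ 0 = of_real k" "k\<^sup>2 = (norm l)\<^sup>2"
    by (metis of_real_minus power2_minus)
  have k0: "k \<noteq> 0" using k l(1) by auto
  have "\<gamma> $ 0 $ 0 = of_real (1 / k)" using \<gamma>\<kappa>00 k0 unfolding k(1) by (simp add: field_simps)
  then have \<gamma>r: "\<gamma> $ 0 $ 0 = of_real r" and rk: "r = 1 / k" by (simp_all add: r_def)
  have r0: "r \<noteq> 0" using k0 by (simp add: rk)
  have rl: "r\<^sup>2 * (norm l)\<^sup>2 = 1" using k k0 l(1) by (simp add: rk power_divide)
  then have "(\<bar>r\<bar> * norm l)\<^sup>2 = 1" by (simp add: power_mult_distrib)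
  then have \<epsilon>: "norm (of_real r * l) = 1"
    by (simp add: norm_mult power2_eq_1_iff) (metis abs_ge_zero mult_nonneg_nonneg norm_ge_zero not_one_le_zero neg_0_le_iff_le zero_le_one order.antisym)
  have ccm: "cc a * cc b = cc (a * b)" for a b by simp
  have "\<gamma>\<^sup>2 * P = 1" using \<gamma>\<kappa> by (simp add: P_def flip: power_mult_distrib)
  then have "cc (of_real (r\<^sup>2)) * (\<gamma>\<^sup>2 * (cc (of_real ((norm l)\<^sup>2)) * theta_sq \<alpha> s)) = cc (of_real (r\<^sup>2))"
    unfolding l(2) by simp
  then have "(cc (of_real (r\<^sup>2)) * cc (of_real ((norm l)\<^sup>2))) * (\<gamma>\<^sup>2 * theta_sq \<alpha> s) = cc (of_real (r\<^sup>2))"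
    by (simp only: mult_ac)
  moreover have "cc (of_real (r\<^sup>2)) * cc (of_real ((norm l)\<^sup>2)) = 1"
    unfolding ccm of_real_mult[symmetric] rl by simp
  ultimately have th: "\<gamma>\<^sup>2 * theta_sq \<alpha> s = cc (of_real (r\<^sup>2))" by simp
  have "f * \<gamma> = F * (\<gamma> * \<kappa>)" by (simp add: f_def mult_ac)
  then have "F = f * \<gamma>" using \<gamma>\<kappa> by simp
  then have "cc (of_real r) * F = (cc (of_real r) * cc l) * (zz + cc \<alpha> * ww) * \<gamma>"
    unfolding l(3) by (simp only: mult.assoc)
  then have "cc (of_real r) * F = cc (of_real r * l) * (zz + cc \<alpha> * ww) * \<gamma>" unfolding ccm .
  then show ?thesis using that \<epsilon> r0 G \<gamma>r th by blast
qed

lemma inverse_csqrt_expansion: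
  obtains K where "(\<lambda>x. inverse (csqrt (1 + x))) has_fps_expansion K" "K $ 0 = 1"
proof -
  have re: "1 + x \<notin> \<real>\<^sub>\<le>\<^sub>0" if "norm x < 1" for x :: complex
    using that abs_Re_le_cmod[of x] by (auto simp: complex_nonpos_Reals_iff)
  have "(\<lambda>x. inverse (csqrt (1 + x))) holomorphic_on ball 0 1"
  proof (intro holomorphic_intros)
    fix x :: complex assume "x \<in> ball 0 1"
    then have "1 + x \<notin> \<real>\<^sub>\<le>\<^sub>0" using re by simp
    then show "1 + x \<notin> \<real>\<^sub>\<le>\<^sub>0" "csqrt (1 + x) \<noteq> 0" by auto
  qed
  then have e: "(\<lambda>x. inverse (csqrt (1 + x))) has_fps_expansion fps_expansion (\<lambda>x. inverse (csqrt (1 + x))) 0"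
    by (rule has_fps_expansion_fps_expansion[rotated 2]) auto
  moreover have "fps_expansion (\<lambda>x. inverse (csqrt (1 + x))) 0 $ 0 = 1"
    using has_fps_expansion_imp_0_eq_fps_nth_0[OF e] by simp
  ultimately show ?thesis by (rule that)
qed

text \<open>Convergence follows once \<open>H\<close> equals the Taylor series \<open>H'\<close> of
  the explicit map. Both satisfy the same algebraic relations, so along a line they differ at most
  by the sign of a square root, and the constant term \<open>r\<close> decides it.\<close>

lemma formal_aut_imp_Hmap:
  assumes H: "formal_aut H"
  shows "\<exists>\<epsilon> r \<alpha> s. norm \<epsilon> = 1 \<and> r \<noteq> 0 \<and> represents H (Hmap \<epsilon> r \<alpha> s)"
proof -
  obtain \<epsilon> \<alpha> :: complex and r s :: real and \<gamma> :: nest where \<epsilon>: "norm \<epsilon> = 1" and r: "r \<noteq> 0"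
    and G: "nest2 (H 1) = ww * \<gamma>" "\<gamma> $ 0 $ 0 = of_real r"
    and th: "\<gamma>\<^sup>2 * theta_sq \<alpha> s = cc (of_real (r\<^sup>2))"
    and F: "cc (of_real r) * nest2 (H 0) = cc \<epsilon> * (zz + cc \<alpha> * ww) * \<gamma>"
    using formal_aut_normal_form[OF H] by metis
  obtain H' where H': "represents H' (Hmap \<epsilon> r \<alpha> s)"
    using holomorphic_has_series[OF cholo_Hmap slit_origin] by blast
  obtain K where K: "(\<lambda>x. inverse (csqrt (1 + x))) has_fps_expansion K" "K $ 0 = 1"
    by (rule inverse_csqrt_expansion)
  have eq: "along (pair2 Z W) (H i) = along (pair2 Z W) (H' i)"
    if ZW: "Z = fps_const x * fps_X" "W = fps_const u * fps_X" for x u Z W and i :: 2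
  proof -
    have A: "expands (\<lambda>s. y * of_real s) (fps_const y * fps_X)" for y
      by (rule expands_mult[OF expands_const expands_X])
    define zc where "zc = (\<lambda>s::real. x * of_real s)"
    define wc where "wc = (\<lambda>s::real. u * of_real s)"
    have Z: "expands zc Z" "Z $ 0 = 0" and W: "expands wc W" "W $ 0 = 0"
      unfolding zc_def wc_def ZW using A by auto
    define q where "q = (\<lambda>s'. radicand \<alpha> s (zc s', wc s') - 1)"
    define Q where "Q = along2 Z W (theta_sq \<alpha> s) - 1"
    have cvth: "along2 Z W (theta_sq \<alpha> s) = 1 - fps_const (2 * \<i> * cnj \<alpha>) * Z * W - fps_const (of_real s + \<i> * of_real ((norm \<alpha>)\<^sup>2)) * W\<^sup>2"
      using Z W by (simp add: theta_sq_def along2_diff along2_mult along2_X along2_const power2_eq_square del: fps_const_mult fps_const_add)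
    have q: "q s' = - (2 * \<i> * cnj \<alpha> * zc s' * wc s') - (of_real s + \<i> * of_real ((norm \<alpha>)\<^sup>2)) * (wc s')\<^sup>2" for s'
      by (simp add: q_def radicand_def)
    have qQ: "expands q Q"
    proof -
      have "expands (\<lambda>s'. 1 - (2 * \<i> * cnj \<alpha>) * zc s' * wc s' - (of_real s + \<i> * of_real ((norm \<alpha>)\<^sup>2)) * (wc s')\<^sup>2 - 1) Q"
        unfolding Q_def cvth by (intro expands_diff expands_mult expands_const expands_1 expands_power Z W)
      then show ?thesis by (simp add: q[abs_def] mult.assoc)
    qed
    have Q0: "Q $ 0 = 0" using Z W by (simp add: Q_def cvth power2_eq_square)
    define k where "k = K oo Q"
    define kf where "kf = (\<lambda>s'. inverse (csqrt (1 + q s')))"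
    have kf: "expands kf k" unfolding kf_def k_def by (rule expands_compose[OF K(1) qQ Q0])
    have k0: "k $ 0 = 1" by (simp add: k_def K)
    \<comment> \<open>Proved for functions near 0 and transferred to series by uniqueness of
      expansions.\<close>
    have kth: "k\<^sup>2 * (1 + Q) = 1"
    proof -
      have "expands (\<lambda>s'. (kf s')\<^sup>2 * (1 + q s')) (k\<^sup>2 * (1 + Q))"
        by (intro expands_mult expands_power expands_add expands_1 kf qQ)
      moreover have "\<forall>\<^sub>F s' in at_right 0. (kf s')\<^sup>2 * (1 + q s') = 1"
      proof -
        have "\<forall>\<^sub>F s' in at_right 0. dist (q s') 0 < 1"
          using order_ge_1_imp_tendsto[OF expands_order_ge_1[OF qQ Q0]] by (intro tendstoD) auto
        then show ?thesis
        proof eventually_elim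
          case (elim s')
          have "1 + q s' \<noteq> 0"
          proof
            assume "1 + q s' = 0"
            then have "q s' = -1" by (simp add: eq_neg_iff_add_eq_0 add.commute)
            then show False using elim by simp
          qed
          then show ?case by (simp add: kf_def power_inverse)
        qed
      qed
      ultimately have "expands (\<lambda>_. 1) (k\<^sup>2 * (1 + Q))" by (rule expands_cong[rotated])
      then show ?thesis using expands_1 by (rule expands_unique)
    qed
    have hm: "Hmap \<epsilon> r \<alpha> s (zc s', wc s') = (\<epsilon> * (zc s' + \<alpha> * wc s') * kf s', of_real r * wc s' * kf s')" for s'
      by (simp add: Hmap_eq kf_def q_def)
    have "expands (\<lambda>s'. fst (Hmap \<epsilon> r \<alpha> s (zc s', wc s'))) (fps_const \<epsilon> * (Z + fps_const \<alpha> * W) * k)"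
      "expands (\<lambda>s'. snd (Hmap \<epsilon> r \<alpha> s (zc s', wc s'))) (fps_const (of_real r) * W * k)"
      unfolding hm fst_conv snd_conv by (intro expands_mult expands_const expands_add Z W kf)+
    then have H'01: "along (pair2 Z W) (H' 0) = fps_const \<epsilon> * (Z + fps_const \<alpha> * W) * k"
      "along (pair2 Z W) (H' 1) = fps_const (of_real r) * W * k"
      using expands_represented[OF H' Z W] expands_unique by blast+
    define g where "g = along2 Z W \<gamma>"
    have "g\<^sup>2 * (1 + Q) = fps_const (of_real (r\<^sup>2))"
      using arg_cong[OF th, of "along2 Z W"] Z W by (simp add: along2_mult g_def Q_def power2_eq_square)
    then have "g\<^sup>2 * (1 + Q) = (fps_const (of_real r) * k)\<^sup>2 * (1 + Q)"
      using kth by (simp add: power_mult_distrib mult.assoc)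
    moreover have "1 + Q \<noteq> 0" using kth by auto
    ultimately have "g\<^sup>2 = (fps_const (of_real r) * k)\<^sup>2" by simp
    then have "g = fps_const (of_real r) * k \<or> g = - (fps_const (of_real r) * k)"
      by (simp only: power2_eq_iff)
    moreover have "g $ 0 = of_real r" using G(2) by (simp add: g_def along2_nth)
    ultimately have g: "g = fps_const (of_real r) * k" using k0 r by auto
    have H1: "along (pair2 Z W) (H 1) = along (pair2 Z W) (H' 1)"
      unfolding H'01 using Z W by (simp add: along_pair2 G along2_mult along2_X g flip: g_def)
    have "fps_const (of_real r) * along (pair2 Z W) (H 0) = fps_const \<epsilon> * (Z + fps_const \<alpha> * W) * g"
      using arg_cong[OF F, of "along2 Z W"] Z W by (simp add: along_pair2 along2_mult along2_add along2_X along2_const g_def)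
    then have "fps_const (of_real r) * along (pair2 Z W) (H 0) = fps_const (of_real r) * along (pair2 Z W) (H' 0)"
      unfolding g H'01 by (simp only: mult_ac)
    then have H0: "along (pair2 Z W) (H 0) = along (pair2 Z W) (H' 0)" using r by simp
    have "\<forall>i. along (pair2 Z W) (H i) = along (pair2 Z W) (H' i)"
      unfolding all_2 using H0 H1 by blast
    then show ?thesis ..
  qed
  have "H i = H' i" for i
  proof (rule test_set_eq[OF test_set_UNIV])
    fix x :: "2 \<Rightarrow> complex"
    let ?c = "pair2 (fps_const (x 0) * fps_X) (fps_const (x 1) * fps_X)"
    have "\<forall>v. ?c v $ 0 = 0 \<and> ?c v $ 1 = x v" unfolding all_2 by simp
    then show "\<exists>c. (\<forall>v. c v $ 0 = 0 \<and> c v $ 1 = x v) \<and> along c (H i) = along c (H' i)"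
      using eq[OF refl refl] by blast
  qed
  then have "H = H'" by (rule ext)
  then show ?thesis using \<epsilon> r H' by blast
qed

lemma represents_imp_germ_eq:
  assumes "represents H F" "represents H F'"
  shows "germ_eq F F'"
proof -
  obtain \<delta> where \<delta>: "\<delta> > 0" "\<And>z w. norm z < \<delta> \<Longrightarrow> norm w < \<delta> \<Longrightarrow> F (z, w) = (mp_eval (H 0) (pt2 z w), mp_eval (H 1) (pt2 z w))"
    using assms(1) unfolding represents_def by blast
  obtain \<delta>' where \<delta>': "\<delta>' > 0" "\<And>z w. norm z < \<delta>' \<Longrightarrow> norm w < \<delta>' \<Longrightarrow> F' (z, w) = (mp_eval (H 0) (pt2 z w), mp_eval (H 1) (pt2 z w))"
    using assms(2) unfolding represents_def by blast
  let ?U = "ball 0 (min \<delta> \<delta>') \<times> ball 0 (min \<delta> \<delta>')"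
  have "open ?U" "(0, 0) \<in> ?U" using \<delta>(1) \<delta>'(1) by (auto intro: open_Times)
  moreover have "\<forall>p\<in>?U. F p = F' p" using \<delta>(2) \<delta>'(2) by auto
  ultimately show ?thesis unfolding germ_eq_def by blast
qed

lemma germ_eq_refl: "germ_eq F F"
  unfolding germ_eq_def by (rule exI[of _ UNIV]) simp

theorem theorem1p1:
  shows "(\<forall>H. formal_aut H \<longrightarrow> (\<forall>i. mp_converges (H i)))
    \<and> (\<forall>H. formal_aut H \<longleftrightarrow> (\<exists>F\<in>Aut_M0. represents H F))
    \<and> (\<forall>H. formal_aut H \<longleftrightarrow>
          (\<exists>\<epsilon> r \<alpha> s. norm \<epsilon> = 1 \<and> r \<noteq> 0 \<and> represents H (Hmap \<epsilon> r \<alpha> s)))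
    \<and> (\<forall>F. F \<in> Aut_M0 \<longleftrightarrow>
          (\<exists>\<epsilon> r \<alpha> s. norm \<epsilon> = 1 \<and> r \<noteq> 0 \<and> germ_eq F (Hmap \<epsilon> r \<alpha> s)))"
proof (intro conjI allI iffI impI)
  show "mp_converges (H i)" if "formal_aut H" for H i
    using formal_aut_imp_Hmap[OF that] by (auto simp: represents_def)
  show "\<exists>F\<in>Aut_M0. represents H F" if "formal_aut H" for H
    using formal_aut_imp_Hmap[OF that] Hmap_in_Aut[OF _ _ germ_eq_refl] by blast
  show "formal_aut H" if "\<exists>F\<in>Aut_M0. represents H F" for H
    using that Aut_imp_formal_aut by blast
  show "\<exists>\<epsilon> r \<alpha> s. norm \<epsilon> = 1 \<and> r \<noteq> 0 \<and> represents H (Hmap \<epsilon> r \<alpha> s)" if "formal_aut H" for H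
    by (rule formal_aut_imp_Hmap[OF that])
  show "formal_aut H" if "\<exists>\<epsilon> r \<alpha> s. norm \<epsilon> = 1 \<and> r \<noteq> 0 \<and> represents H (Hmap \<epsilon> r \<alpha> s)" for H
    using that Aut_imp_formal_aut Hmap_in_Aut[OF _ _ germ_eq_refl] by blast
  show "F \<in> Aut_M0" if "\<exists>\<epsilon> r \<alpha> s. norm \<epsilon> = 1 \<and> r \<noteq> 0 \<and> germ_eq F (Hmap \<epsilon> r \<alpha> s)" for F
    using that Hmap_in_Aut by blast
  show "\<exists>\<epsilon> r \<alpha> s. norm \<epsilon> = 1 \<and> r \<noteq> 0 \<and> germ_eq F (Hmap \<epsilon> r \<alpha> s)" if F: "F \<in> Aut_M0" for F
  proof -
    obtain U where "(0, 0) \<in> U" "cholo F U" using F unfolding Aut_M0_def by blast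
    then obtain H where H: "represents H F" using holomorphic_has_series by blast
    then have "formal_aut H" using Aut_imp_formal_aut F by blast
    then show ?thesis using formal_aut_imp_Hmap represents_imp_germ_eq[OF H] by meson
  qed
qed

end
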